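(* Let $X$ be a rearrangement invariant space over $(-1,1)$ satisfying $0<\underline{\alpha}_X\le\overline{\alpha}_X<1$. Then every function $f\in[T,X]\subseteq L^1(m_{\widehat X})$ satisfies $$\int_Af\,dm_{\widehat X}=T(f\chi_A)\in X,\qquad A\in\mathscr{B}.$$ Consequently, the linear operator $T\colon[T,X]\to X$ admits the $X$-valued integral representation given by $$T(f)=\int_{-1}^1f\,dm_{\widehat X}\in X,\qquad f\in[T,X].$$
   Context: Let $\mu$ be Lebesgue measure on the Borel $\sigma$-algebra $\mathscr{B}$ of $(-1,1)$, let $\mathrm{sim}\,\mathscr{B}$ be the space of all $\mathbb{C}$-valued $\mathscr{B}$-simple functions, and let $L^0$ be the complex vector lattice of all $\mathbb{C}$-valued $\mathscr{B}$-measurable functions on $(-1,1)$ (functions equal a.e. are identified). $L^p$ means $L^p(-1,1)$, and $p'$ is the conjugate exponent of $p$. A Banach function space (B.f.s.) over $(-1,1)$ is an order ideal $X$ of $L^0$ with $\mathrm{sim}\,\mathscr{B}\subseteq X$, equipped with a lattice norm $\|\cdot\|_X$ for which $X$ is complete. It has the Fatou property if, whenever $\{f_n\}$ is a norm-bounded increasing sequence of positive functions in $X$ with $f=\sup_n f_n$ in $L^0$, then $f\in X$ and $\|f_n\|_X\to\|f\|_X$. For $f\in L^0$ the decreasing rearrangement $f^*\colon[0,2]\to[0,\infty]$ is the right continuous inverse of the distribution function $\lambda\mapsto\mu(\{|f|>\lambda\})$. A B.f.s. $X$ over $(-1,1)$ with the Fatou property is rearrangement invariant (r.i.) if $g\in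 L^0$ and $g^*\le f^*$ for some $f\in X$ imply $g\in X$. Then $L^\infty\subseteq X\subseteq L^1$ continuously. For $t>0$ the dilation operator $E_t\colon X\to X$ is $E_t(f)(x)=f(tx)$ if $-1<tx<1$ and $0$ otherwise. The Boyd indices are $\underline{\alpha}_X=\sup_{0<t<1}\frac{\log\|E_{1/t}\|_{\mathrm{op}}}{\log t}$ and $\overline{\alpha}_X=\inf_{1<t<\infty}\frac{\log\|E_{1/t}\|_{\mathrm{op}}}{\log t}$. The finite Hilbert transform of $f\in L^1$ is $T(f)(t)=\lim_{\varepsilon\to0+}\frac1\pi\left(\int_{-1}^{t-\varepsilon}+\int_{t+\varepsilon}^1\right)\frac{f(x)}{x-t}\,dx$, which exists for a.e. $t\in(-1,1)$; $T(f)\in L^0$. If $X$ is r.i. with $0<\underline{\alpha}_X\le\overline{\alpha}_X<1$, then $T$ maps $X$ boundedly into $X$ and $T_X\colon X\to X$ denotes this operator. Define $[T,X]=\{f\in L^1: T(h)\in X\text{ for all }h\in L^0\text{ with }|h|\le|f|\text{ a.e.}\}$ with norm $\|f\|_{[T,X]}=\sup_{|h|\le|f|}\|T(h)\|_X$; it is a B.f.s. over $(-1,1)$ with the Fatou property. Let $J_X=\{p\in(1,\infty):X\subseteq L^p\}$, a non-empty bounded interval, and $\widehat X=\bigcap_{p\in J_X}L^p$, with the locally convex topology generated by the norms $\|\cdot\|_{L^p}$, $p\in J_X$. It is a reflexive Fréchet space (equal to $L^{p_X}$ if $p_X:=\sup J_X\in J_X$) containing $X$ continuously, and $(\widehat X)^*=\bigcup_{p\in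 J_X}L^{p'}$ via $\langle f,g\rangle=\int_{-1}^1fg\,d\mu$. $m_{\widehat X}\colon\mathscr{B}\to\widehat X$ is the $\sigma$-additive vector measure $A\mapsto T(\chi_A)$. A function $f\in L^0$ is scalarly $m_{\widehat X}$-integrable if it is integrable with respect to the complex measure $\langle m_{\widehat X},g\rangle\colon A\mapsto\langle m_{\widehat X}(A),g\rangle$ for every $g\in(\widehat X)^*$; such an $f$ is $m_{\widehat X}$-integrable if for every $A\in\mathscr{B}$ there is a unique $\int_Af\,dm_{\widehat X}\in\widehat X$ with $\langle\int_Af\,dm_{\widehat X},g\rangle=\int_Af\,d\langle m_{\widehat X},g\rangle$ for every $g\in(\widehat X)^*$. $L^1(m_{\widehat X})$ denotes the space of (equivalence classes modulo $m_{\widehat X}$-a.e. equality of) $m_{\widehat X}$-integrable functions; a set $A\in\mathscr{B}$ is $m_{\widehat X}$-null if $m_{\widehat X}(B)=0$ for all $B\in\mathscr{B}$, $B\subseteq A$, and the $m_{\widehat X}$-null and $\mu$-null sets coincide. *)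

theory Defs
  imports "HOL-Analysis.Analysis"
begin

text \<open>Function spaces are sets of representatives \<^typ>\<open>real \<Rightarrow> complex\<close>; equality of elements is
  equality almost everywhere with respect to \<open>mu\<close>. Values outside \<open>(-1,1)\<close> are irrelevant.\<close>

definition mu :: "real measure" where
  "mu = restrict_space lborel {-1<..<1}"

definition L0 :: "(real \<Rightarrow> complex) set" where
  "L0 = borel_measurable mu"

definition Lp :: "real \<Rightarrow> (real \<Rightarrow> complex) set" where
  "Lp p = {f \<in> L0. integrable mu (\<lambda>x. norm (f x) powr p)}"

definition conjugate_exponent :: "real \<Rightarrow> real" where
  "conjugate_exponent p = p / (p - 1)"

section \<open>Banach function spaces\<close>

text \<open>A normed function space is a carrier \<open>X\<close> together with a function \<open>N\<close> of which only the
  values on \<open>X\<close> matter. The ideal property makes \<open>X\<close> closed under a.e. equality, and the lattice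
  property makes \<open>N\<close> invariant under it.\<close>

definition order_ideal :: "(real \<Rightarrow> complex) set \<Rightarrow> bool" where
  "order_ideal X \<longleftrightarrow>
     X \<subseteq> L0 \<and> (\<lambda>x. 0) \<in> X \<and>
     (\<forall>f\<in>X. \<forall>g\<in>X. (\<lambda>x. f x + g x) \<in> X) \<and>
     (\<forall>c. \<forall>f\<in>X. (\<lambda>x. c * f x) \<in> X) \<and>
     (\<forall>f\<in>X. \<forall>g\<in>L0. (AE x in mu. norm (g x) \<le> norm (f x)) \<longrightarrow> g \<in> X)"

definition lattice_norm ::
    "(real \<Rightarrow> complex) set \<Rightarrow> ((real \<Rightarrow> complex) \<Rightarrow> real) \<Rightarrow> bool" where
  "lattice_norm X N \<longleftrightarrow>
     (\<forall>f\<in>X. 0 \<le> N f) \<and>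
     (\<forall>f\<in>X. N f = 0 \<longleftrightarrow> (AE x in mu. f x = 0)) \<and>
     (\<forall>c. \<forall>f\<in>X. N (\<lambda>x. c * f x) = norm c * N f) \<and>
     (\<forall>f\<in>X. \<forall>g\<in>X. N (\<lambda>x. f x + g x) \<le> N f + N g) \<and>
     (\<forall>f\<in>X. \<forall>g\<in>X. (AE x in mu. norm (g x) \<le> norm (f x)) \<longrightarrow> N g \<le> N f)"

definition norm_complete ::
    "(real \<Rightarrow> complex) set \<Rightarrow> ((real \<Rightarrow> complex) \<Rightarrow> real) \<Rightarrow> bool" where
  "norm_complete X N \<longleftrightarrow>
     (\<forall>u. (\<forall>n. u n \<in> X) \<and>
          (\<forall>e>0. \<exists>n0::nat. \<forall>m\<ge>n0. \<forall>n\<ge>n0. N (\<lambda>x. u m x - u n x) < e) \<longrightarrow>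
          (\<exists>f\<in>X. (\<lambda>n. N (\<lambda>x. u n x - f x)) \<longlonglongrightarrow> 0))"

definition banach_function_space ::
    "(real \<Rightarrow> complex) set \<Rightarrow> ((real \<Rightarrow> complex) \<Rightarrow> real) \<Rightarrow> bool" where
  "banach_function_space X N \<longleftrightarrow>
     order_ideal X \<and> {f. simple_function mu f} \<subseteq> X \<and> lattice_norm X N \<and> norm_complete X N"

text \<open>Supremum of a sequence in the real part of the vector lattice \<open>L0\<close>.\<close>

definition is_sup_L0 :: "(nat \<Rightarrow> real \<Rightarrow> real) \<Rightarrow> (real \<Rightarrow> real) \<Rightarrow> bool" where
  "is_sup_L0 u f \<longleftrightarrow>
     f \<in> borel_measurable mu \<and>
     (\<forall>n. AE x in mu. u n x \<le> f x) \<and>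
     (\<forall>g \<in> borel_measurable mu. (\<forall>n. AE x in mu. u n x \<le> g x) \<longrightarrow> (AE x in mu. f x \<le> g x))"

text \<open>Positive elements of \<open>X\<close> are represented by real-valued functions.\<close>

definition fatou_property ::
    "(real \<Rightarrow> complex) set \<Rightarrow> ((real \<Rightarrow> complex) \<Rightarrow> real) \<Rightarrow> bool" where
  "fatou_property X N \<longleftrightarrow>
     (\<forall>(u :: nat \<Rightarrow> real \<Rightarrow> real) f.
        (\<forall>n. (\<lambda>x. complex_of_real (u n x)) \<in> X) \<and>
        (\<forall>n. AE x in mu. 0 \<le> u n x) \<and>
        (\<forall>n. AE x in mu. u n x \<le> u (Suc n) x) \<and>
        bdd_above (range (\<lambda>n. N (\<lambda>x. complex_of_real (u n x)))) \<and>
        is_sup_L0 u f \<longrightarrow>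
        (\<lambda>x. complex_of_real (f x)) \<in> X \<and>
        (\<lambda>n. N (\<lambda>x. complex_of_real (u n x))) \<longlonglongrightarrow> N (\<lambda>x. complex_of_real (f x)))"

section \<open>Rearrangement invariance and Boyd indices\<close>

definition distribution_function :: "(real \<Rightarrow> complex) \<Rightarrow> real \<Rightarrow> real" where
  "distribution_function f l = measure mu {x \<in> space mu. norm (f x) > l}"

text \<open>The right continuous inverse of the distribution function; the infimum of the empty set is
  \<open>\<infinity>\<close>, which can only occur at \<open>t = 0\<close>.\<close>

definition decreasing_rearrangement :: "(real \<Rightarrow> complex) \<Rightarrow> real \<Rightarrow> ennreal" where
  "decreasing_rearrangement f t = Inf {ennreal l | l. 0 \<le> l \<and> distribution_function f l \<le> t}"

definition rearrangement_invariant ::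
    "(real \<Rightarrow> complex) set \<Rightarrow> ((real \<Rightarrow> complex) \<Rightarrow> real) \<Rightarrow> bool" where
  "rearrangement_invariant X N \<longleftrightarrow>
     banach_function_space X N \<and> fatou_property X N \<and>
     (\<forall>f\<in>X. \<forall>g\<in>L0.
        (\<forall>t\<in>{0..2}. decreasing_rearrangement g t \<le> decreasing_rearrangement f t) \<longrightarrow> g \<in> X)"

definition dilation :: "real \<Rightarrow> (real \<Rightarrow> complex) \<Rightarrow> real \<Rightarrow> complex" where
  "dilation t f x = (if -1 < t * x \<and> t * x < 1 then f (t * x) else 0)"

text \<open>A real supremum: dilations are bounded operators on every rearrangement invariant space.\<close>

definition op_norm ::
    "(real \<Rightarrow> complex) set \<Rightarrow> ((real \<Rightarrow> complex) \<Rightarrow> real) \<Rightarrow>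
     ((real \<Rightarrow> complex) \<Rightarrow> real \<Rightarrow> complex) \<Rightarrow> real" where
  "op_norm X N S = (SUP f\<in>{f \<in> X. N f \<le> 1}. N (S f))"

definition lower_boyd_index ::
    "(real \<Rightarrow> complex) set \<Rightarrow> ((real \<Rightarrow> complex) \<Rightarrow> real) \<Rightarrow> ereal" where
  "lower_boyd_index X N = (SUP t\<in>{0<..<1}. ereal (ln (op_norm X N (dilation (1 / t))) / ln t))"

definition upper_boyd_index ::
    "(real \<Rightarrow> complex) set \<Rightarrow> ((real \<Rightarrow> complex) \<Rightarrow> real) \<Rightarrow> ereal" where
  "upper_boyd_index X N = (INF t\<in>{1<..}. ereal (ln (op_norm X N (dilation (1 / t))) / ln t))"

section \<open>The finite Hilbert transform and its optimal domain\<close>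

text \<open>For integrable \<open>f\<close> the limit exists for almost every \<open>t\<close> in \<open>(-1,1)\<close>; where it does not
  exist, \<^const>\<open>Lim\<close> is a fixed unspecified constant.\<close>

definition finite_hilbert :: "(real \<Rightarrow> complex) \<Rightarrow> real \<Rightarrow> complex" where
  "finite_hilbert f t =
     Lim (at_right 0) (\<lambda>\<epsilon>. complex_of_real (1 / pi) *
       ((LINT x:{-1<..<t - \<epsilon>}|lborel. f x / complex_of_real (x - t)) +
        (LINT x:{t + \<epsilon><..<1}|lborel. f x / complex_of_real (x - t))))"

definition optimal_domain :: "(real \<Rightarrow> complex) set \<Rightarrow> (real \<Rightarrow> complex) set" where
  "optimal_domain X =
     {f. integrable mu f \<and>
         (\<forall>h\<in>L0. (AE x in mu. norm (h x) \<le> norm (f x)) \<longrightarrow> finite_hilbert h \<in> X)}"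

section \<open>The space \<open>X_hat\<close> and its dual\<close>

definition J :: "(real \<Rightarrow> complex) set \<Rightarrow> real set" where
  "J X = {p. 1 < p \<and> X \<subseteq> Lp p}"

definition X_hat :: "(real \<Rightarrow> complex) set \<Rightarrow> (real \<Rightarrow> complex) set" where
  "X_hat X = (\<Inter>p\<in>J X. Lp p)"

text \<open>The dual of the Frechet space \<open>X_hat X\<close>, identified with a space of functions through
  \<open>pairing\<close>.\<close>

definition X_hat_dual :: "(real \<Rightarrow> complex) set \<Rightarrow> (real \<Rightarrow> complex) set" where
  "X_hat_dual X = (\<Union>p\<in>J X. Lp (conjugate_exponent p))"

definition pairing :: "(real \<Rightarrow> complex) \<Rightarrow> (real \<Rightarrow> complex) \<Rightarrow> complex" where
  "pairing f g = (LINT x|mu. f x * g x)"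

section \<open>Integration with respect to complex measures\<close>

text \<open>The positive variation \<open>A \<mapsto> sup {nu B | B \<subseteq> A}\<close> of a real set function on the Borel sets of
  \<open>(-1,1)\<close>; since the empty set competes, truncation of negative values by \<^const>\<open>ennreal\<close> is
  harmless. For a countably additive \<open>nu\<close> it is a finite measure, and \<open>nu\<close> is the difference of
  the positive variations of \<open>nu\<close> and \<open>- nu\<close> (Jordan decomposition).\<close>

definition pos_variation :: "(real set \<Rightarrow> real) \<Rightarrow> real measure" where
  "pos_variation \<nu> =
     measure_of (space mu) (sets mu) (\<lambda>A. SUP B\<in>{B \<in> sets mu. B \<subseteq> A}. ennreal (\<nu> B))"

text \<open>A function is integrable with respect to a complex measure iff it is integrable with respect
  to its total variation, equivalently with respect to the four Jordan components.\<close>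

definition cmeasure_integrable :: "(real set \<Rightarrow> complex) \<Rightarrow> (real \<Rightarrow> complex) \<Rightarrow> bool" where
  "cmeasure_integrable \<nu> f \<longleftrightarrow>
     integrable (pos_variation (\<lambda>A. Re (\<nu> A))) f \<and>
     integrable (pos_variation (\<lambda>A. - Re (\<nu> A))) f \<and>
     integrable (pos_variation (\<lambda>A. Im (\<nu> A))) f \<and>
     integrable (pos_variation (\<lambda>A. - Im (\<nu> A))) f"

definition cmeasure_integral ::
    "(real set \<Rightarrow> complex) \<Rightarrow> real set \<Rightarrow> (real \<Rightarrow> complex) \<Rightarrow> complex" where
  "cmeasure_integral \<nu> A f =
     ((LINT x:A|pos_variation (\<lambda>B. Re (\<nu> B)). f x) -
      (LINT x:A|pos_variation (\<lambda>B. - Re (\<nu> B)). f x)) +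
     \<i> * ((LINT x:A|pos_variation (\<lambda>B. Im (\<nu> B)). f x) -
          (LINT x:A|pos_variation (\<lambda>B. - Im (\<nu> B)). f x))"

section \<open>Integration with respect to the vector measure\<close>

text \<open>The formula for the vector measure does not depend on \<open>X\<close>; only its codomain \<open>X_hat X\<close>
  and hence the dual in which it is tested do.\<close>

definition m_hat :: "real set \<Rightarrow> real \<Rightarrow> complex" where
  "m_hat A = finite_hilbert (indicator A)"

definition m_hat_scalar :: "(real \<Rightarrow> complex) \<Rightarrow> real set \<Rightarrow> complex" where
  "m_hat_scalar g A = pairing (m_hat A) g"

definition scalarly_m_hat_integrable ::
    "(real \<Rightarrow> complex) set \<Rightarrow> (real \<Rightarrow> complex) \<Rightarrow> bool" where
  "scalarly_m_hat_integrable X f \<longleftrightarrow>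
     f \<in> L0 \<and> (\<forall>g\<in>X_hat_dual X. cmeasure_integrable (m_hat_scalar g) f)"

definition is_m_hat_integral ::
    "(real \<Rightarrow> complex) set \<Rightarrow> real set \<Rightarrow> (real \<Rightarrow> complex) \<Rightarrow> (real \<Rightarrow> complex) \<Rightarrow> bool" where
  "is_m_hat_integral X A f h \<longleftrightarrow>
     h \<in> X_hat X \<and>
     (\<forall>g\<in>X_hat_dual X. pairing h g = cmeasure_integral (m_hat_scalar g) A f)"

definition L1_m_hat :: "(real \<Rightarrow> complex) set \<Rightarrow> (real \<Rightarrow> complex) set" where
  "L1_m_hat X =
     {f. scalarly_m_hat_integrable X f \<and>
         (\<forall>A\<in>sets mu. \<exists>h. is_m_hat_integral X A f h \<and>
            (\<forall>h'. is_m_hat_integral X A f h' \<longrightarrow> (AE x in mu. h' x = h x)))}"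

text \<open>A representative of the integral, determined up to a.e. equality for \<open>f \<in> L1_m_hat X\<close>.\<close>

definition m_hat_integral ::
    "(real \<Rightarrow> complex) set \<Rightarrow> real set \<Rightarrow> (real \<Rightarrow> complex) \<Rightarrow> real \<Rightarrow> complex" where
  "m_hat_integral X A f = (SOME h. is_m_hat_integral X A f h)"

end

theory Submission
  imports Defs "HOL-Complex_Analysis.Complex_Analysis" "HOL-Real_Asymp.Real_Asymp"
begin

text \<open>
  Write \<open>T\<close> for the finite Hilbert transform. Let \<open>f\<close> belong to the optimal domain, let \<open>p\<close> be an
  exponent in \<open>J X\<close> with conjugate exponent \<open>q\<close>, and let \<open>g\<close> be in \<open>L\<^sup>q\<close>. By Parseval's formula \<open>\<integral>
  T \<phi> g = - \<integral> \<phi> T g\<close> for bounded \<open>\<phi>\<close> (\<open>parseval\<close>), the scalar measure \<open>A \<mapsto> \<integral> T \<chi>\<^sub>A g\<close> has the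
  integrable density \<open>- T g\<close>. So the statement amounts to two facts: \<open>f T g\<close> is integrable, and \<open>\<integral>
  T (f \<chi>\<^sub>A) g = - \<integral> f \<chi>\<^sub>A T g\<close> (\<open>optimal_domain_duality\<close>).

  Neither is covered by Parseval's formula, because \<open>f\<close> is only integrable. What saves them is a
  uniform bound: by a Baire category argument the norms of \<open>T (\<phi> f)\<close> in \<open>L\<^sup>p\<close> are bounded as \<open>\<phi>\<close>
  runs through the measurable functions with \<open>|\<phi>| \<le> 1\<close> (\<open>optimal_domain_uniform_bound\<close>). Take \<open>\<phi>\<close>
  to be the indicator of a set \<open>{|f| \<le> n}\<close> times the phase that makes \<open>\<phi> f T g\<close> nonnegative.
  Parseval's formula and the bound then control \<open>\<integral> |f T g|\<close> over this set, uniformly in \<open>n\<close>. The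
  identity follows by letting \<open>n\<close> tend to infinity, since a sequence that is bounded in \<open>L\<^sup>p\<close> and
  converges almost everywhere converges weakly (\<open>weak_limit_of_bounded_sequence\<close>).

  Everything rests on three properties of \<open>T\<close>, the first two of which are proved by complex
  analysis. Let \<open>F\<close> be the Cauchy transform of a real function \<open>h\<close>. The real part of \<open>F\<close> is the
  conjugate Poisson integral of \<open>h\<close>, which approximates \<open>T h\<close>, and its imaginary part is the
  Poisson integral.
  \<^item> If \<open>h\<close> is nonnegative then so is the imaginary part of \<open>F\<close>, and the square root of \<open>F\<close> takes
    values in the first quadrant. So the modulus of the root is controlled by the harmonic
    function Re + Im. With the Poisson representation and the Hardy-Littlewood inequality this
    makes the truncated transforms of a function of small \<open>L\<^sup>1\<close> norm uniformly small off a small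
    set (\<open>truncations_small_off_small_set\<close>). Since principal values exist for indicators of
    half-lines, they exist almost everywhere for every integrable function
    (\<open>AE_pv_limit_finite_hilbert\<close>), and convergence in \<open>L\<^sup>1\<close> implies almost everywhere convergence
    of the transforms along a subsequence (\<open>finite_hilbert_AE_subsequence\<close>).
  \<^item> If \<open>|h| \<le> 1\<close> then \<open>|Im F| \<le> 1\<close>, so the real parts of \<open>exp F\<close> and \<open>exp (- F)\<close> are positive and
    comparable to their moduli. This makes \<open>exp |T h|\<close> integrable, hence \<open>T\<close> maps bounded
    functions into all \<open>L\<^sup>p\<close> with \<open>p\<close> finite (\<open>finite_hilbert_bounded_powr\<close>).
  \<^item> By duality \<open>T\<close> maps \<open>L\<^sup>q\<close> into \<open>L\<^sup>1\<close> for \<open>q > 1\<close> (\<open>finite_hilbert_L1_bound\<close>), and Parseval's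
    formula extends from bounded functions to \<open>L\<^sup>q\<close>.

  Uniqueness of the integral needs a nonempty \<open>J X\<close>. An upper Boyd index below one says that some
  dilation of factor \<open>t > 1\<close> has norm less than \<open>t\<close>. Iterating it on the symmetric decreasing
  rearrangement gives a power decay of the distribution function with exponent greater than one
  (\<open>J_nonempty_of_upper_boyd_index\<close>).\<close>

section \<open>Poisson integrals of bounded holomorphic functions\<close>

definition poisson_kernel :: "real \<Rightarrow> real \<Rightarrow> real" where
  "poisson_kernel y s = y / (pi * (s\<^sup>2 + y\<^sup>2))"

lemma poisson_kernel_nonneg: "0 < y \<Longrightarrow> 0 \<le> poisson_kernel y s"
  by (simp add: poisson_kernel_def)

lemma poisson_kernel_minus [simp]: "poisson_kernel y (- s) = poisson_kernel y s"
  by (simp add: poisson_kernel_def)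

lemma poisson_kernel_measurable [measurable]: "poisson_kernel y \<in> borel_measurable borel"
  unfolding poisson_kernel_def by measurable

lemma nn_integral_poisson_kernel_half:
  assumes "0 < y"
  shows "(\<integral>\<^sup>+s. ennreal (poisson_kernel y s) * indicator {0..} s \<partial>lborel) = ennreal (1/2)"
proof -
  have "(\<integral>\<^sup>+s. ennreal (poisson_kernel y s) * indicator {0..} s \<partial>lborel)
      = ennreal (1/2) - ennreal (arctan (0 / y) / pi)"
  proof (subst nn_integral_FTC_atLeast[where F = "\<lambda>s. arctan (s / y) / pi" and T = "1/2"])
    show "((\<lambda>s. arctan (s / y) / pi) has_real_derivative poisson_kernel y s) (at s)" if "0 \<le> s" for s
    proof -
      have "((\<lambda>s. arctan (s / y) / pi) has_real_derivative
              inverse (1 + (s / y)\<^sup>2) * (1 / y) / pi) (at s)"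
        using assms by (auto intro!: derivative_eq_intros)
      moreover have "y\<^sup>2 + s\<^sup>2 \<noteq> 0" using assms
        by (metis less_irrefl sum_power2_eq_zero_iff)
      hence "inverse (1 + (s / y)\<^sup>2) * (1 / y) / pi = poisson_kernel y s"
        using assms unfolding poisson_kernel_def
        by (simp add: field_simps power2_eq_square)
      ultimately show ?thesis by simp
    qed
    have "filterlim (\<lambda>s. s / y) at_top at_top"
      using assms by real_asymp
    hence "((\<lambda>s. arctan (s / y) / pi) \<longlongrightarrow> (pi/2) / pi) at_top"
      by (intro tendsto_intros filterlim_compose[OF tendsto_arctan_at_top]) auto
    thus "((\<lambda>s. arctan (s / y) / pi) \<longlongrightarrow> 1/2) at_top" by simp
  qed (use assms poisson_kernel_nonneg in \<open>auto\<close>)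
  thus ?thesis by simp
qed

lemma nn_integral_poisson_kernel:
  assumes "0 < y"
  shows "(\<integral>\<^sup>+s. ennreal (poisson_kernel y s) \<partial>lborel) = 1"
proof -
  let ?P = "\<lambda>s. ennreal (poisson_kernel y s)"
  have neg: "(\<integral>\<^sup>+s. ?P s * indicator {..0} s \<partial>lborel) = (\<integral>\<^sup>+s. ?P s * indicator {0..} s \<partial>lborel)"
    by (subst nn_integral_real_affine[where c = "-1" and t = 0])
       (auto intro!: nn_integral_cong simp: indicator_def)
  have "(\<integral>\<^sup>+s. ?P s \<partial>lborel) = (\<integral>\<^sup>+s. ?P s * indicator {0..} s + ?P s * indicator {..0} s \<partial>lborel)"
  proof (rule nn_integral_cong_AE)
    have "AE s in lborel. s \<noteq> (0::real)" by (rule AE_lborel_singleton)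
    thus "AE s in lborel. ?P s = ?P s * indicator {0..} s + ?P s * indicator {..0} s"
      by eventually_elim (auto simp: indicator_def)
  qed
  also have "\<dots> = ennreal (1/2) + ennreal (1/2)"
    by (subst nn_integral_add) (auto simp: neg nn_integral_poisson_kernel_half[OF assms])
  also have "\<dots> = ennreal (1/2 + 1/2)" by (rule ennreal_plus[symmetric]) auto
  also have "\<dots> = 1" by simp
  finally show ?thesis .
qed

lemma nn_integral_poisson_kernel_shift:
  assumes "0 < y"
  shows "(\<integral>\<^sup>+s. ennreal (poisson_kernel y (t - s)) \<partial>lborel) = 1"
  using nn_integral_real_affine[where c = "-1" and t = t and f = "\<lambda>s. ennreal (poisson_kernel y s)"]
  by (simp add: nn_integral_poisson_kernel[OF assms])

lemma poisson_kernel_integrable: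
  assumes "0 < y"
  shows "integrable lborel (\<lambda>s. poisson_kernel y (t - s))"
  by (rule integrableI_nonneg)
     (auto simp: nn_integral_poisson_kernel_shift[OF assms] poisson_kernel_nonneg[OF assms])

lemma poisson_kernel_integral:
  assumes "0 < y"
  shows "(\<integral>s. poisson_kernel y (t - s) \<partial>lborel) = 1"
  by (subst integral_eq_nn_integral)
     (auto simp: nn_integral_poisson_kernel_shift[OF assms] poisson_kernel_nonneg[OF assms])

text \<open>Apply Cauchy's formula on a rectangle standing on the real line. Reflecting the pole \<open>w\<close> to
  \<open>cnj w\<close>, outside the rectangle, turns the Cauchy kernel into one that decays quadratically. On the
  base this is the Poisson kernel, and the other three sides contribute \<open>O(1/R)\<close>.\<close>

lemma truncated_poisson_representation:
  assumes G: "G holomorphic_on {z. - d < Im z}" and d: "0 < d"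
    and B: "\<And>z. - d < Im z \<Longrightarrow> cmod (G z) \<le> B" and y: "0 < y" and R: "2 * y < R"
  shows "cmod (2 * pi * \<i> * G (Complex t y) -
           integral {t - R..t + R} (\<lambda>s. G (of_real s) * (2 * \<i> * y) / ((s - t)\<^sup>2 + y\<^sup>2))) \<le> 32 * B * y / R"
proof -
  define w where "w = Complex t y"
  define S where "S = {z. - min d y < Im z}"
  define f where "f z = G z * (2 * \<i> * y) / (z - cnj w)" for z
  define k where "k z = f z / (z - w)" for z
  define a1 a2 a3 a4 where "a1 = complex_of_real (t - R)" and "a2 = complex_of_real (t + R)"
    and "a3 = Complex (t + R) R" and "a4 = Complex (t - R) R"
  have R0: "0 < R" using y R by simp
  have B0: "0 \<le> B" using B[of 0] d by (smt (verit) norm_ge_zero zero_complex.simps(2))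
  have S: "convex S" "open S"
    unfolding S_def by (auto simp: convex_halfspace_Im_gt open_halfspace_Im_gt)
  have cw: "z \<noteq> cnj w" if "z \<in> S" for z
  proof
    assume "z = cnj w"
    hence "Im z = - y" by (simp add: w_def)
    thus False using that y by (auto simp: S_def)
  qed
  have sub: "S \<subseteq> {z. - d < Im z}" by (auto simp: S_def)
  have holf: "f holomorphic_on S"
    unfolding f_def by (intro holomorphic_intros holomorphic_on_subset[OF G] sub) (use cw in auto)
  have wS: "w \<in> interior S" 
  proof -
    have "Im w = y" by (simp add: w_def)
    hence "w \<in> S" using y d unfolding S_def by simp
    thus ?thesis by (simp add: interior_open[OF S(2)])
  qed
  have rp: "rectpath a1 a3 = linepath a1 a2 +++ linepath a2 a3 +++ linepath a3 a4 +++ linepath a4 a1"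
  proof -
    have "Complex (Re a3) (Im a1) = a2" "Complex (Re a1) (Im a3) = a4"
      by (auto simp: a1_def a2_def a3_def a4_def complex_eq_iff)
    thus ?thesis unfolding rectpath_def Let_def by simp
  qed
  have pim: "path_image (rectpath a1 a3) \<subseteq> S - {w}"
    using R y d by (subst path_image_rectpath) (auto simp: a1_def a3_def S_def w_def)
  have wn: "winding_number (rectpath a1 a3) w = 1"
    by (rule winding_number_rectpath) (use R y in \<open>auto simp: in_box_complex_iff a1_def a3_def w_def\<close>)
  have "(k has_contour_integral (2 * pi * \<i> * winding_number (rectpath a1 a3) w * f w)) (rectpath a1 a3)"
    unfolding k_def
    by (rule Cauchy_integral_formula_convex_simple[OF S(1) holf wS _ pim]) auto
  moreover have "f w = G w"
  proof -
    have "w - cnj w = 2 * \<i> * y" by (simp add: w_def complex_eq_iff)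
    thus ?thesis using y by (simp add: f_def)
  qed
  ultimately have ci: "(k has_contour_integral (2 * pi * \<i> * G w)) (rectpath a1 a3)"
    by (simp add: wn)
  have kcont: "continuous_on (S - {w}) k"
    unfolding k_def using holf
    by (intro continuous_intros holomorphic_on_imp_continuous_on holomorphic_on_subset[OF holf]) auto
  have segs: "closed_segment a1 a2 \<subseteq> S - {w}" "closed_segment a2 a3 \<subseteq> S - {w}"
     "closed_segment a3 a4 \<subseteq> S - {w}" "closed_segment a4 a1 \<subseteq> S - {w}"
    using pim unfolding rp by (auto simp: path_image_join)
  have int: "k contour_integrable_on linepath a1 a2" "k contour_integrable_on linepath a2 a3"
    "k contour_integrable_on linepath a3 a4" "k contour_integrable_on linepath a4 a1"
    by (auto intro!: contour_integrable_continuous_linepath continuous_on_subset[OF kcont] dest: subsetD[OF segs(1)]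
        subsetD[OF segs(2)] subsetD[OF segs(3)] subsetD[OF segs(4)])
  have sum: "2 * pi * \<i> * G w = contour_integral (linepath a1 a2) k + (contour_integral (linepath a2 a3) k
      + (contour_integral (linepath a3 a4) k + contour_integral (linepath a4 a1) k))"
    using contour_integral_unique[OF ci] int unfolding rp by (simp add: contour_integral_join)
  have kb: "cmod (k z) \<le> 8 * B * y / R\<^sup>2" if "R/2 \<le> cmod (z - w)" "R/2 \<le> cmod (z - cnj w)" "z \<in> S" for z
  proof -
    have "cmod (k z) = cmod (G z) * (2 * y) / (cmod (z - cnj w) * cmod (z - w))"
      using y by (simp add: k_def f_def norm_divide norm_mult)
    also have "\<dots> \<le> B * (2 * y) / ((R/2) * (R/2))"
    proof (rule frac_le)
      show "cmod (G z) * (2 * y) \<le> B * (2 * y)"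
        using that(3) y B[of z] by (intro mult_right_mono) (auto simp: S_def)
      show "R/2 * (R/2) \<le> cmod (z - cnj w) * cmod (z - w)"
        using that R0 by (intro mult_mono) auto
    qed (use B0 y R0 in auto)
    also have "\<dots> = 8 * B * y / R\<^sup>2" using R0 by (simp add: field_simps power2_eq_square)
    finally show ?thesis .
  qed
  have kb': "cmod (k z) \<le> 8 * B * y / R\<^sup>2"
    if "z \<in> S" "(R/2 \<le> \<bar>Re z - t\<bar>) \<or> R \<le> Im z" for z
  proof (rule kb[OF _ _ that(1)])
    show "R/2 \<le> cmod (z - w)"
      using abs_Re_le_cmod[of "z - w"] abs_Im_le_cmod[of "z - w"] that(2) R y by (auto simp: w_def)
    show "R/2 \<le> cmod (z - cnj w)"
      using abs_Re_le_cmod[of "z - cnj w"] abs_Im_le_cmod[of "z - cnj w"] that(2) R y by (auto simp: w_def)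
  qed
  have nn: "0 \<le> 8 * B * y / R\<^sup>2" using B0 y by simp
  have s2: "cmod (contour_integral (linepath a2 a3) k) \<le> 8 * B * y / R\<^sup>2 * cmod (a3 - a2)"
  proof (rule contour_integral_bound_linepath[OF int(2) nn])
    fix z assume "z \<in> closed_segment a2 a3"
    moreover from this have "Re z = t + R"
      by (subst (asm) closed_segment_same_Re) (auto simp: a2_def a3_def)
    ultimately show "cmod (k z) \<le> 8 * B * y / R\<^sup>2" using segs(2) R0 by (intro kb') auto
  qed
  have s3: "cmod (contour_integral (linepath a3 a4) k) \<le> 8 * B * y / R\<^sup>2 * cmod (a4 - a3)"
  proof (rule contour_integral_bound_linepath[OF int(3) nn])
    fix z assume "z \<in> closed_segment a3 a4"
    moreover from this have "Im z = R"
      by (subst (asm) closed_segment_same_Im) (auto simp: a4_def a3_def)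
    ultimately show "cmod (k z) \<le> 8 * B * y / R\<^sup>2" using segs(3) R0 by (intro kb') auto
  qed
  have s4: "cmod (contour_integral (linepath a4 a1) k) \<le> 8 * B * y / R\<^sup>2 * cmod (a1 - a4)"
  proof (rule contour_integral_bound_linepath[OF int(4) nn])
    fix z assume "z \<in> closed_segment a4 a1"
    moreover from this have "Re z = t - R"
      by (subst (asm) closed_segment_same_Re) (auto simp: a4_def a1_def)
    ultimately show "cmod (k z) \<le> 8 * B * y / R\<^sup>2" using segs(4) R0 by (intro kb') auto
  qed
  have l: "cmod (a3 - a2) = R" "cmod (a4 - a3) = 2 * R" "cmod (a1 - a4) = R"
    using R0 by (auto simp: a1_def a2_def a3_def a4_def cmod_def real_sqrt_mult)
  have s1: "contour_integral (linepath a1 a2) k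
      = integral {t - R..t + R} (\<lambda>s. G (of_real s) * (2 * \<i> * y) / ((s - t)\<^sup>2 + y\<^sup>2))"
  proof -
    have "contour_integral (linepath a1 a2) k = integral {Re a1..Re a2} (\<lambda>s. k (of_real s))"
      by (rule contour_integral_linepath_Reals_eq) (use R0 in \<open>auto simp: a1_def a2_def\<close>)
    also have "(\<lambda>s. k (of_real s)) = (\<lambda>s. G (of_real s) * (2 * \<i> * y) / ((s - t)\<^sup>2 + y\<^sup>2))"
    proof
      fix s :: real
      have "(of_real s - cnj w) * (of_real s - w) = (s - t)\<^sup>2 + y\<^sup>2"
        by (simp add: w_def complex_eq_iff algebra_simps power2_eq_square)
      thus "k (of_real s) = G (of_real s) * (2 * \<i> * y) / ((s - t)\<^sup>2 + y\<^sup>2)"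
        unfolding k_def f_def by (simp add: divide_divide_eq_left)
    qed
    finally show ?thesis by (simp add: a1_def a2_def)
  qed
  have "cmod (2 * pi * \<i> * G w - contour_integral (linepath a1 a2) k)
     \<le> cmod (contour_integral (linepath a2 a3) k) + (cmod (contour_integral (linepath a3 a4) k)
       + cmod (contour_integral (linepath a4 a1) k))"
    unfolding sum by (simp add: norm_triangle_le norm_triangle_ineq add_left_mono)
  also have "\<dots> \<le> 8 * B * y / R\<^sup>2 * R + (8 * B * y / R\<^sup>2 * (2 * R) + 8 * B * y / R\<^sup>2 * R)"
    using s2 s3 s4 unfolding l by (intro add_mono)
  also have "\<dots> = 32 * B * y / R" using R0 by (simp add: field_simps power2_eq_square)
  finally show ?thesis unfolding s1 w_def by simp
qed

lemma poisson_representation: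
  assumes G: "G holomorphic_on {z. - d < Im z}" and d: "0 < d"
    and B: "\<And>z. - d < Im z \<Longrightarrow> cmod (G z) \<le> B" and y: "0 < y"
  shows "integrable lborel (\<lambda>s. of_real (poisson_kernel y (t - s)) * G (of_real s))"
    and "(\<integral>s. of_real (poisson_kernel y (t - s)) * G (of_real s) \<partial>lborel) = G (Complex t y)"
proof -
  let ?h = "\<lambda>s. complex_of_real (poisson_kernel y (t - s)) * G (of_real s)"
  have contG: "continuous_on UNIV (\<lambda>s. G (complex_of_real s))"
    by (rule continuous_on_compose2[OF holomorphic_on_imp_continuous_on[OF G]])
       (use d in \<open>auto intro!: continuous_intros\<close>)
  have [measurable]: "(\<lambda>s. G (complex_of_real s)) \<in> borel_measurable borel"
    by (rule borel_measurable_continuous_onI[OF contG])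
  show int: "integrable lborel ?h"
  proof (rule Bochner_Integration.integrable_bound[where f = "\<lambda>s. B * poisson_kernel y (t - s)"])
    show "AE s in lborel. norm (?h s) \<le> norm (B * poisson_kernel y (t - s))"
    proof (rule AE_I2)
      fix s
      have "cmod (G (of_real s)) \<le> B" using B[of "of_real s"] d by simp
      thus "norm (?h s) \<le> norm (B * poisson_kernel y (t - s))"
        using poisson_kernel_nonneg[OF y]
        by (auto simp: norm_mult abs_mult mult.commute intro!: mult_mono)
    qed
  qed (auto intro!: poisson_kernel_integrable y)
  let ?I = "\<lambda>n::nat. (\<integral>s. indicator {t - real n..t + real n} s *\<^sub>R ?h s \<partial>lborel)"
  have lim1: "?I \<longlonglongrightarrow> (\<integral>s. ?h s \<partial>lborel)"
  proof (rule integral_dominated_convergence[where w = "\<lambda>s. norm (?h s)"])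
    show "AE s in lborel. (\<lambda>n. indicator {t - real n..t + real n} s *\<^sub>R ?h s) \<longlonglongrightarrow> ?h s"
    proof (rule AE_I2)
      fix s
      have "eventually (\<lambda>n. \<bar>s - t\<bar> \<le> real n) sequentially"
        using eventually_ge_at_top[of "nat \<lceil>\<bar>s - t\<bar>\<rceil>"] by eventually_elim linarith
      hence "eventually (\<lambda>n. indicator {t - real n..t + real n} s *\<^sub>R ?h s = ?h s) sequentially"
        by eventually_elim (auto simp: indicator_def abs_le_iff)
      thus "(\<lambda>n. indicator {t - real n..t + real n} s *\<^sub>R ?h s) \<longlonglongrightarrow> ?h s"
        by (rule tendsto_eventually)
    qed
  qed (use int in \<open>auto simp: indicator_def\<close>)
  have "?I \<longlonglongrightarrow> G (Complex t y)"
  proof (rule LIM_zero_cancel, rule Lim_null_comparison)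
    show "((\<lambda>n. 32 * B * y / real n) \<longlonglongrightarrow> 0)" by real_asymp
    show "eventually (\<lambda>n. norm (?I n - G (Complex t y)) \<le> 32 * B * y / real n) sequentially"
      using eventually_gt_at_top[of "nat \<lceil>2 * y\<rceil>"]
    proof eventually_elim
      case (elim n)
      hence n: "2 * y < real n" by linarith
      have "?I n = (LINT s:{t - real n..t + real n}|lborel. ?h s)"
        by (simp add: set_lebesgue_integral_def)
      also have "\<dots> = integral {t - real n..t + real n} ?h"
        by (rule set_borel_integral_eq_integral) (auto simp: set_integrable_def intro!: integrable_mult_indicator int)
      also have "\<dots> = integral {t - real n..t + real n}
          (\<lambda>s. G (of_real s) * (2 * \<i> * y) / ((s - t)\<^sup>2 + y\<^sup>2) / (2 * pi * \<i>))"
      proof (rule Henstock_Kurzweil_Integration.integral_cong)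
        fix s
        have "2 * \<i> * G (of_real s) * y / (2 * \<i> * (pi * ((t - s)\<^sup>2 + y\<^sup>2))) =
           G (of_real s) * y / (pi * ((t - s)\<^sup>2 + y\<^sup>2))"
          by (simp only: mult.assoc) simp
        thus "?h s = G (of_real s) * (2 * \<i> * y) / ((s - t)\<^sup>2 + y\<^sup>2) / (2 * pi * \<i>)"
          by (simp only: poisson_kernel_def of_real_divide of_real_mult of_real_add of_real_power of_real_diff
             divide_divide_eq_left times_divide_eq_right power2_commute[of "complex_of_real s"] mult_ac of_real_numeral)
      qed
      also have "\<dots> = integral {t - real n..t + real n}
          (\<lambda>s. G (of_real s) * (2 * \<i> * y) / ((s - t)\<^sup>2 + y\<^sup>2)) / (2 * pi * \<i>)"
        by (rule integral_divide)
      finally have *: "?I n = integral {t - real n..t + real n}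
          (\<lambda>s. G (of_real s) * (2 * \<i> * y) / ((s - t)\<^sup>2 + y\<^sup>2)) / (2 * pi * \<i>)" (is "_ = ?J / _") .
      have "norm (?I n - G (Complex t y)) = cmod (2 * pi * \<i> * G (Complex t y) - ?J) / (2 * pi)"
      proof -
        have "?I n - G (Complex t y) = (?J - 2 * pi * \<i> * G (Complex t y)) / (2 * pi * \<i>)"
          unfolding * by (simp add: diff_divide_distrib)
        thus ?thesis by (simp add: norm_divide norm_mult norm_minus_commute)
      qed
      also have "\<dots> \<le> cmod (2 * pi * \<i> * G (Complex t y) - ?J) / 1"
        using pi_ge_two by (intro divide_left_mono) auto
      also have "\<dots> \<le> 32 * B * y / real n"
        using truncated_poisson_representation[OF G d B y n, of t] by simp
      finally show ?case .
    qed
  qed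
  thus "(\<integral>s. ?h s \<partial>lborel) = G (Complex t y)"
    using LIMSEQ_unique[OF lim1] by simp
qed

section \<open>The Hardy-Littlewood maximal inequality\<close>

text \<open>The Vitali covering lemma selects disjoint intervals on which the mean exceeds \<open>lam\<close> and whose
  fivefold enlargements cover all such intervals; hence the factor 5.\<close>

lemma hardy_littlewood_weak_type:
  fixes A :: "real \<Rightarrow> ennreal"
  assumes A [measurable]: "A \<in> borel_measurable borel" and fin: "(\<integral>\<^sup>+s. A s \<partial>lborel) \<le> ennreal I"
    and lam: "0 < lam" and I: "0 \<le> I"
  obtains E where "E \<in> sets borel" "emeasure lborel E \<le> ennreal (5 * I / lam)"
    "\<And>t r. t \<notin> E \<Longrightarrow> 0 < r \<Longrightarrow> (\<integral>\<^sup>+s. A s * indicator (cball t r) s \<partial>lborel) \<le> ennreal (2 * r * lam)"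
proof -
  define K where "K = {(t, r). 0 < r \<and> ennreal (2 * r * lam) < (\<integral>\<^sup>+s. A s * indicator (cball t r) s \<partial>lborel)}"
  have bdd: "r \<le> I / (2 * lam)" if "(t, r) \<in> K" for t r
  proof -
    have "ennreal (2 * r * lam) < (\<integral>\<^sup>+s. A s * indicator (cball t r) s \<partial>lborel)"
      using that by (simp add: K_def)
    also have "\<dots> \<le> (\<integral>\<^sup>+s. A s \<partial>lborel)"
      by (intro nn_integral_mono) (auto simp: indicator_def)
    also have "\<dots> \<le> ennreal I" by (rule fin)
    finally have "2 * r * lam < I" using that lam by (simp add: ennreal_less_iff K_def)
    thus ?thesis using lam by (simp add: field_simps)
  qed
  obtain C where C: "countable C" "C \<subseteq> K"
     "pairwise (\<lambda>i j. disjnt (cball (fst i) (snd i)) (cball (fst j) (snd j))) C"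
     "(\<Union>i\<in>K. cball (fst i) (snd i)) \<subseteq> (\<Union>i\<in>C. cball (fst i) (5 * snd i))"
  proof (rule Vitali_covering_lemma_cballs[where S = "\<Union>i\<in>K. cball (fst i) (snd i)" and K = K
        and a = fst and r = snd and B = "I / (2 * lam)"])
    fix i assume "i \<in> K"
    thus "0 < snd i \<and> snd i \<le> I / (2 * lam)"
      using bdd[of "fst i" "snd i"] by (auto simp: K_def)
  qed auto
  define E where "E = (\<Union>i\<in>C. cball (fst i) (5 * snd i))"
  have Em: "E \<in> sets borel"
    unfolding E_def using C(1) by (intro sets.countable_UN') auto
  have pos: "0 < snd i" if "i \<in> C" for i using C(2) that by (auto simp: K_def)
  have "emeasure lborel E = (\<integral>\<^sup>+s. indicator E s \<partial>lborel)" using Em by simp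
  also have "\<dots> \<le> (\<integral>\<^sup>+s. (\<integral>\<^sup>+i. indicator (cball (fst i) (5 * snd i)) s \<partial>count_space C) \<partial>lborel)"
  proof (rule nn_integral_mono)
    fix s
    show "indicator E s \<le> (\<integral>\<^sup>+i. indicator (cball (fst i) (5 * snd i)) s \<partial>count_space C)"
    proof (cases "s \<in> E")
      case True
      then obtain i where i: "i \<in> C" "s \<in> cball (fst i) (5 * snd i)" by (auto simp: E_def)
      have "indicator (cball (fst i) (5 * snd i)) s
          \<le> (\<integral>\<^sup>+i. indicator (cball (fst i) (5 * snd i)) s \<partial>count_space C)"
        by (rule nn_integral_ge_point[OF i(1)])
      thus ?thesis using i True by simp
    qed auto
  qed
  also have "\<dots> = (\<integral>\<^sup>+i. (\<integral>\<^sup>+s. indicator (cball (fst i) (5 * snd i)) s \<partial>lborel) \<partial>count_space C)"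
    by (rule nn_integral_count_space_nn_integral[OF C(1)]) (auto intro!: borel_measurable_indicator borel_closed)
  also have "\<dots> \<le> (\<integral>\<^sup>+i. ennreal (5 / lam) * (\<integral>\<^sup>+s. A s * indicator (cball (fst i) (snd i)) s \<partial>lborel) \<partial>count_space C)"
  proof (rule nn_integral_mono)
    fix i assume "i \<in> space (count_space C)"
    hence i: "i \<in> C" by simp
    have "(\<integral>\<^sup>+s. indicator (cball (fst i) (5 * snd i)) s \<partial>lborel) = ennreal (10 * snd i)"
      using pos[OF i] by (simp add: cball_eq_atLeastAtMost)
    also have "\<dots> = ennreal (5 / lam) * ennreal (2 * snd i * lam)"
      using lam pos[OF i] by (simp flip: ennreal_mult)
    also have "\<dots> \<le> ennreal (5 / lam) * (\<integral>\<^sup>+s. A s * indicator (cball (fst i) (snd i)) s \<partial>lborel)"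
      using C(2) i by (intro mult_left_mono) (auto simp: K_def less_imp_le)
    finally show "(\<integral>\<^sup>+s. indicator (cball (fst i) (5 * snd i)) s \<partial>lborel)
      \<le> ennreal (5 / lam) * (\<integral>\<^sup>+s. A s * indicator (cball (fst i) (snd i)) s \<partial>lborel)" .
  qed
  also have "\<dots> = ennreal (5 / lam) * (\<integral>\<^sup>+i. emeasure (density lborel A) (cball (fst i) (snd i)) \<partial>count_space C)"
    by (subst nn_integral_cmult) (auto simp: emeasure_density)
  also have "(\<integral>\<^sup>+i. emeasure (density lborel A) (cball (fst i) (snd i)) \<partial>count_space C)
      = emeasure (density lborel A) (\<Union>i\<in>C. cball (fst i) (snd i))"
    by (rule emeasure_UN_countable[symmetric, OF _ C(1)])
       (use C(3) in \<open>auto simp: disjoint_family_on_def pairwise_def disjnt_def\<close>)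
  also have "\<dots> \<le> emeasure (density lborel A) (space (density lborel A))"
    by (rule emeasure_space)
  also have "\<dots> \<le> ennreal I" using fin by (simp add: emeasure_density)
  also have "ennreal (5 / lam) * ennreal I = ennreal (5 * I / lam)"
    using lam I by (simp flip: ennreal_mult)
  finally have Es: "emeasure lborel E \<le> ennreal (5 * I / lam)" by (simp add: mult_left_mono)
  show ?thesis
  proof (rule that[OF Em Es])
    fix t r :: real assume t: "t \<notin> E" and r: "0 < r"
    show "(\<integral>\<^sup>+s. A s * indicator (cball t r) s \<partial>lborel) \<le> ennreal (2 * r * lam)"
    proof (rule ccontr)
      assume "\<not> ?thesis"
      hence "(t, r) \<in> K" using r by (simp add: K_def)
      hence "t \<in> (\<Union>i\<in>K. cball (fst i) (snd i))" using r by force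
      thus False using C(4) t unfolding E_def by blast
    qed
  qed
qed

text \<open>The Poisson kernel is a superposition of normalised indicators of centred intervals.\<close>

lemma poisson_integral_le_maximal:
  fixes A :: "real \<Rightarrow> ennreal"
  assumes A [measurable]: "A \<in> borel_measurable borel" and y: "0 < y" and lam: "0 \<le> lam"
    and max: "\<And>r. 0 < r \<Longrightarrow> (\<integral>\<^sup>+s. A s * indicator (cball t r) s \<partial>lborel) \<le> ennreal (2 * r * lam)"
  shows "(\<integral>\<^sup>+s. ennreal (poisson_kernel y (t - s)) * A s \<partial>lborel) \<le> ennreal lam"
proof -
  define q where "q r = y / pi * (2 * r) / (r\<^sup>2 + y\<^sup>2)\<^sup>2" for r
  have q0: "0 \<le> q r" if "0 \<le> r" for r using that y by (simp add: q_def)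
  have [measurable]: "q \<in> borel_measurable borel" unfolding q_def by measurable
  have layer: "(\<integral>\<^sup>+r. ennreal (q r) * indicator {\<bar>s\<bar>..} r \<partial>lborel) = ennreal (poisson_kernel y s)" for s
  proof -
    have "(\<integral>\<^sup>+r. ennreal (q r) * indicator {\<bar>s\<bar>..} r \<partial>lborel)
        = ennreal (0 - - (y / (pi * (\<bar>s\<bar>\<^sup>2 + y\<^sup>2))))"
    proof (rule nn_integral_FTC_atLeast[where F = "\<lambda>r. - (y / (pi * (r\<^sup>2 + y\<^sup>2)))"])
      fix r assume "\<bar>s\<bar> \<le> r"
      thus "0 \<le> q r" by (intro q0) simp
      have ne: "r\<^sup>2 + y\<^sup>2 \<noteq> 0" using y by (metis less_irrefl sum_power2_eq_zero_iff)
      have "((\<lambda>r. - (y / (pi * (r\<^sup>2 + y\<^sup>2)))) has_real_derivative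
              (y * (pi * (2 * r)) / (pi * (r\<^sup>2 + y\<^sup>2))\<^sup>2)) (at r)"
        using ne by (auto intro!: derivative_eq_intros simp: power2_eq_square)
      moreover have "y * (pi * (2 * r)) / (pi * (r\<^sup>2 + y\<^sup>2))\<^sup>2 = q r"
        unfolding q_def using ne by (simp add: power2_eq_square)
      ultimately show "((\<lambda>r. - (y / (pi * (r\<^sup>2 + y\<^sup>2)))) has_real_derivative q r) (at r)" by simp
    next
      show "((\<lambda>r. - (y / (pi * (r\<^sup>2 + y\<^sup>2)))) \<longlongrightarrow> 0) at_top" using y by real_asymp
    qed measurable
    thus ?thesis by (simp add: poisson_kernel_def)
  qed
  have main: "(\<integral>\<^sup>+s. ennreal (poisson_kernel y (t - s)) * D s \<partial>lborel)
     = (\<integral>\<^sup>+r. ennreal (q r) * indicator {0..} r * (\<integral>\<^sup>+s. D s * indicator (cball t r) s \<partial>lborel) \<partial>lborel)"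
    if [measurable]: "D \<in> borel_measurable borel" for D :: "real \<Rightarrow> ennreal"
  proof -
    have "(\<integral>\<^sup>+s. ennreal (poisson_kernel y (t - s)) * D s \<partial>lborel)
      = (\<integral>\<^sup>+s. (\<integral>\<^sup>+r. ennreal (q r) * (if \<bar>t - s\<bar> \<le> r then 1 else 0) * D s \<partial>lborel) \<partial>lborel)"
      by (rule nn_integral_cong, subst nn_integral_multc)
         (auto simp flip: layer intro!: arg_cong2[where f = times] nn_integral_cong simp: indicator_def)
    also have "\<dots> = (\<integral>\<^sup>+r. (\<integral>\<^sup>+s. ennreal (q r) * (if \<bar>t - s\<bar> \<le> r then 1 else 0) * D s \<partial>lborel) \<partial>lborel)"
      by (rule lborel_pair.Fubini') measurable
    also have "\<dots> = (\<integral>\<^sup>+r. ennreal (q r) * indicator {0..} r * (\<integral>\<^sup>+s. D s * indicator (cball t r) s \<partial>lborel) \<partial>lborel)"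
    proof (rule nn_integral_cong)
      fix r
      have "(\<integral>\<^sup>+s. ennreal (q r) * (if \<bar>t - s\<bar> \<le> r then 1 else 0) * D s \<partial>lborel)
        = (\<integral>\<^sup>+s. (ennreal (q r) * indicator {0..} r) * (D s * indicator (cball t r) s) \<partial>lborel)"
        by (rule nn_integral_cong) (auto simp: indicator_def dist_real_def)
      also have "\<dots> = ennreal (q r) * indicator {0..} r * (\<integral>\<^sup>+s. D s * indicator (cball t r) s \<partial>lborel)"
        using borel_closed[OF closed_cball, of t r] that
        by (intro nn_integral_cmult borel_measurable_times_ennreal borel_measurable_indicator) auto
      finally show "(\<integral>\<^sup>+s. ennreal (q r) * (if \<bar>t - s\<bar> \<le> r then 1 else 0) * D s \<partial>lborel)
        = ennreal (q r) * indicator {0..} r * (\<integral>\<^sup>+s. D s * indicator (cball t r) s \<partial>lborel)" .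
    qed
    finally show ?thesis .
  qed
  have "(\<integral>\<^sup>+s. ennreal (poisson_kernel y (t - s)) * A s \<partial>lborel)
      = (\<integral>\<^sup>+r. ennreal (q r) * indicator {0..} r * (\<integral>\<^sup>+s. A s * indicator (cball t r) s \<partial>lborel) \<partial>lborel)"
    by (rule main) measurable
  also have "\<dots> \<le> (\<integral>\<^sup>+r. ennreal (q r) * indicator {0..} r * (\<integral>\<^sup>+s. ennreal lam * indicator (cball t r) s \<partial>lborel) \<partial>lborel)"
  proof (rule nn_integral_mono)
    fix r
    show "ennreal (q r) * indicator {0..} r * (\<integral>\<^sup>+s. A s * indicator (cball t r) s \<partial>lborel)
      \<le> ennreal (q r) * indicator {0..} r * (\<integral>\<^sup>+s. ennreal lam * indicator (cball t r) s \<partial>lborel)"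
    proof (cases "0 < r")
      case True
      have "(\<integral>\<^sup>+s. ennreal lam * indicator (cball t r) s \<partial>lborel) = ennreal (2 * r * lam)"
        using True lam by (simp add: nn_integral_cmult cball_eq_atLeastAtMost mult.commute flip: ennreal_mult)
      thus ?thesis using max[OF True] by (intro mult_left_mono) auto
    next
      case False
      thus ?thesis by (cases "r = 0") (auto simp: q_def)
    qed
  qed
  also have "\<dots> = (\<integral>\<^sup>+s. ennreal (poisson_kernel y (t - s)) * ennreal lam \<partial>lborel)"
    by (rule main[symmetric]) measurable
  also have "\<dots> = ennreal lam"
    by (subst nn_integral_multc) (auto simp: nn_integral_poisson_kernel_shift[OF y])
  finally show ?thesis .
qed

section \<open>The Cauchy transform and the truncated Hilbert transforms\<close>

lemma space_mu [simp]: "space mu = {-1<..<1}"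
  by (simp add: mu_def space_restrict_space)

lemma sets_mu: "A \<in> sets mu \<longleftrightarrow> A \<in> sets borel \<and> A \<subseteq> {-1<..<1}"
  by (subst mu_def, subst sets_restrict_space_iff) auto

lemma borel_measurable_mu [measurable (raw)]: "f \<in> borel_measurable borel \<Longrightarrow> f \<in> borel_measurable mu"
  unfolding mu_def by (rule measurable_restrict_space1) simp

lemma nn_integral_mu: "(\<integral>\<^sup>+x. f x \<partial>mu) = (\<integral>\<^sup>+x. f x * indicator {-1<..<1} x \<partial>lborel)"
  unfolding mu_def by (rule nn_integral_restrict_space) simp

lemma emeasure_mu: "A \<subseteq> {-1<..<1} \<Longrightarrow> emeasure mu A = emeasure lborel A"
  unfolding mu_def by (rule emeasure_restrict_space) auto

lemma finite_measure_mu: "finite_measure mu"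
  by (rule finite_measureI) (simp add: emeasure_mu)

interpretation mu: finite_measure mu
  by (rule finite_measure_mu)

lemma bounded_kernel_integrable:
  fixes h k :: "real \<Rightarrow> complex"
  assumes h: "integrable mu h" and k: "k \<in> borel_measurable mu"
    and K: "\<And>x. x \<in> {-1<..<1} \<Longrightarrow> cmod (k x) \<le> K"
  shows "integrable mu (\<lambda>x. h x * k x)"
    and "cmod (\<integral>x. h x * k x \<partial>mu) \<le> K * (\<integral>x. cmod (h x) \<partial>mu)"
proof -
  note [measurable] = borel_measurable_integrable[OF h] k
  have b: "cmod (h x * k x) \<le> K * cmod (h x)" if "x \<in> space mu" for x
    using K[of x] that mult_left_mono[of "cmod (k x)" K "cmod (h x)"]
    by (simp add: norm_mult mult.commute)
  have K0: "0 \<le> K" using order_trans[OF norm_ge_zero K[of 0]] by simp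
  show int: "integrable mu (\<lambda>x. h x * k x)"
    by (rule Bochner_Integration.integrable_bound[where f = "\<lambda>x. K * cmod (h x)"])
       (use h b K0 in \<open>auto intro!: AE_I2 simp: abs_mult\<close>)
  have "cmod (\<integral>x. h x * k x \<partial>mu) \<le> (\<integral>x. K * cmod (h x) \<partial>mu)"
    by (rule order_trans[OF integral_norm_bound integral_mono]) (use h int b in auto)
  thus "cmod (\<integral>x. h x * k x \<partial>mu) \<le> K * (\<integral>x. cmod (h x) \<partial>mu)" by simp
qed

definition cauchy_transform :: "(real \<Rightarrow> complex) \<Rightarrow> complex \<Rightarrow> complex" where
  "cauchy_transform h z = (\<integral>x. h x * (1 / (of_real x - z)) \<partial>mu) / pi"

definition trunc_kernel :: "real \<Rightarrow> real \<Rightarrow> real" where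
  "trunc_kernel e s = (if e < \<bar>s\<bar> then 1 / s else 0)"

text \<open>The real part of \<open>1 / (s - \<i> e)\<close>.\<close>

definition conj_kernel :: "real \<Rightarrow> real \<Rightarrow> real" where
  "conj_kernel e s = s / (s\<^sup>2 + e\<^sup>2)"

definition truncated_hilbert :: "(real \<Rightarrow> complex) \<Rightarrow> real \<Rightarrow> real \<Rightarrow> complex" where
  "truncated_hilbert h e t = (\<integral>x. h x * of_real (trunc_kernel e (x - t)) \<partial>mu) / pi"

definition conj_poisson :: "(real \<Rightarrow> complex) \<Rightarrow> real \<Rightarrow> real \<Rightarrow> complex" where
  "conj_poisson h e t = (\<integral>x. h x * of_real (conj_kernel e (x - t)) \<partial>mu) / pi"

lemma trunc_kernel_measurable1 [measurable]: "trunc_kernel e \<in> borel_measurable borel"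
  unfolding trunc_kernel_def by measurable

lemma conj_kernel_measurable1 [measurable]: "conj_kernel e \<in> borel_measurable borel"
  unfolding conj_kernel_def by measurable

lemma trunc_kernel_bound: "0 < e \<Longrightarrow> \<bar>trunc_kernel e s\<bar> \<le> 1 / e"
  by (auto simp: trunc_kernel_def abs_div intro!: divide_left_mono mult_pos_pos)

lemma conj_kernel_bound:
  assumes "0 < e" shows "\<bar>conj_kernel e s\<bar> \<le> 1 / e"
proof -
  have "0 < s\<^sup>2 + e\<^sup>2" using assms by (simp add: sum_power2_gt_zero_iff)
  moreover have "\<bar>s\<bar> * e \<le> s\<^sup>2 + e\<^sup>2"
  proof -
    have "2 * \<bar>s\<bar> * e \<le> s\<^sup>2 + e\<^sup>2" using sum_squares_bound[of "\<bar>s\<bar>" e] by simp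
    moreover have "0 \<le> \<bar>s\<bar> * e" using assms by simp
    ultimately show ?thesis by linarith
  qed
  ultimately show ?thesis using assms
    by (simp add: conj_kernel_def abs_div field_simps abs_mult)
qed

text \<open>The error between the two truncations is at most the Poisson kernel itself, so that the
  Poisson integral, which is the imaginary part of the Cauchy transform, controls it.\<close>

lemma kernels_close:
  assumes "0 < e"
  shows "\<bar>conj_kernel e s - trunc_kernel e s\<bar> \<le> e / (s\<^sup>2 + e\<^sup>2)"
proof -
  have p: "0 < s\<^sup>2 + e\<^sup>2" using assms by (simp add: sum_power2_gt_zero_iff)
  show ?thesis
  proof (cases "e < \<bar>s\<bar>")
    case True
    have s: "s \<noteq> 0" using True assms by auto
    have "conj_kernel e s - trunc_kernel e s = - (e\<^sup>2 / (s * (s\<^sup>2 + e\<^sup>2)))"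
      using True s p by (simp add: conj_kernel_def trunc_kernel_def field_simps power2_eq_square)
    also have "\<bar>\<dots>\<bar> = (e / \<bar>s\<bar>) * (e / (s\<^sup>2 + e\<^sup>2))"
      using assms p by (simp add: abs_mult abs_div power2_eq_square)
    also have "\<dots> \<le> 1 * (e / (s\<^sup>2 + e\<^sup>2))"
      using True assms p by (intro mult_right_mono) auto
    finally show ?thesis by simp
  next
    case False
    thus ?thesis using p assms
      by (auto simp: conj_kernel_def trunc_kernel_def abs_div divide_right_mono)
  qed
qed

lemma cauchy_kernel_bound:
  assumes "0 < Im z" shows "cmod (1 / (of_real x - z)) \<le> 1 / Im z"
proof -
  have "Im z \<le> cmod (of_real x - z)" using abs_Im_le_cmod[of "of_real x - z"] assms by simp
  thus ?thesis using assms by (simp add: norm_divide frac_le)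
qed

lemma cauchy_integrable:
  assumes "integrable mu h" "0 < Im z"
  shows "integrable mu (\<lambda>x. h x * (1 / (of_real x - z)))"
  by (rule bounded_kernel_integrable(1)[OF assms(1), where K = "1 / Im z"])
     (use assms cauchy_kernel_bound in auto)

lemma cauchy_transform_bound:
  assumes "integrable mu h" "0 < Im z"
  shows "cmod (cauchy_transform h z) \<le> (\<integral>x. cmod (h x) \<partial>mu) / (pi * Im z)"
proof -
  have "cmod (\<integral>x. h x * (1 / (of_real x - z)) \<partial>mu) \<le> 1 / Im z * (\<integral>x. cmod (h x) \<partial>mu)"
    by (rule bounded_kernel_integrable(2)[OF assms(1)]) (use assms cauchy_kernel_bound in auto)
  thus ?thesis using assms(2) pi_gt_zero
    by (simp add: cauchy_transform_def norm_divide divide_simps mult_ac)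
qed

lemma cauchy_transform_bound_far:
  assumes "integrable mu h" "2 \<le> \<bar>Re z\<bar>"
  shows "cmod (cauchy_transform h z) \<le> (\<integral>x. cmod (h x) \<partial>mu) / pi"
proof -
  have "cmod (\<integral>x. h x * (1 / (of_real x - z)) \<partial>mu) \<le> 1 * (\<integral>x. cmod (h x) \<partial>mu)"
  proof (rule bounded_kernel_integrable(2)[OF assms(1)])
    fix x :: real assume "x \<in> {-1<..<1}"
    hence "1 \<le> cmod (of_real x - z)" using abs_Re_le_cmod[of "of_real x - z"] assms(2) by auto
    thus "cmod (1 / (of_real x - z)) \<le> 1"
      using frac_le[of 1 1 1 "cmod (of_real x - z)"] by (simp add: norm_divide)
  qed measurable
  thus ?thesis using pi_gt_zero by (simp add: cauchy_transform_def norm_divide divide_right_mono)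
qed

lemma cauchy_transform_holomorphic:
  assumes h: "integrable mu h"
  shows "cauchy_transform h holomorphic_on {z. 0 < Im z}"
proof (rule holomorphic_onI)
  fix w assume "w \<in> {z. 0 < Im z}"
  hence w: "0 < Im w" by simp
  let ?D = "(\<integral>x. h x * (1 / (of_real x - w)\<^sup>2) \<partial>mu) / pi"
  let ?c = "2 / (Im w) ^ 3 * (\<integral>x. cmod (h x) \<partial>mu)"
  have [measurable]: "(\<lambda>x. h x) \<in> borel_measurable mu" using h by simp
  have ne: "of_real x - z \<noteq> 0" if "0 < Im z" for x z using that by (auto simp: complex_eq_iff)
  have i2: "integrable mu (\<lambda>x. h x * (1 / (of_real x - w)\<^sup>2))"
  proof (rule bounded_kernel_integrable(1)[OF h])
    fix x :: real
    show "cmod (1 / (of_real x - w)\<^sup>2) \<le> (1 / Im w)\<^sup>2"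
      using power_mono[OF cauchy_kernel_bound[OF w, of x], of 2] by (simp add: norm_divide norm_power power_divide)
  qed measurable
  have main: "cmod ((cauchy_transform h z - cauchy_transform h w) / (z - w) - ?D) \<le> ?c * cmod (z - w)"
    if z: "z \<noteq> w" "dist z w < Im w / 2" for z
  proof -
    have "\<bar>Im z - Im w\<bar> < Im w / 2"
      using abs_Im_le_cmod[of "z - w"] z(2) by (simp add: dist_norm)
    hence Imz: "Im w / 2 < Im z" by linarith
    hence z0: "0 < Im z" using w by simp
    have pt: "(h x * (1 / (of_real x - z)) - h x * (1 / (of_real x - w))) / (z - w) - h x * (1 / (of_real x - w)\<^sup>2)
       = h x * ((z - w) / ((of_real x - z) * (of_real x - w)\<^sup>2))" for x
    proof -
      define a b where "a = of_real x - z" and "b = of_real x - w"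
      have ab: "a \<noteq> 0" "b \<noteq> 0" using ne[OF z0] ne[OF w] by (auto simp: a_def b_def)
      have d: "z - w = b - a" "b \<noteq> a" using z(1) by (auto simp: a_def b_def)
      have "1/a - 1/b = (b - a) / (a * b)" using ab by (simp add: field_simps)
      hence "(1/a - 1/b) / (b - a) = 1 / (a * b)" using d ab by simp
      moreover have "1 / (a * b) - 1 / b\<^sup>2 = (b - a) / (a * b\<^sup>2)"
        using ab by (simp add: field_simps power2_eq_square)
      ultimately have "(1/a - 1/b) / (b - a) - 1 / b\<^sup>2 = (b - a) / (a * b\<^sup>2)" by simp
      hence "h x * ((1/a - 1/b) / (b - a) - 1 / b\<^sup>2) = h x * ((b - a) / (a * b\<^sup>2))" by simp
      thus ?thesis unfolding a_def[symmetric] b_def[symmetric] d(1)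
        by (simp add: right_diff_distrib diff_divide_distrib)
    qed
    have "(cauchy_transform h z - cauchy_transform h w) / (z - w) - ?D
      = (\<integral>x. (h x * (1 / (of_real x - z)) - h x * (1 / (of_real x - w))) / (z - w) - h x * (1 / (of_real x - w)\<^sup>2) \<partial>mu) / pi"
    proof -
      note iz = cauchy_integrable[OF h z0] and iw = cauchy_integrable[OF h w]
      have "(\<integral>x. (h x * (1 / (of_real x - z)) - h x * (1 / (of_real x - w))) / (z - w) - h x * (1 / (of_real x - w)\<^sup>2) \<partial>mu)
        = ((\<integral>x. h x * (1 / (of_real x - z)) \<partial>mu) - (\<integral>x. h x * (1 / (of_real x - w)) \<partial>mu)) / (z - w)
          - (\<integral>x. h x * (1 / (of_real x - w)\<^sup>2) \<partial>mu)"
        using iz iw i2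
        by (simp only: Bochner_Integration.integral_diff integral_divide_zero Bochner_Integration.integrable_diff
            integrable_divide_zero)
      thus ?thesis by (simp add: cauchy_transform_def diff_divide_distrib mult.commute)
    qed
    also have "\<dots> = (\<integral>x. h x * ((z - w) / ((of_real x - z) * (of_real x - w)\<^sup>2)) \<partial>mu) / pi"
      by (simp only: pt)
    also have "cmod \<dots> \<le> (cmod (z - w) * (2 / (Im w) ^ 3) * (\<integral>x. cmod (h x) \<partial>mu)) / 1"
      unfolding norm_divide
    proof (rule frac_le)
      show "cmod (\<integral>x. h x * ((z - w) / ((of_real x - z) * (of_real x - w)\<^sup>2)) \<partial>mu)
        \<le> cmod (z - w) * (2 / (Im w) ^ 3) * (\<integral>x. cmod (h x) \<partial>mu)"
      proof (rule bounded_kernel_integrable(2)[OF h])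
        fix x :: real
        have "cmod (1 / (of_real x - z)) * (cmod (1 / (of_real x - w)))\<^sup>2 \<le> (2 / Im w) * (1 / Im w)\<^sup>2"
        proof (intro mult_mono power_mono cauchy_kernel_bound[OF w])
          have "1 / Im z \<le> 2 / Im w" using Imz w z0 by (simp add: field_simps)
          thus "cmod (1 / (of_real x - z)) \<le> 2 / Im w" using cauchy_kernel_bound[OF z0, of x] by linarith
        qed (use w in auto)
        hence "cmod (z - w) * (cmod (1 / (of_real x - z)) * (cmod (1 / (of_real x - w)))\<^sup>2)
          \<le> cmod (z - w) * ((2 / Im w) * (1 / Im w)\<^sup>2)" by (rule mult_left_mono) simp
        thus "cmod ((z - w) / ((of_real x - z) * (of_real x - w)\<^sup>2)) \<le> cmod (z - w) * (2 / (Im w) ^ 3)"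
          by (simp add: norm_divide norm_mult norm_power power2_eq_square power3_eq_cube)
      qed measurable
    qed (use w pi_ge_two in auto)
    finally show ?thesis by (simp add: mult_ac)
  qed
  have "((\<lambda>z. (cauchy_transform h z - cauchy_transform h w) / (z - w) - ?D) \<longlongrightarrow> 0) (at w)"
  proof (rule Lim_null_comparison)
    show "eventually (\<lambda>z. cmod ((cauchy_transform h z - cauchy_transform h w) / (z - w) - ?D) \<le> ?c * cmod (z - w)) (at w)"
      unfolding eventually_at using main w by (intro exI[of _ "Im w / 2"]) auto
    have "((\<lambda>z. ?c * cmod (z - w)) \<longlongrightarrow> ?c * cmod (w - w)) (at w)"
      by (intro tendsto_intros)
    thus "((\<lambda>z. ?c * cmod (z - w)) \<longlongrightarrow> 0) (at w)" by simp
  qed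
  hence "(cauchy_transform h has_field_derivative ?D) (at w)"
    unfolding has_field_derivative_iff by (rule LIM_zero_cancel)
  thus "cauchy_transform h field_differentiable at w within {z. 0 < Im z}"
    using field_differentiable_at_within field_differentiable_def by blast
qed

lemma cauchy_transform_shift_holomorphic:
  assumes h: "integrable mu h" and y: "0 < y"
  shows "(\<lambda>z. cauchy_transform h (z + \<i> * of_real y)) holomorphic_on {z. - (y/2) < Im z}"
  using holomorphic_on_compose_gen[of "\<lambda>z. z + \<i> * y" "{z. - (y/2) < Im z}" "cauchy_transform h" "{z. 0 < Im z}"]
    cauchy_transform_holomorphic[OF h] y
  by (force simp: o_def intro!: holomorphic_intros)

lemma cauchy_transform_split:
  fixes a :: "real \<Rightarrow> real"
  assumes a: "integrable mu a" and e: "0 < e"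
  shows "cauchy_transform (\<lambda>x. of_real (a x)) (Complex t e)
       = conj_poisson (\<lambda>x. of_real (a x)) e t + \<i> * of_real (\<integral>x. a x * (e / ((x - t)\<^sup>2 + e\<^sup>2)) \<partial>mu) / pi"
    and "conj_poisson (\<lambda>x. of_real (a x)) e t = of_real (\<integral>x. a x * conj_kernel e (x - t) \<partial>mu) / pi"
    and "integrable mu (\<lambda>x. a x * (e / ((x - t)\<^sup>2 + e\<^sup>2)))"
    and "integrable mu (\<lambda>x. a x * conj_kernel e (x - t))"
proof -
  have ai: "integrable mu (\<lambda>x. complex_of_real (a x))" using a by simp
  have k: "1 / (of_real x - Complex t e) = of_real (conj_kernel e (x - t)) + \<i> * of_real (e / ((x - t)\<^sup>2 + e\<^sup>2))" for x
  proof -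
    have p: "(x - t)\<^sup>2 + e\<^sup>2 \<noteq> 0" using e by (metis less_irrefl sum_power2_eq_zero_iff)
    have "1 / (of_real x - Complex t e) = inverse (Complex (x - t) (- e))"
    proof -
      have "of_real x - Complex t e = Complex (x - t) (- e)" by (simp add: complex_eq_iff)
      thus ?thesis by (simp only: inverse_eq_divide)
    qed
    also have "\<dots> = Complex ((x - t) / ((x - t)\<^sup>2 + e\<^sup>2)) (e / ((x - t)\<^sup>2 + e\<^sup>2))"
      by (simp add: complex_eq_iff)
    finally show ?thesis by (simp add: conj_kernel_def complex_eq_iff)
  qed
  show ck: "integrable mu (\<lambda>x. a x * conj_kernel e (x - t))"
  proof -
    have "integrable mu (\<lambda>x. of_real (a x) * complex_of_real (conj_kernel e (x - t)))"
      by (rule bounded_kernel_integrable(1)[OF ai, where K = "1 / e"])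
         (use conj_kernel_bound[OF e] in auto)
    from integrable_Re[OF this] show ?thesis by simp
  qed
  show pk: "integrable mu (\<lambda>x. a x * (e / ((x - t)\<^sup>2 + e\<^sup>2)))"
  proof -
    from integrable_Im[OF cauchy_integrable[OF ai, of "Complex t e"]] e
    show ?thesis unfolding k by simp
  qed
  have "(\<integral>x. of_real (a x) * complex_of_real (conj_kernel e (x - t)) \<partial>mu)
     = of_real (\<integral>x. a x * conj_kernel e (x - t) \<partial>mu)"
    by (simp flip: of_real_mult)
  thus cp: "conj_poisson (\<lambda>x. of_real (a x)) e t = of_real (\<integral>x. a x * conj_kernel e (x - t) \<partial>mu) / pi"
    by (simp add: conj_poisson_def)
  have "(\<integral>x. of_real (a x) * (1 / (of_real x - Complex t e)) \<partial>mu)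
    = (\<integral>x. complex_of_real (a x * conj_kernel e (x - t)) + \<i> * of_real (a x * (e / ((x - t)\<^sup>2 + e\<^sup>2))) \<partial>mu)"
    unfolding k by (simp add: algebra_simps)
  also have "\<dots> = of_real (\<integral>x. a x * conj_kernel e (x - t) \<partial>mu) + \<i> * of_real (\<integral>x. a x * (e / ((x - t)\<^sup>2 + e\<^sup>2)) \<partial>mu)"
    using integrable_of_real[OF ck, where ?'a = complex] integrable_of_real[OF pk, where ?'a = complex]
    by (simp only: Bochner_Integration.integral_add integral_mult_right_zero integral_complex_of_real integrable_mult_right)
  finally show "cauchy_transform (\<lambda>x. of_real (a x)) (Complex t e)
       = conj_poisson (\<lambda>x. of_real (a x)) e t + \<i> * of_real (\<integral>x. a x * (e / ((x - t)\<^sup>2 + e\<^sup>2)) \<partial>mu) / pi"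
    unfolding cp by (simp add: cauchy_transform_def add_divide_distrib)
qed

lemma cauchy_transform_Im_nonneg:
  fixes a :: "real \<Rightarrow> real"
  assumes a: "integrable mu a" and a0: "\<And>x. 0 \<le> a x" and z: "0 < Im z"
  shows "0 \<le> Im (cauchy_transform (\<lambda>x. of_real (a x)) z)"
proof -
  have "0 \<le> (\<integral>x. a x * (Im z / ((x - Re z)\<^sup>2 + (Im z)\<^sup>2)) \<partial>mu)"
    using a0 z by (intro Bochner_Integration.integral_nonneg) auto
  moreover have "cauchy_transform (\<lambda>x. of_real (a x)) z = cauchy_transform (\<lambda>x. of_real (a x)) (Complex (Re z) (Im z))"
    by simp
  ultimately show ?thesis
    unfolding cauchy_transform_split(1)[OF a z] cauchy_transform_split(2)[OF a z] by (simp flip: of_real_divide)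
qed

lemma truncations_le_cauchy_transform:
  fixes a :: "real \<Rightarrow> real"
  assumes a: "integrable mu a" and a0: "\<And>x. 0 \<le> a x" and e: "0 < e"
  shows "cmod (conj_poisson (\<lambda>x. of_real (a x)) e t) \<le> 2 * cmod (cauchy_transform (\<lambda>x. of_real (a x)) (Complex t e))"
    and "cmod (truncated_hilbert (\<lambda>x. of_real (a x)) e t) \<le> 2 * cmod (cauchy_transform (\<lambda>x. of_real (a x)) (Complex t e))"
proof -
  let ?F = "cauchy_transform (\<lambda>x. of_real (a x)) (Complex t e)"
  let ?P = "(\<integral>x. a x * (e / ((x - t)\<^sup>2 + e\<^sup>2)) \<partial>mu) / pi"
  note s = cauchy_transform_split[OF a e, of t]
  have Re: "conj_poisson (\<lambda>x. of_real (a x)) e t = of_real (Re ?F)" and Im: "Im ?F = ?P"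
    unfolding s(1) s(2) by (simp_all flip: of_real_divide of_real_mult)
  show 1: "cmod (conj_poisson (\<lambda>x. of_real (a x)) e t) \<le> 2 * cmod ?F"
    unfolding Re using abs_Re_le_cmod[of ?F] norm_ge_zero[of ?F] by (simp del: norm_ge_zero)
  have ai: "integrable mu (\<lambda>x. complex_of_real (a x))" using a by simp
  have ti: "integrable mu (\<lambda>x. of_real (a x) * complex_of_real (trunc_kernel e (x - t)))"
    by (rule bounded_kernel_integrable(1)[OF ai, where K = "1 / e"])
       (use trunc_kernel_bound[OF e] in auto)
  hence ti': "integrable mu (\<lambda>x. a x * trunc_kernel e (x - t))"
    using integrable_Re[OF ti] by simp
  have T: "truncated_hilbert (\<lambda>x. of_real (a x)) e t = of_real ((\<integral>x. a x * trunc_kernel e (x - t) \<partial>mu) / pi)"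
    by (simp add: truncated_hilbert_def flip: of_real_mult)
  have C: "conj_poisson (\<lambda>x. of_real (a x)) e t = of_real ((\<integral>x. a x * conj_kernel e (x - t) \<partial>mu) / pi)"
    unfolding s(2) by simp
  have "\<bar>(\<integral>x. a x * conj_kernel e (x - t) \<partial>mu) - (\<integral>x. a x * trunc_kernel e (x - t) \<partial>mu)\<bar>
      = \<bar>\<integral>x. a x * (conj_kernel e (x - t) - trunc_kernel e (x - t)) \<partial>mu\<bar>"
    by (subst Bochner_Integration.integral_diff[OF s(4) ti', symmetric]) (simp add: right_diff_distrib)
  also have "\<dots> \<le> (\<integral>x. a x * (e / ((x - t)\<^sup>2 + e\<^sup>2)) \<partial>mu)"
  proof (rule order_trans[OF integral_abs_bound integral_mono])
    show "integrable mu (\<lambda>x. \<bar>a x * (conj_kernel e (x - t) - trunc_kernel e (x - t))\<bar>)"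
      using Bochner_Integration.integrable_diff[OF s(4) ti'] by (simp add: right_diff_distrib)
    show "\<bar>a x * (conj_kernel e (x - t) - trunc_kernel e (x - t))\<bar> \<le> a x * (e / ((x - t)\<^sup>2 + e\<^sup>2))" for x
      using kernels_close[OF e, of "x - t"] a0[of x] unfolding abs_mult by (intro mult_mono) auto
  qed (rule s(3))
  finally have "\<bar>(\<integral>x. a x * conj_kernel e (x - t) \<partial>mu) / pi - (\<integral>x. a x * trunc_kernel e (x - t) \<partial>mu) / pi\<bar> \<le> ?P"
    by (simp add: divide_right_mono flip: diff_divide_distrib)
  hence "cmod (conj_poisson (\<lambda>x. of_real (a x)) e t - truncated_hilbert (\<lambda>x. of_real (a x)) e t) \<le> Im ?F"
    unfolding T C Im of_real_diff[symmetric] norm_of_real .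
  moreover have "Im ?F \<le> cmod ?F" using abs_Im_le_cmod[of ?F] by linarith
  moreover have "cmod (conj_poisson (\<lambda>x. of_real (a x)) e t) \<le> cmod ?F"
    unfolding Re using abs_Re_le_cmod[of ?F] by simp
  ultimately show "cmod (truncated_hilbert (\<lambda>x. of_real (a x)) e t) \<le> 2 * cmod ?F"
    using norm_triangle_sub[of "truncated_hilbert (\<lambda>x. of_real (a x)) e t" "conj_poisson (\<lambda>x. of_real (a x)) e t"]
    by (simp add: norm_minus_commute)
qed


section \<open>Smallness of the truncations off small sets\<close>

lemma cmod_le_Re_plus_Im: "0 \<le> Re z \<Longrightarrow> 0 \<le> Im z \<Longrightarrow> cmod z \<le> Re z + Im z"
  using cmod_le[of z] by simp

lemma Im_csqrt_nonneg: "0 < Im w \<Longrightarrow> 0 \<le> Im (csqrt w)"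
  using abs_Re_le_cmod[of w] by simp

lemma poisson_kernel_one_lower:
  assumes "s \<in> {-2..2}" shows "1 \<le> 5 * pi * poisson_kernel 1 s"
proof -
  have "s\<^sup>2 \<le> 2\<^sup>2" using assms by (intro abs_le_square_iff[THEN iffD1]) auto
  moreover have "0 < s\<^sup>2 + 1" by (simp add: add_nonneg_pos)
  moreover have "5 * pi * poisson_kernel 1 s = 5 / (s\<^sup>2 + 1)"
    by (simp add: poisson_kernel_def)
  ultimately show ?thesis by simp
qed

text \<open>Adding \<open>\<i> m\<close> to the Cauchy transform \<open>F\<close> keeps it away from the branch cut of the square root at
  no cost, since the imaginary part of \<open>F\<close> is nonnegative. The root \<open>G\<close> lies in the first
  quadrant, so \<open>|G| \<le> Re G + Im G\<close>, and the Poisson representation at the single point \<open>\<i>\<close> bounds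
  \<open>\<integral> |G|\<close> over \<open>[-2,2]\<close> by a multiple of \<open>sqrt m\<close>. Away from this interval \<open>F\<close> is bounded anyway.
  The Poisson representation at all other points and the maximal inequality then bound \<open>|F| \<le>
  |G|\<^sup>2\<close> off a small set. The height \<open>h\<close> only serves to make \<open>G\<close> bounded and holomorphic across
  the line of integration.\<close>

lemma cauchy_transform_maximal_level:
  fixes a :: "real \<Rightarrow> real"
  assumes a: "integrable mu a" and a0: "\<And>x. 0 \<le> a x" and m: "(\<integral>x. a x \<partial>mu) \<le> m" "0 < m"
    and lam: "0 < lam" and h: "0 < h"
  obtains E where "E \<in> sets borel" "emeasure lborel E \<le> ennreal (400 * sqrt m / lam)"
    "\<And>t y. t \<notin> E \<Longrightarrow> h < y \<Longrightarrow>
       cmod (cauchy_transform (\<lambda>x. of_real (a x)) (Complex t y)) \<le> (2 * sqrt m + lam)\<^sup>2"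
proof -
  define F where "F = cauchy_transform (\<lambda>x. complex_of_real (a x))"
  define G where "G z = csqrt (F (z + \<i> * h) + \<i> * m)" for z
  have ai: "integrable mu (\<lambda>x. complex_of_real (a x))" using a by simp
  have na: "(\<integral>x. cmod (complex_of_real (a x)) \<partial>mu) \<le> m" using m(1) a0 by simp
  have FIm: "0 \<le> Im (F z)" if "0 < Im z" for z
    unfolding F_def by (rule cauchy_transform_Im_nonneg[OF a a0 that])
  have Fb: "cmod (F z) \<le> m / Im z" if "0 < Im z" for z
  proof -
    have "cmod (F z) \<le> (\<integral>x. cmod (complex_of_real (a x)) \<partial>mu) / (pi * Im z)"
      unfolding F_def by (rule cauchy_transform_bound[OF ai that])
    also have "\<dots> \<le> m / (1 * Im z)"
      using na that m pi_ge_two by (intro frac_le mult_right_mono) auto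
    finally show ?thesis by simp
  qed
  have Ffar: "cmod (F z) \<le> m" if "2 \<le> \<bar>Re z\<bar>" for z
  proof -
    have "cmod (F z) \<le> (\<integral>x. cmod (complex_of_real (a x)) \<partial>mu) / pi"
      unfolding F_def by (rule cauchy_transform_bound_far[OF ai that])
    also have "\<dots> \<le> m / 1" using na m pi_ge_two by (intro frac_le) auto
    finally show ?thesis by simp
  qed
  have Gnorm: "(cmod (G z))\<^sup>2 = cmod (F (z + \<i> * h) + \<i> * m)" for z
    by (simp add: G_def)
  have Gquad: "0 \<le> Re (G z)" "0 \<le> Im (G z)" if "- h < Im z" for z
  proof -
    have "0 < Im (F (z + \<i> * h) + \<i> * m)" using FIm[of "z + \<i> * h"] that m by simp
    thus "0 \<le> Im (G z)" unfolding G_def by (rule Im_csqrt_nonneg)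
    show "0 \<le> Re (G z)" unfolding G_def by (rule Re_csqrt)
  qed
  have Ghol: "G holomorphic_on {z. - (h/2) < Im z}"
  proof -
    have "(\<lambda>z. F (z + \<i> * h)) holomorphic_on {z. - (h/2) < Im z}"
      unfolding F_def by (rule cauchy_transform_shift_holomorphic[OF ai h])
    moreover have "F (z + \<i> * h) + \<i> * m \<notin> \<real>\<^sub>\<le>\<^sub>0" if "- (h/2) < Im z" for z
    proof -
      have "0 < Im (F (z + \<i> * h) + \<i> * m)" using FIm[of "z + \<i> * h"] that m h by simp
      thus ?thesis by (auto simp: complex_nonpos_Reals_iff)
    qed
    ultimately show ?thesis unfolding G_def
      by (intro holomorphic_on_csqrt' holomorphic_intros) auto
  qed
  have Gbd: "cmod (G z) \<le> sqrt (m / (h/2) + m)" if "- (h/2) < Im z" for z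
  proof -
    have "cmod (F (z + \<i> * h)) \<le> m / Im (z + \<i> * h)" by (rule Fb) (use that h in auto)
    also have "\<dots> \<le> m / (h/2)" by (rule divide_left_mono) (use that h m in auto)
    finally have "cmod (F (z + \<i> * h) + \<i> * m) \<le> m / (h/2) + m"
      using norm_triangle_ineq[of "F (z + \<i> * h)" "\<i> * m"] m by (simp add: norm_mult)
    thus ?thesis by (simp add: G_def)
  qed
  note repr = poisson_representation[OF Ghol _ Gbd]
  have h2: "0 < h/2" using h by simp
  have Gcont: "continuous_on UNIV (\<lambda>s. G (complex_of_real s))"
    by (rule continuous_on_compose2[OF holomorphic_on_imp_continuous_on[OF Ghol]])
       (use h in \<open>auto intro!: continuous_intros\<close>)
  have [measurable]: "(\<lambda>s. G (complex_of_real s)) \<in> borel_measurable borel"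
    by (rule borel_measurable_continuous_onI[OF Gcont])
  define A where "A s = ennreal (cmod (G (of_real s))) * indicator {-2..2} s" for s
  have [measurable]: "A \<in> borel_measurable borel" unfolding A_def by measurable
  have Gi: "cmod (G \<i>) \<le> 2 * sqrt m"
  proof -
    have "cmod (F (\<i> + \<i> * h)) \<le> m / (1 + h)" using Fb[of "\<i> + \<i> * h"] h by simp
    also have "\<dots> \<le> m" using m h by (simp add: field_simps)
    finally have "cmod (F (\<i> + \<i> * h) + \<i> * m) \<le> 4 * m"
      using norm_triangle_ineq[of "F (\<i> + \<i> * h)" "\<i> * m"] m by (simp add: norm_mult)
    hence "sqrt (cmod (F (\<i> + \<i> * h) + \<i> * m)) \<le> sqrt (4 * m)" by (rule real_sqrt_le_mono)
    thus ?thesis by (simp add: G_def real_sqrt_mult)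
  qed
  have A_int: "(\<integral>\<^sup>+s. A s \<partial>lborel) \<le> ennreal (80 * sqrt m)"
  proof -
    let ?p = "\<lambda>s. of_real (poisson_kernel 1 (0 - s)) * G (of_real s)"
    have int: "integrable lborel ?p" using repr(1)[OF h2, of 1 0] by simp
    have val: "(\<integral>s. ?p s \<partial>lborel) = G \<i>" using repr(2)[OF h2, of 1 0] by (simp add: imaginary_unit.code)
    have A_le: "A s \<le> ennreal (5 * pi * (Re (?p s) + Im (?p s)))" for s
    proof (cases "s \<in> {-2..2}")
      case True
      have q: "0 \<le> Re (G (of_real s))" "0 \<le> Im (G (of_real s))" using Gquad[of "of_real s"] h by auto
      have "cmod (G (of_real s)) \<le> 1 * (Re (G (of_real s)) + Im (G (of_real s)))"
        using cmod_le_Re_plus_Im[OF q] by simp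
      also have "\<dots> \<le> (5 * pi * poisson_kernel 1 s) * (Re (G (of_real s)) + Im (G (of_real s)))"
        using poisson_kernel_one_lower[OF True] q by (intro mult_right_mono) auto
      finally show ?thesis using True by (simp add: A_def algebra_simps ennreal_leI)
    qed (auto simp: A_def)
    have "(\<integral>\<^sup>+s. A s \<partial>lborel) \<le> (\<integral>\<^sup>+s. ennreal (5 * pi * (Re (?p s) + Im (?p s))) \<partial>lborel)"
      by (rule nn_integral_mono) (rule A_le)
    also have "\<dots> = ennreal (\<integral>s. 5 * pi * (Re (?p s) + Im (?p s)) \<partial>lborel)"
    proof (rule nn_integral_eq_integral)
      show "integrable lborel (\<lambda>s. 5 * pi * (Re (?p s) + Im (?p s)))"
        by (intro integrable_mult_right Bochner_Integration.integrable_add integrable_Re integrable_Im int)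
      show "AE s in lborel. 0 \<le> 5 * pi * (Re (?p s) + Im (?p s))"
      proof (rule AE_I2)
        fix s
        have q: "0 \<le> Re (G (of_real s))" "0 \<le> Im (G (of_real s))" using Gquad[of "of_real s"] h by auto
        thus "0 \<le> 5 * pi * (Re (?p s) + Im (?p s))" using poisson_kernel_nonneg[of 1 s] by simp
      qed
    qed
    also have "(\<integral>s. 5 * pi * (Re (?p s) + Im (?p s)) \<partial>lborel) = 5 * pi * (Re (G \<i>) + Im (G \<i>))"
      using integrable_Re[OF int] integrable_Im[OF int] integral_Re[OF int] integral_Im[OF int]
      by (simp only: integral_mult_right_zero Bochner_Integration.integral_add val)
    also have "\<dots> \<le> 5 * 4 * (2 * sqrt m + 2 * sqrt m)"
      using pi_less_4 Gquad[of \<i>] h abs_Re_le_cmod[of "G \<i>"] abs_Im_le_cmod[of "G \<i>"] Gi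
      by (intro mult_mono add_mono) auto
    finally show ?thesis by (simp add: ennreal_leI)
  qed
  obtain E where E: "E \<in> sets borel" "emeasure lborel E \<le> ennreal (5 * (80 * sqrt m) / lam)"
    "\<And>t r. t \<notin> E \<Longrightarrow> 0 < r \<Longrightarrow> (\<integral>\<^sup>+s. A s * indicator (cball t r) s \<partial>lborel) \<le> ennreal (2 * r * lam)"
    by (rule hardy_littlewood_weak_type[OF _ A_int lam]) (use m in auto)
  show ?thesis
  proof (rule that[OF E(1)])
    show "emeasure lborel E \<le> ennreal (400 * sqrt m / lam)" using E(2) by simp
    fix t y :: real assume t: "t \<notin> E" and y: "h < y"
    define u where "u = y - h"
    have u: "0 < u" using y by (simp add: u_def)
    have far: "ennreal (cmod (G (of_real s))) \<le> A s + ennreal (2 * sqrt m)" for s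
    proof (cases "s \<in> {-2..2}")
      case False
      have "cmod (F (of_real s + \<i> * h)) \<le> m" by (rule Ffar) (use False in auto)
      hence "cmod (F (of_real s + \<i> * h) + \<i> * m) \<le> 4 * m"
        using norm_triangle_ineq[of "F (of_real s + \<i> * h)" "\<i> * m"] m by (simp add: norm_mult)
      hence "sqrt (cmod (F (of_real s + \<i> * h) + \<i> * m)) \<le> sqrt (4 * m)" by (rule real_sqrt_le_mono)
      hence "cmod (G (of_real s)) \<le> 2 * sqrt m" by (simp add: G_def real_sqrt_mult)
      thus ?thesis by (simp add: ennreal_leI add_increasing)
    qed (simp add: A_def)
    have "ennreal (cmod (G (Complex t u))) = ennreal (cmod (\<integral>s. of_real (poisson_kernel u (t - s)) * G (of_real s) \<partial>lborel))"
      using repr(2)[OF h2 _ u, of t] by simp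
    also have "\<dots> \<le> (\<integral>\<^sup>+s. ennreal (cmod (of_real (poisson_kernel u (t - s)) * G (of_real s))) \<partial>lborel)"
      by (rule integral_norm_bound_ennreal) (use repr(1)[OF h2 _ u, of t] in simp)
    also have "\<dots> \<le> (\<integral>\<^sup>+s. ennreal (poisson_kernel u (t - s)) * A s
        + ennreal (poisson_kernel u (t - s)) * ennreal (2 * sqrt m) \<partial>lborel)"
    proof (rule nn_integral_mono)
      fix s
      have "ennreal (cmod (of_real (poisson_kernel u (t - s)) * G (of_real s)))
        = ennreal (poisson_kernel u (t - s)) * ennreal (cmod (G (of_real s)))"
        using poisson_kernel_nonneg[OF u, of "t - s"] by (simp add: norm_mult ennreal_mult)
      also have "\<dots> \<le> ennreal (poisson_kernel u (t - s)) * (A s + ennreal (2 * sqrt m))"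
        using far by (intro mult_left_mono) auto
      finally show "ennreal (cmod (of_real (poisson_kernel u (t - s)) * G (of_real s)))
        \<le> ennreal (poisson_kernel u (t - s)) * A s + ennreal (poisson_kernel u (t - s)) * ennreal (2 * sqrt m)"
        by (simp add: distrib_left)
    qed
    also have "\<dots> = (\<integral>\<^sup>+s. ennreal (poisson_kernel u (t - s)) * A s \<partial>lborel) + ennreal (2 * sqrt m)"
      by (subst nn_integral_add, measurable, subst nn_integral_multc)
         (auto simp: nn_integral_poisson_kernel_shift[OF u])
    also have "\<dots> \<le> ennreal lam + ennreal (2 * sqrt m)"
      by (intro add_right_mono poisson_integral_le_maximal u E(3)[OF t]) (use lam in auto)
    also have "\<dots> = ennreal (2 * sqrt m + lam)" using lam m by (simp flip: ennreal_plus add: add.commute)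
    finally have "ennreal (cmod (G (Complex t u))) \<le> ennreal (2 * sqrt m + lam)" .
    hence Gle: "cmod (G (Complex t u)) \<le> 2 * sqrt m + lam"
      by (subst (asm) ennreal_le_iff) (use lam m in auto)
    have z: "Complex t u + \<i> * h = Complex t y" by (simp add: complex_eq_iff u_def)
    have "cmod (F (Complex t y)) \<le> cmod (F (Complex t y) + \<i> * m)"
    proof -
      have "0 \<le> Im (F (Complex t y))" by (rule FIm) (use h y in simp)
      hence "(Im (F (Complex t y)))\<^sup>2 \<le> (Im (F (Complex t y)) + m)\<^sup>2"
        using m by (intro power_mono) auto
      thus ?thesis by (simp add: cmod_def)
    qed
    also have "\<dots> = (cmod (G (Complex t u)))\<^sup>2" unfolding Gnorm z ..
    also have "\<dots> \<le> (2 * sqrt m + lam)\<^sup>2" using Gle by (intro power_mono) auto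
    finally show "cmod (cauchy_transform (\<lambda>x. of_real (a x)) (Complex t y)) \<le> (2 * sqrt m + lam)\<^sup>2"
      unfolding F_def .
  qed
qed

text \<open>The exceptional sets for heights above \<open>1/n\<close> increase with \<open>n\<close> and the estimate does not
  depend on the height, so it passes to the union.\<close>

lemma cauchy_transform_maximal:
  fixes a :: "real \<Rightarrow> real"
  assumes a: "integrable mu a" and a0: "\<And>x. 0 \<le> a x" and m: "(\<integral>x. a x \<partial>mu) \<le> m" "0 < m"
    and lam: "0 < lam"
  obtains E where "E \<in> sets borel" "emeasure lborel E \<le> ennreal (400 * sqrt m / lam)"
    "\<And>t y. t \<notin> E \<Longrightarrow> 0 < y \<Longrightarrow>
       cmod (cauchy_transform (\<lambda>x. of_real (a x)) (Complex t y)) \<le> (2 * sqrt m + lam)\<^sup>2"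
proof -
  define F where "F = cauchy_transform (\<lambda>x. complex_of_real (a x))"
  define c where "c = (2 * sqrt m + lam)\<^sup>2"
  define U where "U n = (\<Union>y\<in>{1 / real (Suc n)<..}. {t. c < cmod (F (Complex t y))})" for n
  have ai: "integrable mu (\<lambda>x. complex_of_real (a x))" using a by simp
  have "open (U n)" for n
    unfolding U_def
  proof (intro open_UN ballI)
    fix y assume "y \<in> {1 / real (Suc n)<..}"
    hence y: "0 < y" by (auto intro: less_trans[rotated])
    have "continuous_on UNIV (\<lambda>t. F (Complex t y))"
      unfolding F_def Complex_eq
      by (rule continuous_on_compose2[OF holomorphic_on_imp_continuous_on[OF cauchy_transform_holomorphic[OF ai]]])
         (use y in \<open>auto intro!: continuous_intros\<close>)
    thus "open {t. c < cmod (F (Complex t y))}"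
      by (intro open_Collect_less continuous_intros)
  qed
  hence Um: "U n \<in> sets lborel" for n by simp
  have inc: "incseq U"
  proof (rule incseq_SucI)
    fix n
    have "1 / real (Suc (Suc n)) \<le> 1 / real (Suc n)" by (simp add: frac_le)
    thus "U n \<subseteq> U (Suc n)" unfolding U_def by (intro UN_mono) (auto simp: greaterThan_subset_iff)
  qed
  have Ule: "emeasure lborel (U n) \<le> ennreal (400 * sqrt m / lam)" for n
  proof -
    obtain E where E: "E \<in> sets borel" "emeasure lborel E \<le> ennreal (400 * sqrt m / lam)"
      "\<And>t y. t \<notin> E \<Longrightarrow> 1 / real (Suc n) < y \<Longrightarrow>
       cmod (cauchy_transform (\<lambda>x. of_real (a x)) (Complex t y)) \<le> (2 * sqrt m + lam)\<^sup>2"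
      by (rule cauchy_transform_maximal_level[OF a a0 m lam, of "1 / real (Suc n)"]) auto
    have "U n \<subseteq> E" using E(3) by (force simp: U_def F_def c_def)
    hence "emeasure lborel (U n) \<le> emeasure lborel E" using E(1) by (intro emeasure_mono) auto
    thus ?thesis using E(2) by simp
  qed
  show ?thesis
  proof (rule that[of "\<Union>n. U n"])
    show "(\<Union>n. U n) \<in> sets borel" using Um by auto
    have "emeasure lborel (\<Union>n. U n) = (SUP n. emeasure lborel (U n))"
      by (rule SUP_emeasure_incseq[symmetric]) (use Um inc in auto)
    also have "\<dots> \<le> ennreal (400 * sqrt m / lam)" by (rule SUP_least) (rule Ule)
    finally show "emeasure lborel (\<Union>n. U n) \<le> ennreal (400 * sqrt m / lam)" .
    fix t y :: real assume t: "t \<notin> (\<Union>n. U n)" and y: "0 < y"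
    obtain n where "inverse (real (Suc n)) < y" using reals_Archimedean[OF y] by blast
    with t have "\<not> c < cmod (F (Complex t y))" by (auto simp: U_def inverse_eq_divide)
    thus "cmod (cauchy_transform (\<lambda>x. of_real (a x)) (Complex t y)) \<le> (2 * sqrt m + lam)\<^sup>2"
      by (simp add: F_def c_def)
  qed
qed

lemma truncation_kernels_integrable:
  fixes h :: "real \<Rightarrow> complex"
  assumes h: "integrable mu h" and e: "0 < e"
  shows "integrable mu (\<lambda>x. h x * of_real (trunc_kernel e (x - t)))"
    and "integrable mu (\<lambda>x. h x * of_real (conj_kernel e (x - t)))"
  by (rule bounded_kernel_integrable(1)[OF h, where K = "1 / e"],
      use trunc_kernel_bound[OF e] conj_kernel_bound[OF e] in auto)+

lemma truncations_linear:
  assumes f: "integrable mu f" and g: "integrable mu g" and e: "0 < e"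
  shows "truncated_hilbert (\<lambda>x. u * f x + v * g x) e t = u * truncated_hilbert f e t + v * truncated_hilbert g e t"
    and "conj_poisson (\<lambda>x. u * f x + v * g x) e t = u * conj_poisson f e t + v * conj_poisson g e t"
  using truncation_kernels_integrable[OF f e, of t] truncation_kernels_integrable[OF g e, of t]
  by (simp_all add: truncated_hilbert_def conj_poisson_def distrib_right mult.assoc add_divide_distrib)

lemma truncations_small_off_small_set_nonneg:
  assumes lam: "0 < lam" and e: "0 < e"
  shows "\<exists>d>0. \<forall>a::real\<Rightarrow>real. integrable mu a \<longrightarrow> (\<forall>x. 0 \<le> a x) \<longrightarrow> (\<integral>x. a x \<partial>mu) \<le> d \<longrightarrow>
    (\<exists>E\<in>sets borel. emeasure lborel E \<le> ennreal e \<and>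
      (\<forall>t. t \<notin> E \<longrightarrow> (\<forall>y>0. cmod (truncated_hilbert (\<lambda>x. of_real (a x)) y t) \<le> lam \<and>
        cmod (conj_poisson (\<lambda>x. of_real (a x)) y t) \<le> lam)))"
proof -
  \<comment> \<open>with these values the maximal bound becomes \<open>(2 * q + l)\<^sup>2 \<le> lam / 2\<close> off a set of measure at most \<open>e\<close>\<close>
  define l where "l = sqrt (lam / 2) / 2"
  define q where "q = min (l / 2) (e * l / 400)"
  have l: "0 < l" using lam by (simp add: l_def)
  have q: "0 < q" "2 * q \<le> l" "400 * q / l \<le> e" using l e by (auto simp: q_def field_simps min_def)
  show ?thesis
  proof (intro exI[of _ "q\<^sup>2"] conjI allI impI)
    show "0 < q\<^sup>2" using q by simp
    fix a :: "real \<Rightarrow> real"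
    assume a: "integrable mu a" and a0: "\<forall>x. 0 \<le> a x" and le: "(\<integral>x. a x \<partial>mu) \<le> q\<^sup>2"
    have sq: "sqrt (q\<^sup>2) = q" using q by simp
    obtain E where E: "E \<in> sets borel" "emeasure lborel E \<le> ennreal (400 * q / l)"
      "\<And>t y. t \<notin> E \<Longrightarrow> 0 < y \<Longrightarrow>
       cmod (cauchy_transform (\<lambda>x. of_real (a x)) (Complex t y)) \<le> (2 * q + l)\<^sup>2"
      by (rule cauchy_transform_maximal[OF a _ le _ l, unfolded sq]) (use a0 q in auto)
    have "(2 * q + l)\<^sup>2 \<le> (2 * l)\<^sup>2" using q l by (intro power_mono) auto
    also have "\<dots> = lam / 2" using lam by (simp add: l_def)
    finally have b: "(2 * q + l)\<^sup>2 \<le> lam / 2" .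
    show "\<exists>E\<in>sets borel. emeasure lborel E \<le> ennreal e \<and>
      (\<forall>t. t \<notin> E \<longrightarrow> (\<forall>y>0. cmod (truncated_hilbert (\<lambda>x. of_real (a x)) y t) \<le> lam \<and>
        cmod (conj_poisson (\<lambda>x. of_real (a x)) y t) \<le> lam))"
    proof (rule bexI[OF _ E(1)], intro conjI allI impI)
      show "emeasure lborel E \<le> ennreal e" using E(2) q(3) by (meson ennreal_leI order_trans)
      fix t y :: real assume t: "t \<notin> E" and y: "0 < y"
      show "cmod (truncated_hilbert (\<lambda>x. of_real (a x)) y t) \<le> lam"
        using truncations_le_cauchy_transform(2)[OF a _ y, of t] a0 E(3)[OF t y] b by auto
      show "cmod (conj_poisson (\<lambda>x. of_real (a x)) y t) \<le> lam"
        using truncations_le_cauchy_transform(1)[OF a _ y, of t] a0 E(3)[OF t y] b by auto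
    qed
  qed
qed

lemma truncations_small_off_small_set:
  assumes lam: "0 < lam" and e: "0 < e"
  shows "\<exists>d>0. \<forall>h. integrable mu h \<longrightarrow> (\<integral>x. cmod (h x) \<partial>mu) \<le> d \<longrightarrow>
    (\<exists>E\<in>sets borel. emeasure lborel E \<le> ennreal e \<and>
      (\<forall>t. t \<notin> E \<longrightarrow> (\<forall>y>0. cmod (truncated_hilbert h y t) \<le> lam \<and> cmod (conj_poisson h y t) \<le> lam)))"
proof -
  obtain d where d: "0 < d" and small: "\<And>a::real\<Rightarrow>real. integrable mu a \<Longrightarrow> (\<And>x. 0 \<le> a x) \<Longrightarrow> (\<integral>x. a x \<partial>mu) \<le> d \<Longrightarrow>
    (\<exists>E\<in>sets borel. emeasure lborel E \<le> ennreal (e/4) \<and>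
      (\<forall>t. t \<notin> E \<longrightarrow> (\<forall>y>0. cmod (truncated_hilbert (\<lambda>x. of_real (a x)) y t) \<le> lam/4 \<and>
        cmod (conj_poisson (\<lambda>x. of_real (a x)) y t) \<le> lam/4)))"
    using truncations_small_off_small_set_nonneg[of "lam/4" "e/4"] lam e by auto
  show ?thesis
  proof (intro exI[of _ d] conjI allI impI d)
    fix h assume h: "integrable mu h" and hd: "(\<integral>x. cmod (h x) \<partial>mu) \<le> d"
    define p where "p i x = (if i = 0 then max 0 (Re (h x)) else if i = 1 then max 0 (- Re (h x))
      else if i = 2 then max 0 (Im (h x)) else max 0 (- Im (h x)))" for i :: nat and x
    define P where "P i x = complex_of_real (p i x)" for i x
    have pi: "integrable mu (p i)" for i
      unfolding p_def using h by (cases "i = 0"; cases "i = 1"; cases "i = 2") (auto intro!: integrable_max)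
    have p0: "0 \<le> p i x" for i x by (simp add: p_def)
    have ple: "p i x \<le> cmod (h x)" for i x
      using abs_Re_le_cmod[of "h x"] abs_Im_le_cmod[of "h x"] norm_ge_zero[of "h x"] by (auto simp: p_def simp del: norm_ge_zero)
    have "\<exists>E\<in>sets borel. emeasure lborel E \<le> ennreal (e/4) \<and>
      (\<forall>t. t \<notin> E \<longrightarrow> (\<forall>y>0. cmod (truncated_hilbert (P i) y t) \<le> lam/4 \<and> cmod (conj_poisson (P i) y t) \<le> lam/4))" for i
      unfolding P_def
    proof (rule small[OF pi p0])
      have "(\<integral>x. p i x \<partial>mu) \<le> (\<integral>x. cmod (h x) \<partial>mu)"
        by (rule integral_mono) (use pi h ple in auto)
      thus "(\<integral>x. p i x \<partial>mu) \<le> d" using hd by simp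
    qed
    then obtain E where E: "\<And>i. E i \<in> sets borel" "\<And>i. emeasure lborel (E i) \<le> ennreal (e/4)"
      "\<And>i t y. t \<notin> E i \<Longrightarrow> 0 < y \<Longrightarrow> cmod (truncated_hilbert (P i) y t) \<le> lam/4"
      "\<And>i t y. t \<notin> E i \<Longrightarrow> 0 < y \<Longrightarrow> cmod (conj_poisson (P i) y t) \<le> lam/4"
      by metis
    have Pi: "integrable mu (P i)" for i unfolding P_def using pi by simp
    define R where "R x = 1 * P 0 x + (- 1) * P 1 x" for x
    define I where "I x = 1 * P 2 x + (- 1) * P 3 x" for x
    have RI: "integrable mu R" "integrable mu I" unfolding R_def I_def using Pi by auto
    have hRI: "h = (\<lambda>x. 1 * R x + \<i> * I x)"
      by (rule ext) (auto simp: R_def I_def P_def p_def complex_eq_iff max_def)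
    have dec: "truncated_hilbert h y t = truncated_hilbert (P 0) y t - truncated_hilbert (P 1) y t
        + \<i> * (truncated_hilbert (P 2) y t - truncated_hilbert (P 3) y t)"
      "conj_poisson h y t = conj_poisson (P 0) y t - conj_poisson (P 1) y t
        + \<i> * (conj_poisson (P 2) y t - conj_poisson (P 3) y t)" if y: "0 < y" for y t
      unfolding hRI truncations_linear[OF RI y] unfolding R_def I_def truncations_linear[OF Pi Pi y] by simp_all
    have tri: "cmod (a - b + \<i> * (c - d)) \<le> cmod a + cmod b + cmod c + cmod d" for a b c d
      using norm_triangle_ineq[of "a - b" "\<i> * (c - d)"] norm_triangle_ineq4[of a b] norm_triangle_ineq4[of c d]
      by (simp add: norm_mult)
    show "\<exists>E\<in>sets borel. emeasure lborel E \<le> ennreal e \<and>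
      (\<forall>t. t \<notin> E \<longrightarrow> (\<forall>y>0. cmod (truncated_hilbert h y t) \<le> lam \<and> cmod (conj_poisson h y t) \<le> lam))"
    proof (intro bexI[of _ "\<Union>i<4. E i"] conjI allI impI)
      have "emeasure lborel (\<Union>i<4. E i) \<le> (\<Sum>i<4. emeasure lborel (E i))"
        using E(1) by (intro emeasure_subadditive_finite) auto
      also have "\<dots> \<le> (\<Sum>i<(4::nat). ennreal (e/4))" by (intro sum_mono E(2))
      also have "\<dots> = ennreal e" using e by (subst sum_ennreal) auto
      finally show "emeasure lborel (\<Union>i<4. E i) \<le> ennreal e" .
      fix t y :: real assume t: "t \<notin> (\<Union>i<4. E i)" and y: "0 < y"
      have t': "t \<notin> E 0" "t \<notin> E 1" "t \<notin> E 2" "t \<notin> E 3" using t by auto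
      show "cmod (truncated_hilbert h y t) \<le> lam"
        unfolding dec[OF y] using E(3)[OF t'(1) y] E(3)[OF t'(2) y] E(3)[OF t'(3) y] E(3)[OF t'(4) y]
        by (intro order_trans[OF tri]) linarith
      show "cmod (conj_poisson h y t) \<le> lam"
        unfolding dec[OF y] using E(4)[OF t'(1) y] E(4)[OF t'(2) y] E(4)[OF t'(3) y] E(4)[OF t'(4) y]
        by (intro order_trans[OF tri]) linarith
    qed (use E(1) in auto)
  qed
qed

section \<open>Almost everywhere existence of the finite Hilbert transform\<close>

lemma AE_mu_iff: "(AE x in mu. P x) \<longleftrightarrow> (AE x in lborel. x \<in> {-1<..<1} \<longrightarrow> P x)"
  unfolding mu_def by (rule AE_restrict_space_iff) simp

definition pv_limit :: "(real \<Rightarrow> complex) \<Rightarrow> real \<Rightarrow> complex \<Rightarrow> bool" where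
  "pv_limit h t l \<longleftrightarrow>
     ((\<lambda>e. truncated_hilbert h e t) \<longlongrightarrow> l) (at_right 0) \<and> ((\<lambda>e. conj_poisson h e t) \<longlongrightarrow> l) (at_right 0)"

text \<open>A single Cauchy condition for the truncations that also ties the conjugate Poisson
  integrals to them, so that both families have the same limit.\<close>

definition small_oscillation :: "(real \<Rightarrow> complex) \<Rightarrow> real \<Rightarrow> real \<Rightarrow> bool" where
  "small_oscillation h t c \<longleftrightarrow> (\<exists>d>0. \<forall>e e'. 0 < e \<longrightarrow> e < d \<longrightarrow> 0 < e' \<longrightarrow> e' < d \<longrightarrow>
     cmod (truncated_hilbert h e t - truncated_hilbert h e' t) \<le> c \<and>
     cmod (truncated_hilbert h e t - conj_poisson h e' t) \<le> c)"

lemma convergent_at_right_0I: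
  fixes T :: "real \<Rightarrow> 'a :: complete_space"
  assumes osc: "\<And>c. 0 < c \<Longrightarrow> \<exists>d>0. \<forall>e e'. 0 < e \<longrightarrow> e < d \<longrightarrow> 0 < e' \<longrightarrow> e' < d \<longrightarrow> dist (T e) (T e') \<le> c"
  shows "\<exists>l. (T \<longlongrightarrow> l) (at_right 0)"
proof -
  let ?q = "\<lambda>n. inverse (real (Suc n))"
  have ev: "eventually (\<lambda>n. ?q n < d) sequentially" if "0 < d" for d :: real
    by (rule order_tendstoD(2)[OF LIMSEQ_inverse_real_of_nat that])
  have "Cauchy (\<lambda>n. T (?q n))"
  proof (rule metric_CauchyI)
    fix c :: real assume c: "0 < c"
    obtain d where d: "0 < d" "\<And>e e'. 0 < e \<Longrightarrow> e < d \<Longrightarrow> 0 < e' \<Longrightarrow> e' < d \<Longrightarrow> dist (T e) (T e') \<le> c/2"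
      using osc[of "c/2"] c by auto
    obtain N where "\<And>n. N \<le> n \<Longrightarrow> ?q n < d" using ev[OF d(1)] unfolding eventually_sequentially by blast
    hence "dist (T (?q m)) (T (?q n)) < c" if "N \<le> m" "N \<le> n" for m n
      using d(2)[of "?q m" "?q n"] that c by (auto simp del: of_nat_Suc)
    thus "\<exists>M. \<forall>m\<ge>M. \<forall>n\<ge>M. dist (T (?q m)) (T (?q n)) < c" by blast
  qed
  then obtain l where l: "(\<lambda>n. T (?q n)) \<longlonglongrightarrow> l"
    using Cauchy_convergent_iff convergent_def by blast
  have "(T \<longlongrightarrow> l) (at_right 0)"
  proof (rule tendstoI)
    fix c :: real assume c: "0 < c"
    obtain d where d: "0 < d" "\<And>e e'. 0 < e \<Longrightarrow> e < d \<Longrightarrow> 0 < e' \<Longrightarrow> e' < d \<Longrightarrow> dist (T e) (T e') \<le> c/2"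
      using osc[of "c/2"] c by auto
    have "eventually (\<lambda>n. ?q n < d \<and> dist (T (?q n)) l < c/2) sequentially"
      using ev[OF d(1)] tendstoD[OF l, of "c/2"] c by (auto simp del: of_nat_Suc intro: eventually_conj)
    then obtain n where n: "?q n < d" "dist (T (?q n)) l < c/2"
      using eventually_happens'[OF sequentially_bot] by blast
    have "dist (T e) l < c" if "0 < e" "e < d" for e
      using d(2)[OF that, of "?q n"] n dist_triangle[of "T e" l "T (?q n)"] by (auto simp del: of_nat_Suc)
    thus "eventually (\<lambda>e. dist (T e) l < c) (at_right 0)"
      unfolding eventually_at_right_field using d(1) by blast
  qed
  thus ?thesis ..
qed

lemma pv_limit_iff_small_oscillation: "(\<exists>l. pv_limit h t l) \<longleftrightarrow> (\<forall>c>0. small_oscillation h t c)"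
proof
  assume "\<exists>l. pv_limit h t l"
  then obtain l where l: "((\<lambda>e. truncated_hilbert h e t) \<longlongrightarrow> l) (at_right 0)"
    "((\<lambda>e. conj_poisson h e t) \<longlongrightarrow> l) (at_right 0)" by (auto simp: pv_limit_def)
  show "\<forall>c>0. small_oscillation h t c"
  proof (intro allI impI)
    fix c :: real assume c: "0 < c"
    have "eventually (\<lambda>e. dist (truncated_hilbert h e t) l < c/2 \<and> dist (conj_poisson h e t) l < c/2) (at_right 0)"
      using l c by (intro eventually_conj tendstoD) auto
    then obtain d where d: "0 < d" "\<And>e. 0 < e \<Longrightarrow> e < d \<Longrightarrow> dist (truncated_hilbert h e t) l < c/2 \<and> dist (conj_poisson h e t) l < c/2"
      unfolding eventually_at_right_field by auto
    have tri: "cmod (a - b) \<le> c" if "dist a l < c/2" "dist b l < c/2" for a b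
      using dist_triangle_half_l[OF that] by (simp add: dist_norm)
    show "small_oscillation h t c"
      unfolding small_oscillation_def by (rule exI[of _ d]) (use d tri in blast)
  qed
next
  assume osc: "\<forall>c>0. small_oscillation h t c"
  have "\<exists>l. ((\<lambda>e. truncated_hilbert h e t) \<longlongrightarrow> l) (at_right 0)"
  proof (rule convergent_at_right_0I)
    fix c :: real assume "0 < c"
    thus "\<exists>d>0. \<forall>e e'. 0 < e \<longrightarrow> e < d \<longrightarrow> 0 < e' \<longrightarrow> e' < d \<longrightarrow>
        dist (truncated_hilbert h e t) (truncated_hilbert h e' t) \<le> c"
      using osc unfolding small_oscillation_def dist_norm by meson
  qed
  then obtain l where l: "((\<lambda>e. truncated_hilbert h e t) \<longlongrightarrow> l) (at_right 0)" ..
  have "((\<lambda>e. truncated_hilbert h e t - conj_poisson h e t) \<longlongrightarrow> 0) (at_right 0)"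
  proof (rule tendstoI)
    fix c :: real assume c: "0 < c"
    hence "small_oscillation h t (c/2)" using osc by simp
    then obtain d where "0 < d" "\<And>e. 0 < e \<Longrightarrow> e < d \<Longrightarrow> cmod (truncated_hilbert h e t - conj_poisson h e t) \<le> c/2"
      unfolding small_oscillation_def by blast
    thus "eventually (\<lambda>e. dist (truncated_hilbert h e t - conj_poisson h e t) 0 < c) (at_right 0)"
      unfolding eventually_at_right_field using c by (intro exI[of _ d]) (force simp: dist_norm)
  qed
  from tendsto_diff[OF l this] show "\<exists>l. pv_limit h t l" using l by (auto simp: pv_limit_def)
qed

lemma pv_limit_linear:
  assumes f: "integrable mu f" and g: "integrable mu g" and l: "pv_limit f t l" "pv_limit g t k"
  shows "pv_limit (\<lambda>x. u * f x + v * g x) t (u * l + v * k)"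
proof -
  have 1: "((\<lambda>e. u * truncated_hilbert f e t + v * truncated_hilbert g e t) \<longlongrightarrow> u * l + v * k) (at_right 0)"
    and 2: "((\<lambda>e. u * conj_poisson f e t + v * conj_poisson g e t) \<longlongrightarrow> u * l + v * k) (at_right 0)"
    using l by (auto simp: pv_limit_def intro!: tendsto_intros)
  have "eventually (\<lambda>e. truncated_hilbert (\<lambda>x. u * f x + v * g x) e t = u * truncated_hilbert f e t + v * truncated_hilbert g e t) (at_right 0)"
    "eventually (\<lambda>e. conj_poisson (\<lambda>x. u * f x + v * g x) e t = u * conj_poisson f e t + v * conj_poisson g e t) (at_right 0)"
    using truncations_linear[OF f g, of _ u v t] unfolding eventually_at_right_field by (auto intro!: exI[of _ 1])
  from this[THEN tendsto_cong] 1 2 show ?thesis by (auto simp: pv_limit_def)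
qed

text \<open>At a point where the oscillation of \<open>f\<close> is large, some truncation of \<open>f - s n\<close> must be large,
  for every \<open>n\<close>. The sets where this happens have arbitrarily small measure.\<close>

lemma AE_pv_limit_closed:
  assumes s: "\<And>n. integrable mu (s n)" and pv: "\<And>n. AE t in mu. \<exists>l. pv_limit (s n) t l"
    and f: "integrable mu f" and lim: "(\<lambda>n. \<integral>x. cmod (f x - s n x) \<partial>mu) \<longlonglongrightarrow> 0"
  shows "AE t in mu. \<exists>l. pv_limit f t l"
proof -
  have small: "AE t in mu. small_oscillation f t (3 * c)" if c: "0 < c" for c
  proof -
    define good where "good j n E \<longleftrightarrow> E \<in> sets borel \<and> emeasure lborel E \<le> ennreal ((1/2) ^ j) \<and>
       (\<forall>t. t \<notin> E \<longrightarrow> (\<forall>y>0. cmod (truncated_hilbert (\<lambda>x. 1 * f x + (-1) * s n x) y t) \<le> c \<and>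
         cmod (conj_poisson (\<lambda>x. 1 * f x + (-1) * s n x) y t) \<le> c))" for j :: nat and n E
    have "\<exists>n E. good j n E" for j
    proof -
      obtain d where d: "0 < d" and dd: "\<And>h. integrable mu h \<Longrightarrow> (\<integral>x. cmod (h x) \<partial>mu) \<le> d \<Longrightarrow>
        (\<exists>E\<in>sets borel. emeasure lborel E \<le> ennreal ((1/2)^j) \<and>
         (\<forall>t. t \<notin> E \<longrightarrow> (\<forall>y>0. cmod (truncated_hilbert h y t) \<le> c \<and> cmod (conj_poisson h y t) \<le> c)))"
        using truncations_small_off_small_set[OF c, of "(1/2)^j"] by auto
      have "eventually (\<lambda>n. (\<integral>x. cmod (f x - s n x) \<partial>mu) < d) sequentially"
        by (rule order_tendstoD(2)[OF lim d])
      then obtain n where n: "(\<integral>x. cmod (f x - s n x) \<partial>mu) < d"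
        using eventually_happens'[OF sequentially_bot] by blast
      show ?thesis using dd[of "\<lambda>x. 1 * f x + (-1) * s n x"] f s n by (auto simp: less_imp_le good_def)
    qed
    then obtain n E where "\<And>j. good j (n j) (E j)" by metis
    hence E: "\<And>j. E j \<in> sets borel" "\<And>j. emeasure lborel (E j) \<le> ennreal ((1/2) ^ j)"
       "\<And>j t y. t \<notin> E j \<Longrightarrow> 0 < y \<Longrightarrow> cmod (truncated_hilbert (\<lambda>x. 1 * f x + (-1) * s (n j) x) y t) \<le> c"
       "\<And>j t y. t \<notin> E j \<Longrightarrow> 0 < y \<Longrightarrow> cmod (conj_poisson (\<lambda>x. 1 * f x + (-1) * s (n j) x) y t) \<le> c"
      by (simp_all only: good_def) auto
    have "emeasure lborel (\<Inter>j. E j) \<le> ennreal ((1/2) ^ j)" for j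
      using E(1) by (intro order_trans[OF emeasure_mono E(2)[of j]]) auto
    moreover have "(\<lambda>j. ennreal ((1/2) ^ j)) \<longlonglongrightarrow> ennreal 0"
      by (intro tendsto_ennrealI LIMSEQ_realpow_zero) auto
    ultimately have "emeasure lborel (\<Inter>j. E j) \<le> ennreal 0"
      by (intro LIMSEQ_le_const) auto
    hence "(\<Inter>j. E j) \<in> null_sets lborel" using E(1) by (intro null_setsI) (auto intro: sets.countable_INT')
    hence "AE t in lborel. t \<notin> (\<Inter>j. E j)" by (rule AE_not_in)
    hence "AE t in mu. t \<notin> (\<Inter>j. E j)" unfolding AE_mu_iff by eventually_elim auto
    moreover have "AE t in mu. \<forall>k. \<exists>l. pv_limit (s k) t l" using pv by (simp add: AE_all_countable)
    ultimately show ?thesis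
    proof eventually_elim
      case (elim t)
      then obtain j where j: "t \<notin> E j" by auto
      have "small_oscillation (s (n j)) t c" using elim(2) c pv_limit_iff_small_oscillation by blast
      then obtain d where d: "0 < d" "\<And>e e'. 0 < e \<Longrightarrow> e < d \<Longrightarrow> 0 < e' \<Longrightarrow> e' < d \<Longrightarrow>
         cmod (truncated_hilbert (s (n j)) e t - truncated_hilbert (s (n j)) e' t) \<le> c \<and>
         cmod (truncated_hilbert (s (n j)) e t - conj_poisson (s (n j)) e' t) \<le> c"
        unfolding small_oscillation_def by blast
      have T: "cmod (truncated_hilbert f e t - truncated_hilbert (s (n j)) e t) \<le> c"
        "cmod (conj_poisson f e t - conj_poisson (s (n j)) e t) \<le> c" if "0 < e" for e
        using E(3,4)[OF j that] truncations_linear[OF f s that, of 1 "-1" "n j" t] by auto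
      have tri: "cmod (a - b) \<le> 3 * c" if "cmod (a - a') \<le> c" "cmod (b - b') \<le> c" "cmod (a' - b') \<le> c" for a b a' b'
      proof -
        have "cmod (a - b) = cmod ((a - a') + (a' - b') - (b - b'))" by simp
        thus ?thesis using norm_triangle_ineq4[of "(a - a') + (a' - b')" "b - b'"]
          norm_triangle_ineq[of "a - a'" "a' - b'"] that by linarith
      qed
      show ?case unfolding small_oscillation_def
        by (intro exI[of _ d] conjI allI impI d(1); rule tri[OF T(1) T(1)] tri[OF T(1) T(2)]) (use d(2) in auto)
    qed
  qed
  have "AE t in mu. \<forall>k::nat. small_oscillation f t (3 * inverse (real (Suc k)))"
    unfolding AE_all_countable by (intro allI small) simp
  thus ?thesis
  proof eventually_elim
    case (elim t)
    show ?case unfolding pv_limit_iff_small_oscillation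
    proof (intro allI impI)
      fix c :: real assume "0 < c"
      then obtain k where "inverse (real (Suc k)) < c / 3" using reals_Archimedean[of "c/3"] by auto
      hence "3 * inverse (real (Suc k)) \<le> c" by simp
      thus "small_oscillation f t c" using elim[rule_format, of k]
        unfolding small_oscillation_def by (meson order_trans)
    qed
  qed
qed

text \<open>Where the function is locally constant, an odd kernel contributes nothing near the singularity.\<close>

lemma odd_kernel_cancels:
  fixes h :: "real \<Rightarrow> complex" and k :: "real \<Rightarrow> real"
  assumes h: "integrable mu h" and k [measurable]: "k \<in> borel_measurable borel"
    and odd: "\<And>s. k (- s) = - k s" and K: "\<And>s. \<bar>k s\<bar> \<le> K"
    and d: "{t - d..t + d} \<subseteq> {-1<..<1}" and const: "\<And>x. \<bar>x - t\<bar> \<le> d \<Longrightarrow> h x = c"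
  shows "(\<integral>x. h x * of_real (k (x - t)) \<partial>mu) = (\<integral>x. h x * of_real (if d < \<bar>x - t\<bar> then k (x - t) else 0) \<partial>mu)"
proof -
  have K0: "0 \<le> K" using K[of 0] by linarith
  define g where "g s = (if d < \<bar>s\<bar> then 0 else k s)" for s
  have [measurable]: "g \<in> borel_measurable borel" unfolding g_def by measurable
  have i1: "integrable mu (\<lambda>x. h x * of_real (k (x - t)))"
    by (rule bounded_kernel_integrable(1)[OF h, where K = K]) (use K in auto)
  have i2: "integrable mu (\<lambda>x. h x * of_real (if d < \<bar>x - t\<bar> then k (x - t) else 0))"
    by (rule bounded_kernel_integrable(1)[OF h, where K = K]) (use K K0 in auto)
  have gs: "indicator {-1<..<1} x * g (x - t) = g (x - t)" for x
  proof (cases "\<bar>x - t\<bar> \<le> d")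
    case True
    hence "x \<in> {t - d..t + d}" by (auto simp: abs_le_iff)
    thus ?thesis using d by (auto simp: indicator_def)
  qed (simp add: g_def)
  have "(\<integral>x. g (x - t) \<partial>lborel) = (\<integral>x. g (t - x) \<partial>lborel)"
    using lborel_integral_real_affine[of "-1" "\<lambda>x. g (x - t)" "2 * t"] by simp
  also have "\<dots> = - (\<integral>x. g (x - t) \<partial>lborel)"
  proof -
    have "g (t - x) = - g (x - t)" for x using odd[of "x - t"] by (auto simp: g_def abs_minus_commute)
    thus ?thesis by simp
  qed
  finally have g0: "(\<integral>x. g (x - t) \<partial>lborel) = 0" by simp
  have "(\<integral>x. h x * of_real (k (x - t)) \<partial>mu) - (\<integral>x. h x * of_real (if d < \<bar>x - t\<bar> then k (x - t) else 0) \<partial>mu)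
     = (\<integral>x. c * of_real (g (x - t)) \<partial>mu)"
    by (subst Bochner_Integration.integral_diff[OF i1 i2, symmetric], rule Bochner_Integration.integral_cong)
       (auto simp: g_def const)
  also have "\<dots> = c * of_real (\<integral>x. g (x - t) \<partial>mu)" by simp
  also have "(\<integral>x. g (x - t) \<partial>mu) = (\<integral>x. indicator {-1<..<1} x *\<^sub>R g (x - t) \<partial>lborel)"
    unfolding mu_def by (rule integral_restrict_space) simp
  also have "\<dots> = 0" by (simp add: gs g0)
  finally show ?thesis by simp
qed

lemma pv_limit_locally_constant:
  fixes h :: "real \<Rightarrow> complex"
  assumes h: "integrable mu h" and d: "0 < d" "{t - d..t + d} \<subseteq> {-1<..<1}"
    and const: "\<And>x. \<bar>x - t\<bar> \<le> d \<Longrightarrow> h x = c"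
  shows "pv_limit h t (truncated_hilbert h d t)"
  unfolding pv_limit_def
proof
  have "truncated_hilbert h e t = truncated_hilbert h d t" if e: "0 < e" "e < d" for e
  proof -
    have "(\<integral>x. h x * of_real (trunc_kernel e (x - t)) \<partial>mu)
      = (\<integral>x. h x * of_real (if d < \<bar>x - t\<bar> then trunc_kernel e (x - t) else 0) \<partial>mu)"
      by (rule odd_kernel_cancels[OF h _ _ trunc_kernel_bound[OF e(1)] d(2) const]) (auto simp: trunc_kernel_def)
    also have "(\<lambda>x. if d < \<bar>x - t\<bar> then trunc_kernel e (x - t) else 0) = (\<lambda>x. trunc_kernel d (x - t))"
      using e by (auto simp: trunc_kernel_def)
    finally show ?thesis by (simp add: truncated_hilbert_def)
  qed
  hence "eventually (\<lambda>e. truncated_hilbert h e t = truncated_hilbert h d t) (at_right 0)"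
    unfolding eventually_at_right_field using d by blast
  thus "((\<lambda>e. truncated_hilbert h e t) \<longlongrightarrow> truncated_hilbert h d t) (at_right 0)"
    by (rule tendsto_eventually)
  show "((\<lambda>e. conj_poisson h e t) \<longlongrightarrow> truncated_hilbert h d t) (at_right 0)"
  proof (rule LIM_zero_cancel, rule Lim_null_comparison)
    let ?H = "\<integral>x. cmod (h x) \<partial>mu"
    have "((\<lambda>e::real. e\<^sup>2 / d ^ 3 * ?H) \<longlongrightarrow> 0\<^sup>2 / d ^ 3 * ?H) (at_right 0)"
      by (intro tendsto_intros) (use d in auto)
    thus "((\<lambda>e::real. e\<^sup>2 / d ^ 3 * ?H) \<longlongrightarrow> 0) (at_right 0)" by simp
    show "eventually (\<lambda>e. cmod (conj_poisson h e t - truncated_hilbert h d t) \<le> e\<^sup>2 / d ^ 3 * ?H) (at_right 0)"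
      unfolding eventually_at_right_field
    proof (intro exI[of _ d] conjI allI impI d(1))
      fix e assume e: "0 < e" "e < d"
      let ?k = "\<lambda>x. if d < \<bar>x - t\<bar> then conj_kernel e (x - t) else 0"
      have "(\<integral>x. h x * of_real (conj_kernel e (x - t)) \<partial>mu) = (\<integral>x. h x * of_real (?k x) \<partial>mu)"
        by (rule odd_kernel_cancels[OF h _ _ conj_kernel_bound[OF e(1)] d(2) const]) (auto simp: conj_kernel_def)
      hence "conj_poisson h e t - truncated_hilbert h d t
        = ((\<integral>x. h x * of_real (?k x) \<partial>mu) - (\<integral>x. h x * of_real (trunc_kernel d (x - t)) \<partial>mu)) / pi"
        by (simp add: conj_poisson_def truncated_hilbert_def diff_divide_distrib)
      also have "\<dots> = (\<integral>x. h x * of_real (?k x - trunc_kernel d (x - t)) \<partial>mu) / pi"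
      proof (subst Bochner_Integration.integral_diff[symmetric])
        show "integrable mu (\<lambda>x. h x * of_real (?k x))"
          by (rule bounded_kernel_integrable(1)[OF h, where K = "1 / e"]) (use conj_kernel_bound[OF e(1)] e in auto)
      qed (auto simp: right_diff_distrib intro!: truncation_kernels_integrable h d)
      also have "cmod \<dots> \<le> (e\<^sup>2 / d ^ 3 * ?H) / 1"
        unfolding norm_divide
      proof (rule frac_le)
        show "cmod (\<integral>x. h x * of_real (?k x - trunc_kernel d (x - t)) \<partial>mu) \<le> e\<^sup>2 / d ^ 3 * ?H"
        proof (rule bounded_kernel_integrable(2)[OF h])
          fix x
          show "cmod (of_real (?k x - trunc_kernel d (x - t))) \<le> e\<^sup>2 / d ^ 3"
          proof (cases "d < \<bar>x - t\<bar>")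
            case True
            define s where "s = x - t"
            have s: "d < \<bar>s\<bar>" "s \<noteq> 0" using True d by (auto simp: s_def)
            have p: "0 < s\<^sup>2 + e\<^sup>2" using e by (simp add: sum_power2_gt_zero_iff)
            have "conj_kernel e s - trunc_kernel d s = - (e\<^sup>2 / (s * (s\<^sup>2 + e\<^sup>2)))"
              using s p by (simp add: conj_kernel_def trunc_kernel_def field_simps power2_eq_square)
            also have "\<bar>\<dots>\<bar> = e\<^sup>2 / (\<bar>s\<bar> * (s\<^sup>2 + e\<^sup>2))" using p by (simp add: abs_mult abs_div)
            also have "\<dots> \<le> e\<^sup>2 / (d * d\<^sup>2)"
            proof (rule divide_left_mono)
              have "d\<^sup>2 \<le> \<bar>s\<bar>\<^sup>2" using s d by (intro power_mono) auto
              hence "d\<^sup>2 \<le> s\<^sup>2 + e\<^sup>2" by (simp add: add_increasing2)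
              thus "d * d\<^sup>2 \<le> \<bar>s\<bar> * (s\<^sup>2 + e\<^sup>2)" using s d by (intro mult_mono) auto
            qed (use d s p in auto)
            finally have "\<bar>conj_kernel e s - trunc_kernel d s\<bar> \<le> e\<^sup>2 / d ^ 3"
              by (simp add: power2_eq_square power3_eq_cube mult.assoc)
            thus ?thesis using True unfolding norm_of_real by (simp add: s_def)
          next
            case False
            thus ?thesis using d by (simp add: trunc_kernel_def)
          qed
        qed measurable
      qed (use pi_ge_two d in \<open>auto intro!: mult_nonneg_nonneg\<close>)
      finally show "cmod (conj_poisson h e t - truncated_hilbert h d t) \<le> e\<^sup>2 / d ^ 3 * ?H" by simp
    qed
  qed
qed

text \<open>The principal value exists for indicators of half-lines away from the end point, and the
  sets for which it exists almost everywhere form a Dynkin system.\<close>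

lemma AE_pv_limit_indicator:
  assumes "A \<in> sets borel"
  shows "AE t in mu. \<exists>l. pv_limit (indicator A) t l"
proof -
  have ii: "integrable mu (indicator A :: real \<Rightarrow> complex)" if [measurable]: "A \<in> sets borel" for A
    by (rule mu.integrable_const_bound[where B = 1]) (auto simp: indicator_def)
  have loc: "\<exists>l. pv_limit (indicator B) t l"
    if "B \<in> sets borel" "t \<in> {-1<..<1}" "0 < r" "\<And>x. \<bar>x - t\<bar> < r \<Longrightarrow> (indicator B x :: complex) = indicator B t" for B t r
  proof -
    define d where "d = min (r/2) (min ((t + 1)/2) ((1 - t)/2))"
    have "0 < d" "{t - d..t + d} \<subseteq> {-1<..<1}" using that(2,3) by (auto simp: d_def min_def field_simps)
    moreover have "indicator B x = (indicator B t :: complex)" if "\<bar>x - t\<bar> \<le> d" for x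
      by (rule \<open>\<And>x. \<bar>x - t\<bar> < r \<Longrightarrow> indicator B x = indicator B t\<close>) (use that \<open>0 < r\<close> in \<open>auto simp: d_def\<close>)
    ultimately show ?thesis using pv_limit_locally_constant[OF ii[OF that(1)]] by blast
  qed
  have U: "AE t in mu. \<exists>l. pv_limit (indicator UNIV) t l"
    by (rule AE_I2) (rule loc[of _ _ 1], auto)
  let ?G = "range (\<lambda>a::real. {..a})"
  have gen: "A \<in> sigma_sets UNIV ?G" using assms by (subst (asm) borel_eq_atMost) auto
  have "Int_stable ?G"
  proof (rule Int_stableI_image)
    fix a b :: real
    have "{..a} \<inter> {..b} = {..min a b}" by auto
    thus "\<exists>c\<in>UNIV. {..a} \<inter> {..b} = {..c}" by blast
  qed
  moreover have "?G \<subseteq> Pow UNIV" by simp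
  ultimately show ?thesis using gen
  proof (induct rule: sigma_sets_induct_disjoint)
    case (basic B)
    then obtain a where B: "B = {..a}" by auto
    have "AE t in mu. t \<noteq> a" unfolding AE_mu_iff using AE_lborel_singleton[of a] by eventually_elim auto
    moreover have "AE t in mu. t \<in> {-1<..<1}" by (rule AE_I2) simp
    ultimately show ?case
    proof eventually_elim
      case (elim t)
      show ?case unfolding B
        by (rule loc[of _ _ "\<bar>t - a\<bar>"]) (use elim in \<open>auto simp: indicator_def\<close>)
    qed
  next
    case empty
    show ?case by (rule AE_I2) (rule loc[of _ _ 1], auto)
  next
    case (compl B)
    have Bb: "B \<in> sets borel" using compl(1) by (subst borel_eq_atMost) auto
    show ?case using compl(2) U
    proof eventually_elim
      case (elim t)
      then obtain l k where "pv_limit (indicator B) t l" "pv_limit (indicator UNIV) t k" by auto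
      from pv_limit_linear[OF ii ii this(2,1), of 1 "-1"] Bb
      have "pv_limit (\<lambda>x. 1 * indicator UNIV x + - 1 * indicator B x) t (1 * k + - 1 * l)" by auto
      moreover have "(\<lambda>x. 1 * indicator UNIV x + - 1 * indicator B x :: complex) = indicator (UNIV - B)"
        by (auto simp: indicator_def)
      ultimately show ?case by auto
    qed
  next
    case (union B)
    have Bb: "B i \<in> sets borel" for i using union(2) by (subst borel_eq_atMost) auto
    have Sb: "(\<Union>i<n. B i) \<in> sets borel" for n :: nat using Bb by auto
    have part: "AE t in mu. \<exists>l. pv_limit (indicator (\<Union>i<n. B i)) t l" for n :: nat
    proof (induction n)
      case 0
      show ?case by (rule AE_I2) (rule loc[of _ _ 1], auto)
    next
      case (Suc n)
      show ?case using Suc union(3)[of n]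
      proof eventually_elim
        case (elim t)
        then obtain l k where "pv_limit (indicator (\<Union>i<n. B i)) t l" "pv_limit (indicator (B n)) t k" by auto
        from pv_limit_linear[OF ii[OF Sb] ii[OF Bb] this, of 1 1]
        have "pv_limit (\<lambda>x. 1 * indicator (\<Union>i<n. B i) x + 1 * indicator (B n) x) t (1 * l + 1 * k)" .
        moreover have "(\<lambda>x. 1 * indicator (\<Union>i<n. B i) x + 1 * indicator (B n) x :: complex) = indicator (\<Union>i<Suc n. B i)"
        proof
          fix x
          have "x \<notin> B n" if "i < n" "x \<in> B i" for i
            using union(1)[unfolded disjoint_family_on_def, rule_format, of i n] that by auto
          thus "1 * indicator (\<Union>i<n. B i) x + 1 * indicator (B n) x = (indicator (\<Union>i<Suc n. B i) x :: complex)"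
            by (auto simp: indicator_def less_Suc_eq)
        qed
        ultimately show ?case by auto
      qed
    qed
    show ?case
    proof (rule AE_pv_limit_closed[OF ii[OF Sb] part ii])
      show "(\<Union>i. B i) \<in> sets borel" using Bb by auto
      have [measurable]: "\<And>i. B i \<in> sets borel" by (rule Bb)
      have "(\<lambda>n. \<integral>x. cmod (indicator (\<Union>i. B i) x - indicator (\<Union>i<n. B i) x) \<partial>mu) \<longlonglongrightarrow> (\<integral>x. 0 \<partial>mu)"
      proof (rule integral_dominated_convergence[where w = "\<lambda>_. 1"])
        show "AE x in mu. (\<lambda>n. cmod (indicator (\<Union>i. B i) x - indicator (\<Union>i<n. B i) x)) \<longlonglongrightarrow> 0"
        proof (rule AE_I2)
          fix x
          have "eventually (\<lambda>n. cmod (indicator (\<Union>i. B i) x - indicator (\<Union>i<n. B i) x) = 0) sequentially"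
          proof (cases "\<exists>i. x \<in> B i")
            case True
            then obtain i where "x \<in> B i" by auto
            have "cmod (indicator (\<Union>i. B i) x - indicator (\<Union>i<n. B i) x) = 0" if "i < n" for n
              using \<open>x \<in> B i\<close> that by (auto simp: indicator_def)
            thus ?thesis by (rule eventually_mono[OF eventually_gt_at_top[of i]])
          qed (auto simp: indicator_def)
          thus "(\<lambda>n. cmod (indicator (\<Union>i. B i) x - indicator (\<Union>i<n. B i) x)) \<longlonglongrightarrow> 0"
            by (rule tendsto_eventually)
        qed
      qed (auto simp: indicator_def)
      thus "(\<lambda>n. \<integral>x. cmod (indicator (\<Union>i. B i) x - indicator (\<Union>i<n. B i) x) \<partial>mu) \<longlonglongrightarrow> 0" by simp
    qed
  qed
qed

lemma AE_pv_limit_ex: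
  assumes "integrable mu h"
  shows "AE t in mu. \<exists>l. pv_limit h t l"
  using assms
proof (induct rule: integrable_induct)
  case (base A c)
  hence A: "A \<in> sets borel" by (simp add: sets_mu)
  have i: "integrable mu (indicator A :: real \<Rightarrow> complex)"
    by (rule mu.integrable_const_bound[where B = 1]) (use A in \<open>auto simp: indicator_def\<close>)
  show ?case using AE_pv_limit_indicator[OF A]
  proof eventually_elim
    case (elim t)
    then obtain l where "pv_limit (indicator A) t l" by auto
    from pv_limit_linear[OF i i this this, of c 0]
    have "pv_limit (\<lambda>x. c * indicator A x) t (c * l)" by simp
    moreover have "(\<lambda>x. c * indicator A x) = (\<lambda>x. indicator A x *\<^sub>R c)" by (auto simp: indicator_def)
    ultimately show ?case by auto
  qed
next
  case (add f g)
  show ?case using add(2,4)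
  proof eventually_elim
    case (elim t)
    then obtain l k where "pv_limit f t l" "pv_limit g t k" by auto
    from pv_limit_linear[OF add(1,3) this, of 1 1] show ?case by auto
  qed
next
  case (lim f s)
  show ?case
  proof (rule AE_pv_limit_closed[OF lim(1,2,5)])
    note [measurable] = borel_measurable_integrable[OF lim(1)] borel_measurable_integrable[OF lim(5)]
    have "(\<lambda>n. \<integral>x. cmod (f x - s n x) \<partial>mu) \<longlonglongrightarrow> (\<integral>x. 0 \<partial>mu)"
    proof (rule integral_dominated_convergence[where w = "\<lambda>x. 3 * cmod (f x)"])
      show "integrable mu (\<lambda>x. 3 * cmod (f x))" using lim(5) by simp
      show "AE x in mu. (\<lambda>n. cmod (f x - s n x)) \<longlonglongrightarrow> 0"
      proof (rule AE_I2)
        fix x assume "x \<in> space mu"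
        hence "(\<lambda>n. cmod (f x - s n x)) \<longlonglongrightarrow> cmod (f x - f x)" by (intro tendsto_intros lim(3))
        thus "(\<lambda>n. cmod (f x - s n x)) \<longlonglongrightarrow> 0" by simp
      qed
      show "AE x in mu. norm (cmod (f x - s n x)) \<le> 3 * cmod (f x)" for n
      proof (rule AE_I2)
        fix x assume "x \<in> space mu"
        from lim(4)[OF this, of n] show "norm (cmod (f x - s n x)) \<le> 3 * cmod (f x)"
          using norm_triangle_ineq4[of "f x" "s n x"] by simp
      qed
    qed measurable
    thus "(\<lambda>n. \<integral>x. cmod (f x - s n x) \<partial>mu) \<longlonglongrightarrow> 0" by simp
  qed
qed

lemma finite_hilbert_eq_Lim:
  assumes h: "integrable mu h" and t: "t \<in> {-1<..<1}"
  shows "finite_hilbert h t = Lim (at_right 0) (\<lambda>e. truncated_hilbert h e t)"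
proof -
  have eq: "complex_of_real (1 / pi) *
       ((LINT x:{-1<..<t - e}|lborel. h x / complex_of_real (x - t)) +
        (LINT x:{t + e<..<1}|lborel. h x / complex_of_real (x - t))) = truncated_hilbert h e t" if e: "0 < e" for e
  proof -
    let ?g = "\<lambda>x. indicator {-1<..<1} x *\<^sub>R (h x * of_real (trunc_kernel e (x - t)))"
    have int: "integrable lborel ?g"
      using truncation_kernels_integrable(1)[OF h e, of t]
      unfolding mu_def by (subst (asm) integrable_restrict_space) auto
    have L: "(LINT x:{-1<..<t - e}|lborel. h x / complex_of_real (x - t)) = (\<integral>x. indicator {..<t} x *\<^sub>R ?g x \<partial>lborel)"
      unfolding set_lebesgue_integral_def
      by (rule Bochner_Integration.integral_cong) (use t e in \<open>auto simp: indicator_def trunc_kernel_def divide_inverse\<close>)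
    have R: "(LINT x:{t + e<..<1}|lborel. h x / complex_of_real (x - t)) = (\<integral>x. indicator {t..} x *\<^sub>R ?g x \<partial>lborel)"
      unfolding set_lebesgue_integral_def
      by (rule Bochner_Integration.integral_cong) (use t e in \<open>auto simp: indicator_def trunc_kernel_def divide_inverse\<close>)
    have "(LINT x:{-1<..<t - e}|lborel. h x / complex_of_real (x - t)) +
        (LINT x:{t + e<..<1}|lborel. h x / complex_of_real (x - t)) = (\<integral>x. indicator {..<t} x *\<^sub>R ?g x + indicator {t..} x *\<^sub>R ?g x \<partial>lborel)"
      unfolding L R by (rule Bochner_Integration.integral_add[symmetric]) (auto intro!: integrable_mult_indicator int simp del: scaleR_scaleR)
    also have "\<dots> = (\<integral>x. ?g x \<partial>lborel)"
      by (rule Bochner_Integration.integral_cong) (auto simp: indicator_def)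
    also have "\<dots> = (\<integral>x. h x * of_real (trunc_kernel e (x - t)) \<partial>mu)"
      unfolding mu_def by (rule integral_restrict_space[symmetric]) simp
    finally show ?thesis by (simp add: truncated_hilbert_def)
  qed
  show ?thesis unfolding finite_hilbert_def
    by (rule Lim_cong) (use eq in \<open>auto simp: eventually_at_right_field intro!: exI[of _ 1]\<close>)
qed

lemma finite_hilbert_eqI:
  assumes "integrable mu h" "t \<in> {-1<..<1}" "pv_limit h t l"
  shows "finite_hilbert h t = l"
  unfolding finite_hilbert_eq_Lim[OF assms(1,2)]
  using assms(3) by (intro tendsto_Lim) (auto simp: pv_limit_def)

lemma AE_mu_space: "AE t in mu. t \<in> {-1<..<1}"
  by (rule AE_I2) simp

theorem AE_pv_limit_finite_hilbert:
  assumes h: "integrable mu h"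
  shows "AE t in mu. pv_limit h t (finite_hilbert h t)"
  using AE_pv_limit_ex[OF h] AE_mu_space
  by eventually_elim (auto simp: finite_hilbert_eqI[OF h])

lemma inverse_Suc_at_right_0: "filterlim (\<lambda>n. inverse (real (Suc n))) (at_right 0) sequentially"
  using LIMSEQ_inverse_real_of_nat by (auto simp: filterlim_at simp del: of_nat_Suc)

lemma AE_conj_poisson_tendsto:
  assumes h: "integrable mu h"
  shows "AE t in mu. (\<lambda>n. conj_poisson h (inverse (real (Suc n))) t) \<longlonglongrightarrow> finite_hilbert h t"
  using AE_pv_limit_finite_hilbert[OF h]
  by eventually_elim (simp only: pv_limit_def, elim conjE, rule filterlim_compose[OF _ inverse_Suc_at_right_0])

lemma finite_hilbert_linear:
  assumes f: "integrable mu f" and g: "integrable mu g"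
  shows "AE t in mu. finite_hilbert (\<lambda>x. u * f x + v * g x) t = u * finite_hilbert f t + v * finite_hilbert g t"
  using AE_pv_limit_finite_hilbert[OF f] AE_pv_limit_finite_hilbert[OF g] AE_mu_space
  by eventually_elim (rule finite_hilbert_eqI, use f g in auto, rule pv_limit_linear[OF f g, simplified])

lemma finite_hilbert_cong_AE:
  assumes "integrable mu f" "g \<in> borel_measurable mu" and ae: "AE x in mu. f x = g x" and t: "t \<in> {-1<..<1}"
  shows "finite_hilbert f t = finite_hilbert g t"
proof -
  have g: "integrable mu g" using assms(1,2) ae by (metis borel_measurable_integrable integrable_cong_AE)
  have "truncated_hilbert f e t = truncated_hilbert g e t" for e
    unfolding truncated_hilbert_def using ae assms(1) g
    by (intro arg_cong2[where f = "(/)"] integral_cong_AE borel_measurable_times) auto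
  thus ?thesis unfolding finite_hilbert_eq_Lim[OF assms(1) t] finite_hilbert_eq_Lim[OF g t] by simp
qed

lemma truncated_hilbert_right_continuous:
  fixes h :: "real \<Rightarrow> complex" and q :: "nat \<Rightarrow> real"
  assumes h: "integrable mu h" and e: "0 < e" and q: "\<And>n. e < q n" "q \<longlonglongrightarrow> e"
  shows "(\<lambda>n. truncated_hilbert h (q n) t) \<longlonglongrightarrow> truncated_hilbert h e t"
  unfolding truncated_hilbert_def
proof (intro tendsto_divide tendsto_const integral_dominated_convergence[where w = "\<lambda>x. cmod (h x) / e"])
  note [measurable] = borel_measurable_integrable[OF h]
  show "integrable mu (\<lambda>x. cmod (h x) / e)" using h by simp
  show "AE x in mu. (\<lambda>n. h x * of_real (trunc_kernel (q n) (x - t))) \<longlonglongrightarrow> h x * of_real (trunc_kernel e (x - t))"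
  proof (rule AE_I2)
    fix x
    have "eventually (\<lambda>n. trunc_kernel (q n) (x - t) = trunc_kernel e (x - t)) sequentially"
    proof (cases "e < \<bar>x - t\<bar>")
      case True
      have "eventually (\<lambda>n. q n < \<bar>x - t\<bar>) sequentially" by (rule order_tendstoD(2)[OF q(2) True])
      thus ?thesis by eventually_elim (use True in \<open>simp add: trunc_kernel_def\<close>)
    next
      case False
      have "trunc_kernel (q n) (x - t) = trunc_kernel e (x - t)" for n
        using q(1)[of n] False by (simp add: trunc_kernel_def)
      thus ?thesis by simp
    qed
    hence "(\<lambda>n. trunc_kernel (q n) (x - t)) \<longlonglongrightarrow> trunc_kernel e (x - t)" by (rule tendsto_eventually)
    thus "(\<lambda>n. h x * of_real (trunc_kernel (q n) (x - t))) \<longlonglongrightarrow> h x * of_real (trunc_kernel e (x - t))"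
      by (intro tendsto_intros)
  qed
  show "AE x in mu. norm (h x * of_real (trunc_kernel (q n) (x - t))) \<le> cmod (h x) / e" for n
  proof (rule AE_I2)
    fix x
    have "\<bar>trunc_kernel (q n) (x - t)\<bar> \<le> 1 / q n" using q(1)[of n] e by (intro trunc_kernel_bound) simp
    also have "\<dots> \<le> 1 / e" using q(1)[of n] e by (intro divide_left_mono) auto
    finally have "cmod (h x) * \<bar>trunc_kernel (q n) (x - t)\<bar> \<le> cmod (h x) * (1 / e)" by (rule mult_left_mono) simp
    thus "norm (h x * of_real (trunc_kernel (q n) (x - t))) \<le> cmod (h x) / e" by (simp add: norm_mult)
  qed
qed (use h pi_gt_zero in \<open>auto intro!: borel_measurable_times\<close>)

lemma convolution_measurable:
  fixes h :: "real \<Rightarrow> complex" and k :: "real \<Rightarrow> real"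
  assumes h: "h \<in> borel_measurable mu" and k: "k \<in> borel_measurable borel"
  shows "(\<lambda>t. \<integral>x. h x * of_real (k (x - t)) \<partial>mu) \<in> borel_measurable borel"
proof (rule mu.borel_measurable_lebesgue_integral)
  have d: "(\<lambda>p. snd p - fst p) \<in> borel_measurable (borel \<Otimes>\<^sub>M mu)"
    by (intro borel_measurable_diff measurable_compose[OF measurable_snd borel_measurable_mu] measurable_fst) simp
  show "(\<lambda>(t, x). h x * of_real (k (x - t))) \<in> borel_measurable (borel \<Otimes>\<^sub>M mu)"
    unfolding split_beta
    using measurable_compose[OF d k] measurable_compose[OF measurable_snd h] by measurable
qed

lemma truncations_measurable [measurable]:
  assumes "h \<in> borel_measurable mu"
  shows "(\<lambda>t. truncated_hilbert h e t) \<in> borel_measurable borel"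
    and "(\<lambda>t. conj_poisson h e t) \<in> borel_measurable borel"
  unfolding truncated_hilbert_def conj_poisson_def
  by (intro borel_measurable_divide convolution_measurable assms; simp)+

text \<open>Because the truncations are right continuous in the truncation parameter, their convergence can be
  tested on rational parameters, which makes the set of convergence measurable. Off this set
  \<^const>\<open>Lim\<close> takes one fixed value.\<close>

lemma finite_hilbert_measurable:
  assumes h: "integrable mu h"
  shows "finite_hilbert h \<in> borel_measurable mu"
proof -
  let ?T = "\<lambda>e t. truncated_hilbert h e t"
  have hm [measurable]: "h \<in> borel_measurable mu" using h by simp
  define C where "C t \<longleftrightarrow> (\<forall>k::nat. \<exists>n::nat. \<forall>p r::rat. 0 < (of_rat p :: real) \<longrightarrow> (of_rat p :: real) < inverse (Suc n) \<longrightarrow> 0 < (of_rat r :: real) \<longrightarrow>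
     (of_rat r :: real) < inverse (Suc n) \<longrightarrow> cmod (?T (of_rat p) t - ?T (of_rat r) t) \<le> inverse (Suc k))" for t
  have [measurable]: "Measurable.pred mu C" unfolding C_def by measurable
  have C: "C t \<longleftrightarrow> (\<exists>l. ((\<lambda>e. ?T e t) \<longlongrightarrow> l) (at_right 0))" for t
  proof
    assume "\<exists>l. ((\<lambda>e. ?T e t) \<longlongrightarrow> l) (at_right 0)"
    then obtain l where l: "((\<lambda>e. ?T e t) \<longlongrightarrow> l) (at_right 0)" ..
    show "C t" unfolding C_def
    proof
      fix k :: nat
      have "eventually (\<lambda>e. dist (?T e t) l < inverse (Suc k) / 2) (at_right 0)"
        by (rule tendstoD[OF l]) simp
      then obtain d where d: "0 < d" "\<And>e. 0 < e \<Longrightarrow> e < d \<Longrightarrow> dist (?T e t) l < inverse (Suc k) / 2"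
        unfolding eventually_at_right_field by auto
      obtain n where n: "inverse (real (Suc n)) < d" using reals_Archimedean[OF d(1)] by blast
      have "cmod (?T p t - ?T r t) \<le> inverse (Suc k)"
        if "0 < p" "p < inverse (real (Suc n))" "0 < r" "r < inverse (real (Suc n))" for p r
        using dist_triangle_half_l[OF d(2)[of p] d(2)[of r]] that n by (auto simp: dist_norm simp del: of_nat_Suc)
      thus "\<exists>n::nat. \<forall>p r::rat. 0 < (of_rat p :: real) \<longrightarrow> (of_rat p :: real) < inverse (Suc n) \<longrightarrow> 0 < (of_rat r :: real) \<longrightarrow>
        (of_rat r :: real) < inverse (Suc n) \<longrightarrow> cmod (?T (of_rat p) t - ?T (of_rat r) t) \<le> inverse (Suc k)"
        by blast
    qed
  next
    assume Ct: "C t"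
    show "\<exists>l. ((\<lambda>e. ?T e t) \<longlongrightarrow> l) (at_right 0)"
    proof (rule convergent_at_right_0I)
      fix c :: real assume "0 < c"
      then obtain k where k: "inverse (real (Suc k)) < c" using reals_Archimedean by blast
      obtain n :: nat where n: "\<And>p r::rat. 0 < (of_rat p :: real) \<Longrightarrow> (of_rat p :: real) < inverse (Suc n) \<Longrightarrow> 0 < (of_rat r :: real) \<Longrightarrow>
        (of_rat r :: real) < inverse (Suc n) \<Longrightarrow> cmod (?T (of_rat p) t - ?T (of_rat r) t) \<le> inverse (Suc k)"
        using Ct unfolding C_def by blast
      let ?d = "inverse (real (Suc n))"
      have seq: "\<exists>q::nat \<Rightarrow> rat. (\<forall>i. e < of_rat (q i)) \<and> (\<forall>i. of_rat (q i) < ?d) \<and> (\<lambda>i. ?T (of_rat (q i)) t) \<longlonglongrightarrow> ?T e t"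
        if e: "0 < e" "e < ?d" for e
      proof -
        have "\<exists>q::rat. e < of_rat q \<and> of_rat q < min ?d (e + inverse (real (Suc i)))" for i
          by (rule of_rat_dense) (use e in \<open>simp del: of_nat_Suc\<close>)
        then obtain q :: "nat \<Rightarrow> rat" where q: "\<And>i. e < of_rat (q i)" "\<And>i. of_rat (q i) < min ?d (e + inverse (real (Suc i)))"
          by metis
        have "(\<lambda>i. of_rat (q i) :: real) \<longlonglongrightarrow> e"
        proof (rule tendsto_sandwich[where f = "\<lambda>_. e" and h = "\<lambda>i. e + inverse (real (Suc i))"])
          show "(\<lambda>i. e + inverse (real (Suc i))) \<longlonglongrightarrow> e"
            using tendsto_add[OF tendsto_const[of e] LIMSEQ_inverse_real_of_nat] by simp
          show "eventually (\<lambda>i. of_rat (q i) \<le> e + inverse (real (Suc i))) sequentially"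
            using q(2) by (intro always_eventually allI) (meson less_imp_le min_less_iff_conj)
          show "eventually (\<lambda>i. e \<le> of_rat (q i)) sequentially"
            using q(1) by (intro always_eventually allI less_imp_le)
        qed simp
        from truncated_hilbert_right_continuous[OF h e(1) q(1) this]
        show ?thesis using q by auto
      qed
      show "\<exists>d>0. \<forall>e e'. 0 < e \<longrightarrow> e < d \<longrightarrow> 0 < e' \<longrightarrow> e' < d \<longrightarrow> dist (?T e t) (?T e' t) \<le> c"
      proof (rule exI[of _ ?d], intro conjI allI impI)
        fix e e' assume e: "0 < e" "e < ?d" and e': "0 < e'" "e' < ?d"
        obtain p where p: "\<forall>i. e < of_rat (p i)" "\<forall>i. of_rat (p i) < ?d" "(\<lambda>i. ?T (of_rat (p i)) t) \<longlonglongrightarrow> ?T e t"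
          using seq[OF e] by blast
        obtain r where r: "\<forall>i. e' < of_rat (r i)" "\<forall>i. of_rat (r i) < ?d" "(\<lambda>i. ?T (of_rat (r i)) t) \<longlonglongrightarrow> ?T e' t"
          using seq[OF e'] by blast
        have "(\<lambda>i. cmod (?T (of_rat (p i)) t - ?T (of_rat (r i)) t)) \<longlonglongrightarrow> cmod (?T e t - ?T e' t)"
          by (intro tendsto_intros p(3) r(3))
        moreover have "cmod (?T (of_rat (p i)) t - ?T (of_rat (r i)) t) \<le> inverse (Suc k)" for i
          by (rule n) (use p(1,2) r(1,2) less_trans[OF e(1)] less_trans[OF e'(1)] in blast)+
        ultimately have "cmod (?T e t - ?T e' t) \<le> inverse (Suc k)"
          by (intro LIMSEQ_le_const2) auto
        thus "dist (?T e t) (?T e' t) \<le> c" using k by (simp add: dist_norm del: of_nat_Suc)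
      qed simp
    qed
  qed
  have "finite_hilbert h t = (if C t then lim (\<lambda>n. ?T (inverse (real (Suc n))) t) else (THE l. False))" if t: "t \<in> space mu" for t
  proof (cases "C t")
    case True
    then obtain l where l: "((\<lambda>e. ?T e t) \<longlongrightarrow> l) (at_right 0)" using C by blast
    have "(\<lambda>n. ?T (inverse (real (Suc n))) t) \<longlonglongrightarrow> l" by (rule filterlim_compose[OF l inverse_Suc_at_right_0])
    hence "lim (\<lambda>n. ?T (inverse (real (Suc n))) t) = l" by (rule limI)
    moreover have "finite_hilbert h t = l"
      using finite_hilbert_eq_Lim[OF h] t l by (simp add: tendsto_Lim)
    ultimately show ?thesis using True by simp
  next
    case False
    hence "(\<lambda>l. ((\<lambda>e. ?T e t) \<longlongrightarrow> l) (at_right 0)) = (\<lambda>l. False)" using C by blast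
    thus ?thesis using False finite_hilbert_eq_Lim[OF h] t by (simp add: t2_space_class.Lim_def)
  qed
  moreover have "(\<lambda>t. if C t then lim (\<lambda>n. ?T (inverse (real (Suc n))) t) else (THE l. False)) \<in> borel_measurable mu"
    by (intro measurable_If borel_measurable_lim_metric) measurable
  ultimately show ?thesis by (subst measurable_cong) auto
qed

text \<open>Select the subsequence so that the truncations of its \<open>j\<close>-th member are at most
  \<open>1/(j+1)\<close> off a set of measure \<open>2\<^sup>-\<^sup>j\<close>, and apply the Borel-Cantelli lemma.\<close>

lemma finite_hilbert_AE_subsequence:
  assumes k: "\<And>n. integrable mu (k n)" and lim: "(\<lambda>n. \<integral>x. cmod (k n x) \<partial>mu) \<longlonglongrightarrow> 0"
  obtains r :: "nat \<Rightarrow> nat" where "strict_mono r" "AE t in mu. (\<lambda>n. finite_hilbert (k (r n)) t) \<longlonglongrightarrow> 0"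
proof -
  define good where "good j h E \<longleftrightarrow> E \<in> sets borel \<and> emeasure lborel E \<le> ennreal ((1/2) ^ j) \<and>
     (\<forall>t. t \<notin> E \<longrightarrow> (\<forall>y>0. cmod (truncated_hilbert h y t) \<le> inverse (real (Suc j))))" for j :: nat and h E
  have "\<exists>N. \<forall>n\<ge>N. \<exists>E. good j (k n) E" for j
  proof -
    have "\<exists>d>0. \<forall>h. integrable mu h \<longrightarrow> (\<integral>x. cmod (h x) \<partial>mu) \<le> d \<longrightarrow>
      (\<exists>E\<in>sets borel. emeasure lborel E \<le> ennreal ((1/2) ^ j) \<and>
        (\<forall>t. t \<notin> E \<longrightarrow> (\<forall>y>0. cmod (truncated_hilbert h y t) \<le> inverse (real (Suc j)) \<and>
          cmod (conj_poisson h y t) \<le> inverse (real (Suc j)))))"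
      by (rule truncations_small_off_small_set) auto
    then obtain d where d: "0 < d" and D: "\<forall>h. integrable mu h \<longrightarrow> (\<integral>x. cmod (h x) \<partial>mu) \<le> d \<longrightarrow>
      (\<exists>E\<in>sets borel. emeasure lborel E \<le> ennreal ((1/2) ^ j) \<and>
        (\<forall>t. t \<notin> E \<longrightarrow> (\<forall>y>0. cmod (truncated_hilbert h y t) \<le> inverse (real (Suc j)) \<and>
          cmod (conj_poisson h y t) \<le> inverse (real (Suc j)))))"
      by (elim exE conjE)
    have ex: "\<exists>E. good j h E" if "integrable mu h" "(\<integral>x. cmod (h x) \<partial>mu) \<le> d" for h
    proof -
      from D[rule_format, OF that] obtain E where "E \<in> sets borel" "emeasure lborel E \<le> ennreal ((1/2) ^ j)"
        "\<forall>t. t \<notin> E \<longrightarrow> (\<forall>y>0. cmod (truncated_hilbert h y t) \<le> inverse (real (Suc j)) \<and>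
          cmod (conj_poisson h y t) \<le> inverse (real (Suc j)))"
        by (elim bexE conjE)
      thus ?thesis unfolding good_def by (intro exI[of _ E]) simp
    qed
    have "eventually (\<lambda>n. (\<integral>x. cmod (k n x) \<partial>mu) < d) sequentially" by (rule order_tendstoD(2)[OF lim d])
    then obtain N where "\<And>n. N \<le> n \<Longrightarrow> (\<integral>x. cmod (k n x) \<partial>mu) < d" unfolding eventually_sequentially by auto
    thus ?thesis by (intro exI[of _ N] allI impI ex k less_imp_le)
  qed
  then obtain N where N: "\<And>j n. N j \<le> n \<Longrightarrow> \<exists>E. good j (k n) E" by metis
  \<comment> \<open>the sums dominate every threshold and the summand \<open>j\<close> makes the selection strictly increasing\<close>
  define r where "r j = (\<Sum>i\<le>j. N i) + j" for j
  have mono: "strict_mono r" by (rule strict_mono_Suc_iff[THEN iffD2]) (simp add: r_def)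
  have "N j \<le> r j" for j
    using sum_nonneg_leq_bound[of "{..j}" N "\<Sum>i\<le>j. N i" j] by (simp add: r_def)
  hence "\<forall>j. \<exists>E. good j (k (r j)) E" using N by blast
  then obtain E where "\<And>j. good j (k (r j)) (E j)" by metis
  hence E: "\<And>j. E j \<in> sets borel" "\<And>j. emeasure lborel (E j) \<le> ennreal ((1/2) ^ j)"
     "\<And>j t y. t \<notin> E j \<Longrightarrow> 0 < y \<Longrightarrow> cmod (truncated_hilbert (k (r j)) y t) \<le> inverse (real (Suc j))"
    unfolding good_def by auto
  have fin: "emeasure lborel (E j) < \<infinity>" for j using E(2)[of j] by (rule le_less_trans) simp
  have meas: "measure lborel (E j) \<le> (1/2) ^ j" for j
    using E(2)[of j] unfolding measure_def by (intro enn2real_leI) auto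
  have "AE t in lborel. eventually (\<lambda>j. t \<in> space lborel - E j) sequentially"
  proof (rule borel_cantelli_AE1)
    show "summable (\<lambda>j. measure lborel (E j))"
      by (rule summable_comparison_test'[where g = "\<lambda>j. (1/2::real) ^ j" and N = 0]) (use meas in auto)
  qed (use E(1) fin in auto)
  hence "AE t in mu. eventually (\<lambda>j. t \<in> space lborel - E j) sequentially"
    unfolding AE_mu_iff by eventually_elim simp
  moreover have "AE t in mu. \<forall>j. pv_limit (k (r j)) t (finite_hilbert (k (r j)) t)"
    unfolding AE_all_countable by (intro allI AE_pv_limit_finite_hilbert k)
  ultimately have "AE t in mu. (\<lambda>n. finite_hilbert (k (r n)) t) \<longlonglongrightarrow> 0"
  proof eventually_elim
    case (elim t)
    have "eventually (\<lambda>j. cmod (finite_hilbert (k (r j)) t) \<le> inverse (real (Suc j))) sequentially"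
      using elim(1)
    proof eventually_elim
      case (elim j)
      have "((\<lambda>e. cmod (truncated_hilbert (k (r j)) e t)) \<longlongrightarrow> cmod (finite_hilbert (k (r j)) t)) (at_right 0)"
        using \<open>\<forall>j. pv_limit (k (r j)) t (finite_hilbert (k (r j)) t)\<close>
        by (intro tendsto_norm) (auto simp: pv_limit_def)
      moreover have "eventually (\<lambda>e. cmod (truncated_hilbert (k (r j)) e t) \<le> inverse (real (Suc j))) (at_right 0)"
        unfolding eventually_at_right_field using E(3)[of t j] elim by (intro exI[of _ 1]) auto
      ultimately show ?case by (rule tendsto_upperbound) simp
    qed
    thus ?case by (rule Lim_null_comparison) (rule LIMSEQ_inverse_real_of_nat)
  qed
  thus ?thesis using that mono by blast
qed

section \<open>Exponential integrability for bounded functions\<close>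

lemma integrable_mu_bounded:
  fixes h :: "real \<Rightarrow> complex"
  assumes "h \<in> borel_measurable mu" "\<And>x. cmod (h x) \<le> B"
  shows "integrable mu h"
  by (rule mu.integrable_const_bound[where B = B]) (use assms in auto)

lemma cauchy_transform_Im_bounded:
  fixes a :: "real \<Rightarrow> real"
  assumes a [measurable]: "a \<in> borel_measurable mu" and a1: "\<And>x. \<bar>a x\<bar> \<le> 1" and z: "0 < Im z"
  shows "\<bar>Im (cauchy_transform (\<lambda>x. of_real (a x)) z)\<bar> \<le> 1"
proof -
  have ai: "integrable mu a" by (rule mu.integrable_const_bound[where B = 1]) (use a1 in auto)
  define e t where "e = Im z" and "t = Re z"
  have e: "0 < e" using z by (simp add: e_def)
  let ?P = "\<lambda>x. a x * (e / ((x - t)\<^sup>2 + e\<^sup>2))"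
  have F: "Im (cauchy_transform (\<lambda>x. of_real (a x)) z) = (\<integral>x. ?P x \<partial>mu) / pi"
  proof -
    have "z = Complex t e" by (simp add: t_def e_def)
    thus ?thesis using cauchy_transform_split(1,2)[OF ai e, of t] by (simp flip: of_real_divide)
  qed
  have b: "\<bar>?P x\<bar> \<le> pi * poisson_kernel e (t - x)" for x
  proof -
    have "0 \<le> e / ((x - t)\<^sup>2 + e\<^sup>2)" using e by simp
    hence "\<bar>?P x\<bar> \<le> 1 * (e / ((x - t)\<^sup>2 + e\<^sup>2))"
      unfolding abs_mult using a1[of x] by (intro mult_mono) auto
    thus ?thesis by (simp add: poisson_kernel_def power2_commute[of t])
  qed
  have pk: "integrable lborel (\<lambda>x. indicator {-1<..<1} x *\<^sub>R (pi * poisson_kernel e (t - x)))"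
    by (intro integrable_mult_indicator integrable_mult_right poisson_kernel_integrable e) auto
  have pm: "integrable mu (\<lambda>x. pi * poisson_kernel e (t - x))"
    unfolding mu_def by (subst integrable_restrict_space) (use pk in auto)
  have "\<bar>\<integral>x. ?P x \<partial>mu\<bar> \<le> (\<integral>x. pi * poisson_kernel e (t - x) \<partial>mu)"
    using b by (intro order_trans[OF integral_abs_bound integral_mono] pm integrable_abs cauchy_transform_split(3)[OF ai e])
  also have "\<dots> = (\<integral>x. indicator {-1<..<1} x *\<^sub>R (pi * poisson_kernel e (t - x)) \<partial>lborel)"
    unfolding mu_def by (rule integral_restrict_space) simp
  also have "\<dots> \<le> (\<integral>x. pi * poisson_kernel e (t - x) \<partial>lborel)"
    using poisson_kernel_nonneg[OF e]
    by (intro integral_mono pk integrable_mult_right poisson_kernel_integrable e) (auto simp: indicator_def)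
  also have "\<dots> = pi" by (simp add: poisson_kernel_integral[OF e])
  finally show ?thesis unfolding F by simp
qed

text \<open>The imaginary part \<open>V\<close> of the Cauchy transform satisfies \<open>|V| \<le> 1\<close>, hence the real part of
  \<open>exp (\<plusminus> F)\<close> is at least \<open>cos 1\<close> times its modulus. The Poisson representation of \<open>exp (\<plusminus> F)\<close> at
  the point \<open>\<i>\<close> bounds the integral of this real part.\<close>

lemma cauchy_transform_exp_bound:
  fixes a :: "real \<Rightarrow> real"
  assumes a [measurable]: "a \<in> borel_measurable mu" and a1: "\<And>x. \<bar>a x\<bar> \<le> 1" and h: "0 < h"
    and sg: "\<bar>sg\<bar> = (1::real)"
  shows "(\<integral>\<^sup>+t. ennreal (exp (sg * Re (cauchy_transform (\<lambda>x. of_real (a x)) (Complex t h)))) \<partial>mu)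
      \<le> ennreal (5 * pi * exp 1 / cos 1)"
proof -
  define F where "F = cauchy_transform (\<lambda>x. complex_of_real (a x))"
  define G where "G z = exp (of_real sg * F (z + \<i> * h))" for z
  have ai: "integrable mu a" by (rule mu.integrable_const_bound[where B = 1]) (use a1 in auto)
  hence aic: "integrable mu (\<lambda>x. complex_of_real (a x))" by simp
  have na: "(\<integral>x. cmod (complex_of_real (a x)) \<partial>mu) \<le> 2"
  proof -
    have "(\<integral>x. cmod (complex_of_real (a x)) \<partial>mu) \<le> (\<integral>x. 1 \<partial>mu)"
      using a1 by (intro integral_mono) (use ai in auto)
    also have "\<dots> = 2" by (simp add: measure_def emeasure_mu)
    finally show ?thesis .
  qed
  have Fb: "cmod (F z) \<le> 1 / Im z" if "0 < Im z" for z
  proof -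
    have "cmod (F z) \<le> (\<integral>x. cmod (complex_of_real (a x)) \<partial>mu) / (pi * Im z)"
      unfolding F_def by (rule cauchy_transform_bound[OF aic that])
    also have "\<dots> \<le> 2 / (2 * Im z)"
      using na that pi_ge_two by (intro frac_le mult_right_mono) auto
    finally show ?thesis by simp
  qed
  have Gn: "cmod (G z) \<le> exp (cmod (F (z + \<i> * h)))" for z
    using norm_exp[of "of_real sg * F (z + \<i> * h)"] sg by (simp add: G_def norm_mult)
  have Ghol: "G holomorphic_on {z. - (h/2) < Im z}"
  proof -
    have "(\<lambda>z. F (z + \<i> * h)) holomorphic_on {z. - (h/2) < Im z}"
      unfolding F_def by (rule cauchy_transform_shift_holomorphic[OF aic h])
    thus ?thesis unfolding G_def by (intro holomorphic_intros)
  qed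
  have Gbd: "cmod (G z) \<le> exp (1 / (h/2))" if "- (h/2) < Im z" for z
  proof -
    have "cmod (F (z + \<i> * h)) \<le> 1 / Im (z + \<i> * h)" by (rule Fb) (use that h in auto)
    also have "\<dots> \<le> 1 / (h/2)" by (rule divide_left_mono) (use that h in auto)
    finally show ?thesis using Gn[of z] by (meson exp_le_cancel_iff order_trans)
  qed
  have h2: "0 < h/2" using h by simp
  note repr = poisson_representation[OF Ghol h2 Gbd]
  let ?p = "\<lambda>s. of_real (poisson_kernel 1 (0 - s)) * G (of_real s)"
  have int: "integrable lborel ?p" using repr(1)[of 1 0] by simp
  have val: "(\<integral>s. ?p s \<partial>lborel) = G \<i>" using repr(2)[of 1 0] by (simp add: imaginary_unit.code)
  have c0: "0 < cos (1::real)" using pi_gt3 by (intro cos_gt_zero) auto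
  have ReG: "cos 1 * exp (sg * Re (F (Complex s h))) \<le> Re (G (of_real s))" for s
  proof -
    have z: "of_real s + \<i> * h = Complex s h" by (simp add: complex_eq_iff)
    have "\<bar>Im (F (Complex s h))\<bar> \<le> 1"
      unfolding F_def by (rule cauchy_transform_Im_bounded[OF a a1]) (use h in simp)
    hence v: "\<bar>sg * Im (F (Complex s h))\<bar> \<le> 1" using sg by (simp add: abs_mult)
    hence "cos 1 \<le> cos \<bar>sg * Im (F (Complex s h))\<bar>"
      using pi_gt3 by (intro cos_monotone_0_pi_le) auto
    hence "cos 1 * exp (sg * Re (F (Complex s h))) \<le> cos (sg * Im (F (Complex s h))) * exp (sg * Re (F (Complex s h)))"
      by (intro mult_right_mono) auto
    thus ?thesis unfolding G_def z by (simp add: Re_exp mult.commute)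
  qed
  have ReG0: "0 \<le> Re (G (of_real s))" for s
    using ReG[of s] c0 by (meson exp_ge_zero less_imp_le mult_nonneg_nonneg order_trans)
  have "(\<integral>\<^sup>+t. ennreal (exp (sg * Re (F (Complex t h)))) \<partial>mu)
     = (\<integral>\<^sup>+t. ennreal (exp (sg * Re (F (Complex t h)))) * indicator {-1<..<1} t \<partial>lborel)"
    by (rule nn_integral_mu)
  also have "\<dots> \<le> (\<integral>\<^sup>+t. ennreal (5 * pi / cos 1 * Re (?p t)) \<partial>lborel)"
  proof (rule nn_integral_mono)
    fix t :: real
    show "ennreal (exp (sg * Re (F (Complex t h)))) * indicator {-1<..<1} t \<le> ennreal (5 * pi / cos 1 * Re (?p t))"
    proof (cases "t \<in> {-1<..<1}")
      case True
      have "exp (sg * Re (F (Complex t h))) \<le> 1 * (Re (G (of_real t)) / cos 1)"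
        using ReG[of t] c0 by (simp add: field_simps)
      also have "\<dots> \<le> (5 * pi * poisson_kernel 1 t) * (Re (G (of_real t)) / cos 1)"
        using poisson_kernel_one_lower[of t] True ReG0[of t] c0 by (intro mult_right_mono) auto
      finally show ?thesis using True by (simp add: ennreal_leI mult_ac)
    qed simp
  qed
  also have "\<dots> = ennreal (\<integral>t. 5 * pi / cos 1 * Re (?p t) \<partial>lborel)"
  proof (rule nn_integral_eq_integral)
    show "integrable lborel (\<lambda>t. 5 * pi / cos 1 * Re (?p t))"
      by (intro integrable_mult_right integrable_Re int)
    show "AE t in lborel. 0 \<le> 5 * pi / cos 1 * Re (?p t)"
    proof (rule AE_I2)
      fix t
      show "0 \<le> 5 * pi / cos 1 * Re (?p t)" using poisson_kernel_nonneg[of 1 t] ReG0[of t] c0 by simp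
    qed
  qed
  also have "(\<integral>t. 5 * pi / cos 1 * Re (?p t) \<partial>lborel) = 5 * pi / cos 1 * Re (G \<i>)"
    using integral_Re[OF int] by (simp only: integral_mult_right_zero val)
  also have "\<dots> \<le> 5 * pi / cos 1 * exp 1"
  proof (rule mult_left_mono)
    have "cmod (F (\<i> + \<i> * h)) \<le> 1 / (1 + h)" using Fb[of "\<i> + \<i> * h"] h by simp
    also have "\<dots> \<le> 1" using h by simp
    finally have "cmod (G \<i>) \<le> exp 1" using Gn[of \<i>] by (meson exp_le_cancel_iff order_trans)
    thus "Re (G \<i>) \<le> exp 1" using complex_Re_le_cmod[of "G \<i>"] by linarith
  qed (use c0 in auto)
  finally show ?thesis unfolding F_def by (simp add: ennreal_leI)
qed

text \<open>The constant comes from \<open>ln (x / p) \<le> x / p - 1\<close>.\<close>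

lemma powr_le_exp:
  fixes x p :: real
  assumes "0 < p" "0 \<le> x" shows "x powr p \<le> exp (p * ln p) * exp x"
proof (cases "x = 0")
  case False
  hence x: "0 < x" using assms by simp
  have "ln (x / p) \<le> x / p - 1" using x assms by (intro ln_le_minus_one) auto
  hence "p * (ln x - ln p) \<le> p * (x / p - 1)" using x assms by (intro mult_left_mono) (auto simp: ln_div)
  hence "p * ln x \<le> p * ln p + x" using assms by (simp add: algebra_simps)
  hence "exp (p * ln x) \<le> exp (p * ln p + x)" by simp
  thus ?thesis using x by (simp add: powr_def exp_add)
qed (use assms in simp)

lemma add_powr_le:
  fixes a b p :: real
  assumes "0 \<le> a" "0 \<le> b" "0 < p"
  shows "(a + b) powr p \<le> 2 powr p * (a powr p + b powr p)"
proof -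
  have "(a + b) powr p \<le> (2 * max a b) powr p" using assms by (intro powr_mono2) auto
  also have "\<dots> = 2 powr p * (max a b) powr p" using assms by (simp add: powr_mult)
  also have "(max a b) powr p \<le> a powr p + b powr p" by (auto simp: max_def)
  finally show ?thesis by (simp add: mult_left_mono)
qed

lemma fatou_powr:
  fixes u :: "nat \<Rightarrow> real \<Rightarrow> complex"
  assumes um [measurable]: "\<And>n. u n \<in> borel_measurable mu" and p: "0 < p"
    and bd: "\<And>n. (\<integral>\<^sup>+t. ennreal (cmod (u n t) powr p) \<partial>mu) \<le> M"
    and lim: "AE t in mu. (\<lambda>n. u n t) \<longlonglongrightarrow> v t"
  shows "(\<integral>\<^sup>+t. ennreal (cmod (v t) powr p) \<partial>mu) \<le> M"
proof -
  have "(\<integral>\<^sup>+t. ennreal (cmod (v t) powr p) \<partial>mu) = (\<integral>\<^sup>+t. liminf (\<lambda>n. ennreal (cmod (u n t) powr p)) \<partial>mu)"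
  proof (rule nn_integral_cong_AE)
    show "AE t in mu. ennreal (cmod (v t) powr p) = liminf (\<lambda>n. ennreal (cmod (u n t) powr p))"
      using lim
    proof eventually_elim
      case (elim t)
      hence "(\<lambda>n. ennreal (cmod (u n t) powr p)) \<longlonglongrightarrow> ennreal (cmod (v t) powr p)"
        using p by (intro tendsto_ennrealI tendsto_powr2 tendsto_norm tendsto_const) auto
      thus ?case by (rule lim_imp_Liminf[symmetric, rotated]) simp
    qed
  qed
  also have "\<dots> \<le> liminf (\<lambda>n. \<integral>\<^sup>+t. ennreal (cmod (u n t) powr p) \<partial>mu)"
    by (rule nn_integral_liminf) measurable
  also have "\<dots> \<le> limsup (\<lambda>n. \<integral>\<^sup>+t. ennreal (cmod (u n t) powr p) \<partial>mu)"
    by (rule Liminf_le_Limsup) simp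
  also have "\<dots> \<le> M"
    by (rule Limsup_bounded) (auto intro!: always_eventually bd)
  finally show ?thesis .
qed

lemma conj_poisson_powr_bound_real:
  fixes a :: "real \<Rightarrow> real"
  assumes a [measurable]: "a \<in> borel_measurable mu" and a1: "\<And>x. \<bar>a x\<bar> \<le> 1" and e: "0 < e" and p: "0 < p"
  shows "(\<integral>\<^sup>+t. ennreal (cmod (conj_poisson (\<lambda>x. of_real (a x)) e t) powr p) \<partial>mu)
     \<le> ennreal (exp (p * ln p) * (2 * (5 * pi * exp 1 / cos 1)))"
proof -
  let ?F = "\<lambda>t. cauchy_transform (\<lambda>x. complex_of_real (a x)) (Complex t e)"
  let ?C = "exp (p * ln p)"
  have ai: "integrable mu a" by (rule mu.integrable_const_bound[where B = 1]) (use a1 in auto)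
  have CP: "conj_poisson (\<lambda>x. of_real (a x)) e t = of_real (Re (?F t))" for t
    unfolding cauchy_transform_split(1,2)[OF ai e] by (simp flip: of_real_divide of_real_mult)
  have ReF: "Re (?F t) = Re (conj_poisson (\<lambda>x. of_real (a x)) e t)" for t by (simp add: CP)
  have [measurable]: "(\<lambda>t. Re (?F t)) \<in> borel_measurable mu"
    unfolding ReF by measurable
  have "(\<integral>\<^sup>+t. ennreal (cmod (conj_poisson (\<lambda>x. of_real (a x)) e t) powr p) \<partial>mu)
    \<le> (\<integral>\<^sup>+t. ennreal ?C * (ennreal (exp (1 * Re (?F t))) + ennreal (exp (- 1 * Re (?F t)))) \<partial>mu)"
  proof (rule nn_integral_mono)
    fix t
    have "\<bar>Re (?F t)\<bar> powr p \<le> ?C * exp \<bar>Re (?F t)\<bar>" by (rule powr_le_exp) (use p in auto)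
    also have "\<dots> \<le> ?C * (exp (1 * Re (?F t)) + exp (- 1 * Re (?F t)))"
      by (intro mult_left_mono) (auto simp: abs_if)
    finally show "ennreal (cmod (conj_poisson (\<lambda>x. of_real (a x)) e t) powr p)
       \<le> ennreal ?C * (ennreal (exp (1 * Re (?F t))) + ennreal (exp (- 1 * Re (?F t))))"
      by (simp add: CP ennreal_leI flip: ennreal_plus ennreal_mult)
  qed
  also have "\<dots> = ennreal ?C * ((\<integral>\<^sup>+t. ennreal (exp (1 * Re (?F t))) \<partial>mu) + (\<integral>\<^sup>+t. ennreal (exp (- 1 * Re (?F t))) \<partial>mu))"
    by (subst nn_integral_cmult, measurable, subst nn_integral_add) auto
  also have "\<dots> \<le> ennreal ?C * (ennreal (5 * pi * exp 1 / cos 1) + ennreal (5 * pi * exp 1 / cos 1))"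
    by (intro mult_left_mono add_mono cauchy_transform_exp_bound a a1 e) auto
  also have "\<dots> = ennreal (?C * (2 * (5 * pi * exp 1 / cos 1)))"
  proof -
    have "0 < cos (1::real)" using pi_gt3 by (intro cos_gt_zero) auto
    thus ?thesis by (simp add: field_simps flip: ennreal_plus ennreal_mult)
  qed
  finally show ?thesis .
qed

text \<open>Powers are dominated by the exponential, and Fatou's lemma passes from the conjugate Poisson
  integrals to their limit.\<close>

lemma finite_hilbert_bounded_powr:
  fixes p B :: real
  assumes p: "0 < p" and B: "0 < B"
  shows "\<exists>K\<ge>0. \<forall>h\<in>borel_measurable mu. (\<forall>x. cmod (h x) \<le> B) \<longrightarrow>
    (\<forall>e>0. (\<integral>\<^sup>+t. ennreal (cmod (conj_poisson h e t) powr p) \<partial>mu) \<le> ennreal K) \<and>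
    (\<integral>\<^sup>+t. ennreal (cmod (finite_hilbert h t) powr p) \<partial>mu) \<le> ennreal K"
proof -
  define L where "L = exp (p * ln p) * (2 * (5 * pi * exp 1 / cos 1))"
  have c0: "0 < cos (1::real)" using pi_gt3 by (intro cos_gt_zero) auto
  have L0: "0 \<le> L" using c0 by (simp add: L_def)
  define K where "K = B powr p * (2 powr p * (2 * L))"
  have K0: "0 \<le> K" using L0 by (simp add: K_def)
  have cp: "(\<integral>\<^sup>+t. ennreal (cmod (conj_poisson h e t) powr p) \<partial>mu) \<le> ennreal K"
    if [measurable]: "h \<in> borel_measurable mu" and hB: "\<forall>x. cmod (h x) \<le> B" and e: "0 < e" for h e
  proof -
    define a b where "a x = Re (h x) / B" and "b x = Im (h x) / B" for x
    have [measurable]: "a \<in> borel_measurable mu" "b \<in> borel_measurable mu" unfolding a_def b_def by measurable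
    have ab1: "\<bar>a x\<bar> \<le> 1" "\<bar>b x\<bar> \<le> 1" for x
      using hB abs_Re_le_cmod[of "h x"] abs_Im_le_cmod[of "h x"] B
      by (auto simp: a_def b_def abs_div field_simps intro: order_trans)
    let ?A = "conj_poisson (\<lambda>x. of_real (a x)) e" and ?B = "conj_poisson (\<lambda>x. of_real (b x)) e"
    have i: "integrable mu (\<lambda>x. complex_of_real (a x))" "integrable mu (\<lambda>x. complex_of_real (b x))"
      by (rule integrable_mu_bounded[where B = 1]; use ab1 in auto)+
    have hab: "h = (\<lambda>x. of_real B * of_real (a x) + (\<i> * of_real B) * of_real (b x))"
      using B by (auto simp: a_def b_def complex_eq_iff)
    have le: "cmod (conj_poisson h e t) powr p \<le> B powr p * (2 powr p * (cmod (?A t) powr p + cmod (?B t) powr p))" for t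
    proof -
      have "conj_poisson h e t = of_real B * (?A t + \<i> * ?B t)"
        by (subst hab, subst truncations_linear(2)[OF i e]) (simp add: algebra_simps)
      hence "cmod (conj_poisson h e t) \<le> B * (cmod (?A t) + cmod (?B t))"
        using norm_triangle_ineq[of "?A t" "\<i> * ?B t"] B by (simp add: norm_mult)
      hence "cmod (conj_poisson h e t) powr p \<le> (B * (cmod (?A t) + cmod (?B t))) powr p"
        using p by (intro powr_mono2) auto
      also have "\<dots> = B powr p * (cmod (?A t) + cmod (?B t)) powr p" using B by (simp add: powr_mult)
      also have "\<dots> \<le> B powr p * (2 powr p * (cmod (?A t) powr p + cmod (?B t) powr p))"
        using p by (intro mult_left_mono add_powr_le) auto
      finally show ?thesis .
    qed
    have "(\<integral>\<^sup>+t. ennreal (cmod (conj_poisson h e t) powr p) \<partial>mu)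
       \<le> (\<integral>\<^sup>+t. ennreal (B powr p * 2 powr p) * (ennreal (cmod (?A t) powr p) + ennreal (cmod (?B t) powr p)) \<partial>mu)"
      using le by (intro nn_integral_mono) (simp add: ennreal_leI mult.assoc flip: ennreal_plus ennreal_mult)
    also have "\<dots> = ennreal (B powr p * 2 powr p) * ((\<integral>\<^sup>+t. ennreal (cmod (?A t) powr p) \<partial>mu) + (\<integral>\<^sup>+t. ennreal (cmod (?B t) powr p) \<partial>mu))"
      by (subst nn_integral_cmult, measurable, subst nn_integral_add) auto
    also have "\<dots> \<le> ennreal (B powr p * 2 powr p) * (ennreal L + ennreal L)"
      unfolding L_def by (intro mult_left_mono add_mono conj_poisson_powr_bound_real e p ab1) auto
    also have "\<dots> = ennreal K" using L0 by (simp add: K_def mult_ac flip: ennreal_plus ennreal_mult)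
    finally show ?thesis .
  qed
  have fh: "(\<integral>\<^sup>+t. ennreal (cmod (finite_hilbert h t) powr p) \<partial>mu) \<le> ennreal K"
    if hm [measurable]: "h \<in> borel_measurable mu" and hB: "\<forall>x. cmod (h x) \<le> B" for h
  proof -
    let ?q = "\<lambda>n. inverse (real (Suc n))"
    have hi: "integrable mu h" by (rule integrable_mu_bounded[OF hm]) (use hB in auto)
    show ?thesis
    proof (rule fatou_powr[OF truncations_measurable(2)[THEN borel_measurable_mu] p cp])
      show "AE t in mu. (\<lambda>n. conj_poisson h (?q n) t) \<longlonglongrightarrow> finite_hilbert h t"
        by (rule AE_conj_poisson_tendsto[OF hi])
    qed (use hm hB in \<open>auto simp del: of_nat_Suc\<close>)
  qed
  show ?thesis using K0 cp fh by blast
qed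

lemma finite_hilbert_bounded_powrE:
  fixes f :: "real \<Rightarrow> complex" and p :: real
  assumes "0 < p" "f \<in> borel_measurable mu" "\<And>x. cmod (f x) \<le> B"
  obtains K where "0 \<le> K" "\<And>e. 0 < e \<Longrightarrow> (\<integral>\<^sup>+t. ennreal (cmod (conj_poisson f e t) powr p) \<partial>mu) \<le> ennreal K"
    "(\<integral>\<^sup>+t. ennreal (cmod (finite_hilbert f t) powr p) \<partial>mu) \<le> ennreal K"
proof -
  have "0 < \<bar>B\<bar> + 1" by linarith
  from finite_hilbert_bounded_powr[OF assms(1) this] obtain K where K: "0 \<le> K"
    "\<forall>h\<in>borel_measurable mu. (\<forall>x. cmod (h x) \<le> \<bar>B\<bar> + 1) \<longrightarrow>
      (\<forall>e>0. (\<integral>\<^sup>+t. ennreal (cmod (conj_poisson h e t) powr p) \<partial>mu) \<le> ennreal K) \<and>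
      (\<integral>\<^sup>+t. ennreal (cmod (finite_hilbert h t) powr p) \<partial>mu) \<le> ennreal K" by blast
  have "\<forall>x. cmod (f x) \<le> \<bar>B\<bar> + 1"
  proof
    fix x show "cmod (f x) \<le> \<bar>B\<bar> + 1" using assms(3)[of x] by linarith
  qed
  with K(2) assms(2) have "(\<forall>e>0. (\<integral>\<^sup>+t. ennreal (cmod (conj_poisson f e t) powr p) \<partial>mu) \<le> ennreal K) \<and>
      (\<integral>\<^sup>+t. ennreal (cmod (finite_hilbert f t) powr p) \<partial>mu) \<le> ennreal K" by blast
  thus ?thesis using that K(1) by blast
qed

section \<open>Weak limits in Lebesgue spaces\<close>

lemma young_powr:
  fixes a b p :: real
  assumes "0 \<le> a" "0 \<le> b" "1 < p"
  shows "a * b \<le> a powr p + b powr (p / (p - 1))"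
proof (cases "a = 0 \<or> b = 0")
  case False
  hence ab: "0 < a" "0 < b" using assms by auto
  show ?thesis
  proof (cases "b \<le> a powr (p - 1)")
    case True
    hence "a * b \<le> a powr 1 * a powr (p - 1)" using ab by (intro mult_mono) auto
    also have "\<dots> = a powr p" by (subst powr_add[symmetric]) simp
    finally show ?thesis by (simp add: add_increasing2)
  next
    case False
    hence "a powr (p - 1) \<le> b" by simp
    hence "(a powr (p - 1)) powr (1 / (p - 1)) \<le> b powr (1 / (p - 1))"
      using assms by (intro powr_mono2) auto
    hence "a \<le> b powr (1 / (p - 1))" using ab assms by (simp add: powr_powr)
    hence "a * b \<le> b powr (1 / (p - 1)) * b powr 1" using ab by (intro mult_mono) auto
    also have "\<dots> = b powr (1 / (p - 1) + 1)" by (rule powr_add[symmetric])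
    also have "1 / (p - 1) + 1 = p / (p - 1)" using assms by (simp add: field_simps)
    finally show ?thesis by (simp add: add_increasing)
  qed
qed auto

text \<open>Where \<open>v\<close> is small relative to \<open>g\<close>, the product is dominated by a fixed integrable function;
  elsewhere it is a small multiple of \<open>v powr p\<close> once \<open>K\<close> is large. Dominated convergence handles
  the first part and boundedness in \<open>L\<^sup>p\<close> the second.\<close>

lemma product_split_bound:
  fixes v g K p :: real
  assumes "0 \<le> v" "0 \<le> g" "0 < K" "1 < p"
  shows "v * g \<le> min (v * g) (K * g powr (p / (p - 1))) + K powr (1 - p) * v powr p"
proof (cases "v \<le> K * g powr (1 / (p - 1))")
  case True
  have "v * g \<le> (K * g powr (1 / (p - 1))) * g powr 1" using True assms by (intro mult_mono) auto
  also have "\<dots> = K * g powr (1 / (p - 1) + 1)" by (simp add: powr_add)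
  also have "1 / (p - 1) + 1 = p / (p - 1)" using assms by (simp add: field_simps)
  finally show ?thesis by simp
next
  case False
  hence "K * g powr (1 / (p - 1)) \<le> v" by simp
  hence "g powr (1 / (p - 1)) \<le> v / K" using assms by (simp add: field_simps)
  hence "(g powr (1 / (p - 1))) powr (p - 1) \<le> (v / K) powr (p - 1)" using assms by (intro powr_mono2) auto
  hence "g \<le> (v / K) powr (p - 1)" using assms by (cases "g = 0") (auto simp: powr_powr)
  hence "v * g \<le> v powr 1 * (v / K) powr (p - 1)" using assms by (intro mult_mono) auto
  also have "\<dots> = K powr (1 - p) * v powr p"
  proof -
    have "v powr 1 * v powr (p - 1) = v powr p" by (subst powr_add[symmetric]) simp
    moreover have "K powr (1 - p) = 1 / K powr (p - 1)" using powr_minus_divide[of K "p - 1"] by simp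
    ultimately show ?thesis using assms by (simp add: powr_divide field_simps)
  qed
  finally show ?thesis using assms by (simp add: add_increasing)
qed

lemma integrable_powr_bounded:
  fixes u :: "real \<Rightarrow> complex"
  assumes [measurable]: "u \<in> borel_measurable mu" and "(\<integral>\<^sup>+t. ennreal (cmod (u t) powr p) \<partial>mu) \<le> ennreal M"
  shows "integrable mu (\<lambda>t. cmod (u t) powr p)"
  by (rule integrableI_nonneg) (use assms in \<open>auto intro: le_less_trans\<close>)

lemma integral_powr_bounded:
  fixes u :: "real \<Rightarrow> complex"
  assumes "u \<in> borel_measurable mu" and "(\<integral>\<^sup>+t. ennreal (cmod (u t) powr p) \<partial>mu) \<le> ennreal M" and "0 \<le> M"
  shows "(\<integral>t. cmod (u t) powr p \<partial>mu) \<le> M"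
  using assms nn_integral_eq_integral[OF integrable_powr_bounded[OF assms(1,2)]] by simp

lemma integrable_product:
  fixes u g :: "real \<Rightarrow> complex"
  assumes [measurable]: "u \<in> borel_measurable mu" "g \<in> borel_measurable mu"
    and u: "integrable mu (\<lambda>t. cmod (u t) powr p)" and g: "integrable mu (\<lambda>t. cmod (g t) powr (p / (p - 1)))"
    and p: "1 < p"
  shows "integrable mu (\<lambda>t. u t * g t)"
proof (rule Bochner_Integration.integrable_bound[OF Bochner_Integration.integrable_add[OF u g]])
  show "AE t in mu. norm (u t * g t) \<le> norm (cmod (u t) powr p + cmod (g t) powr (p / (p - 1)))"
    using young_powr[OF norm_ge_zero norm_ge_zero p] by (intro AE_I2) (simp add: norm_mult)
qed measurable

lemma weak_limit_of_bounded_sequence: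
  fixes u :: "nat \<Rightarrow> real \<Rightarrow> complex"
  assumes um [measurable]: "\<And>n. u n \<in> borel_measurable mu" and vm [measurable]: "v \<in> borel_measurable mu"
    and gm [measurable]: "g \<in> borel_measurable mu"
    and p: "1 < p" and g: "integrable mu (\<lambda>t. cmod (g t) powr (p / (p - 1)))"
    and bd: "\<And>n. (\<integral>\<^sup>+t. ennreal (cmod (u n t) powr p) \<partial>mu) \<le> ennreal M"
    and lim: "AE t in mu. (\<lambda>n. u n t) \<longlonglongrightarrow> v t"
  shows "(\<lambda>n. \<integral>t. u n t * g t \<partial>mu) \<longlonglongrightarrow> (\<integral>t. v t * g t \<partial>mu)"
proof -
  have p0: "0 < p" using p by simp
  have bd': "(\<integral>\<^sup>+t. ennreal (cmod (u n t) powr p) \<partial>mu) \<le> ennreal \<bar>M\<bar>" for n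
    using bd[of n] by (rule order_trans) (simp add: ennreal_leI)
  have vbd: "(\<integral>\<^sup>+t. ennreal (cmod (v t) powr p) \<partial>mu) \<le> ennreal \<bar>M\<bar>"
    by (rule fatou_powr[OF um p0 bd' lim])
  note ui = integrable_powr_bounded[OF um bd'] and vi = integrable_powr_bounded[OF vm vbd]
  define C where "C = 2 powr p * (\<bar>M\<bar> + \<bar>M\<bar>) + 1"
  have C: "0 < C" by (simp add: C_def add_nonneg_pos)
  have di: "integrable mu (\<lambda>t. cmod (u n t - v t) powr p)"
    and dC: "(\<integral>t. cmod (u n t - v t) powr p \<partial>mu) \<le> C" for n
  proof -
    have le: "cmod (u n t - v t) powr p \<le> 2 powr p * (cmod (u n t) powr p + cmod (v t) powr p)" for t
      using add_powr_le[of "cmod (u n t)" "cmod (v t)" p] p0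
      by (intro order_trans[OF powr_mono2[OF _ _ norm_triangle_ineq4]]) auto
    have i: "integrable mu (\<lambda>t. 2 powr p * (cmod (u n t) powr p + cmod (v t) powr p))"
      by (intro integrable_mult_right Bochner_Integration.integrable_add ui vi)
    show d: "integrable mu (\<lambda>t. cmod (u n t - v t) powr p)"
      by (rule Bochner_Integration.integrable_bound[OF i]) (use le in \<open>auto intro!: AE_I2\<close>)
    have "(\<integral>t. cmod (u n t - v t) powr p \<partial>mu) \<le> (\<integral>t. 2 powr p * (cmod (u n t) powr p + cmod (v t) powr p) \<partial>mu)"
      by (rule integral_mono[OF d i le])
    also have "\<dots> = 2 powr p * ((\<integral>t. cmod (u n t) powr p \<partial>mu) + (\<integral>t. cmod (v t) powr p \<partial>mu))"
      using ui[of n] vi by simp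
    also have "\<dots> \<le> 2 powr p * (\<bar>M\<bar> + \<bar>M\<bar>)"
      by (intro mult_left_mono add_mono integral_powr_bounded um vm bd' vbd) auto
    finally show "(\<integral>t. cmod (u n t - v t) powr p \<partial>mu) \<le> C" by (simp add: C_def)
  qed
  note ugi = integrable_product[OF um gm ui g p] and vgi = integrable_product[OF vm gm vi g p]
  have dgi: "integrable mu (\<lambda>t. cmod (u n t - v t) * cmod (g t))" for n
    using integrable_norm[OF integrable_product[OF _ gm di g p, of n]] by (simp add: norm_mult)
  show ?thesis
  proof (rule LIM_zero_cancel, rule tendstoI)
    fix c :: real assume c: "0 < c"
    \<comment> \<open>the choice that makes the second part of the split at most half of \<open>c\<close>\<close>
    define K where "K = (c / (2 * C)) powr (1 / (1 - p))"
    have K: "0 < K" using c C by (simp add: K_def)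
    have Kp: "K powr (1 - p) = c / (2 * C)" using c C p by (simp add: K_def powr_powr)
    let ?m = "\<lambda>n t. min (cmod (u n t - v t) * cmod (g t)) (K * cmod (g t) powr (p / (p - 1)))"
    have gq: "integrable mu (\<lambda>t. K * cmod (g t) powr (p / (p - 1)))" using g by simp
    have mb: "norm (?m n t) \<le> K * cmod (g t) powr (p / (p - 1))" for n t
      using K by (auto simp: min_def abs_mult)
    have mi: "integrable mu (?m n)" for n
      by (rule Bochner_Integration.integrable_bound[OF gq]) (use mb K in \<open>auto intro!: AE_I2\<close>)
    have "(\<lambda>n. \<integral>t. ?m n t \<partial>mu) \<longlonglongrightarrow> (\<integral>t. 0 \<partial>mu)"
    proof (rule integral_dominated_convergence[OF _ _ gq])
      show "AE t in mu. (\<lambda>n. ?m n t) \<longlonglongrightarrow> 0"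
        using lim
      proof eventually_elim
        case (elim t)
        have "(\<lambda>n. ?m n t) \<longlonglongrightarrow> min (cmod (v t - v t) * cmod (g t)) (K * cmod (g t) powr (p / (p - 1)))"
          by (intro tendsto_intros elim)
        thus ?case using K by simp
      qed
    qed (use mb in auto)
    hence "eventually (\<lambda>n. (\<integral>t. ?m n t \<partial>mu) < c / 2) sequentially"
      using c by (intro order_tendstoD(2)) auto
    thus "eventually (\<lambda>n. dist ((\<integral>t. u n t * g t \<partial>mu) - (\<integral>t. v t * g t \<partial>mu)) 0 < c) sequentially"
    proof eventually_elim
      case (elim n)
      have "cmod ((\<integral>t. u n t * g t \<partial>mu) - (\<integral>t. v t * g t \<partial>mu)) = cmod (\<integral>t. (u n t - v t) * g t \<partial>mu)"
        by (simp add: Bochner_Integration.integral_diff[OF ugi vgi, symmetric] left_diff_distrib)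
      also have "\<dots> \<le> (\<integral>t. cmod (u n t - v t) * cmod (g t) \<partial>mu)"
        using integral_norm_bound[of mu "\<lambda>t. (u n t - v t) * g t"] by (simp add: norm_mult)
      also have "\<dots> \<le> (\<integral>t. ?m n t + K powr (1 - p) * cmod (u n t - v t) powr p \<partial>mu)"
        by (intro integral_mono dgi Bochner_Integration.integrable_add mi integrable_mult_right di)
           (intro product_split_bound K p norm_ge_zero)
      also have "\<dots> = (\<integral>t. ?m n t \<partial>mu) + K powr (1 - p) * (\<integral>t. cmod (u n t - v t) powr p \<partial>mu)"
        using mi[of n] di[of n] by simp
      also have "\<dots> < c / 2 + c / (2 * C) * C"
        unfolding Kp using elim dC[of n] c C by (intro add_less_le_mono mult_left_mono) auto
      finally show ?case using C by simp
    qed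
  qed
qed

section \<open>Parseval's formula\<close>

interpretation mu_pair: pair_sigma_finite mu mu
  by unfold_locales

text \<open>The kernel is odd and, for fixed \<open>e\<close>, bounded, so Fubini's theorem applies.\<close>

lemma conj_poisson_antisymmetric:
  assumes hm [measurable]: "h \<in> borel_measurable mu" and hB: "\<And>x. cmod (h x) \<le> B"
    and gm [measurable]: "g \<in> borel_measurable mu" and gB: "\<And>x. cmod (g x) \<le> B" and e: "0 < e"
  shows "(\<integral>t. conj_poisson h e t * g t \<partial>mu) = - (\<integral>t. h t * conj_poisson g e t \<partial>mu)"
proof -
  have B: "0 \<le> B" using order_trans[OF norm_ge_zero hB] .
  let ?k = "\<lambda>x t. complex_of_real (conj_kernel e (x - t))"
  let ?f = "\<lambda>(t, x). h x * ?k x t * g t"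
  have odd: "?k x t = - ?k t x" for x t
  proof -
    have "conj_kernel e (- (t - x)) = - conj_kernel e (t - x)" by (simp only: conj_kernel_def power2_minus minus_divide_left)
    thus ?thesis by simp
  qed
  interpret P: finite_measure "mu \<Otimes>\<^sub>M mu" by (rule finite_measure_pair_measure) unfold_locales
  have km: "(\<lambda>p. ?k (snd p) (fst p)) \<in> borel_measurable (mu \<Otimes>\<^sub>M mu)"
  proof -
    have "(\<lambda>p. snd p - fst p) \<in> borel_measurable (mu \<Otimes>\<^sub>M mu)"
      by (intro borel_measurable_diff measurable_compose[OF measurable_snd borel_measurable_mu]
          measurable_compose[OF measurable_fst borel_measurable_mu]) auto
    from measurable_compose[OF this conj_kernel_measurable1] show ?thesis by measurable
  qed
  have fi: "integrable (mu \<Otimes>\<^sub>M mu) ?f"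
  proof (rule P.integrable_const_bound[where B = "B * (1 / e) * B"])
    show "?f \<in> borel_measurable (mu \<Otimes>\<^sub>M mu)"
      unfolding split_beta using km measurable_compose[OF measurable_snd hm] measurable_compose[OF measurable_fst gm]
      by measurable
    show "AE p in mu \<Otimes>\<^sub>M mu. norm (?f p) \<le> B * (1 / e) * B"
    proof (rule AE_I2)
      fix p :: "real \<times> real"
      show "norm (?f p) \<le> B * (1 / e) * B"
        unfolding split_beta norm_mult using hB gB conj_kernel_bound[OF e] B e
        by (intro mult_mono mult_nonneg_nonneg) auto
    qed
  qed
  have "(\<integral>t. conj_poisson h e t * g t \<partial>mu) = (\<integral>t. (\<integral>x. h x * ?k x t * g t \<partial>mu) \<partial>mu) / pi"
    by (simp add: conj_poisson_def)
  also have "(\<integral>t. (\<integral>x. h x * ?k x t * g t \<partial>mu) \<partial>mu) = (\<integral>x. (\<integral>t. h x * ?k x t * g t \<partial>mu) \<partial>mu)"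
    by (rule mu_pair.Fubini_integral[OF fi, symmetric])
  also have "\<dots> = (\<integral>x. - (h x * (\<integral>t. g t * ?k t x \<partial>mu)) \<partial>mu)"
  proof (rule Bochner_Integration.integral_cong)
    fix x
    have "(\<integral>t. h x * ?k x t * g t \<partial>mu) = (\<integral>t. h x * - (g t * ?k t x) \<partial>mu)"
      by (rule Bochner_Integration.integral_cong, simp, subst odd) simp
    thus "(\<integral>t. h x * ?k x t * g t \<partial>mu) = - (h x * (\<integral>t. g t * ?k t x \<partial>mu))" by simp
  qed simp
  also have "\<dots> / pi = - (\<integral>t. h t * conj_poisson g e t \<partial>mu)"
    by (simp add: conj_poisson_def)
  finally show ?thesis .
qed

text \<open>The conjugate Poisson integrals converge almost everywhere and are bounded in \<open>L\<^sup>2\<close>, which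
  suffices to pass to the limit in the antisymmetry relation.\<close>

lemma parseval_bounded:
  assumes hm [measurable]: "h \<in> borel_measurable mu" and hB: "\<And>x. cmod (h x) \<le> B"
    and gm [measurable]: "g \<in> borel_measurable mu" and gB: "\<And>x. cmod (g x) \<le> B"
  shows "(\<integral>t. finite_hilbert h t * g t \<partial>mu) = - (\<integral>t. h t * finite_hilbert g t \<partial>mu)"
proof -
  let ?q = "\<lambda>n. inverse (real (Suc n))"
  have conv: "(\<lambda>n. \<integral>t. conj_poisson f (?q n) t * k t \<partial>mu) \<longlonglongrightarrow> (\<integral>t. finite_hilbert f t * k t \<partial>mu)"
    if fm [measurable]: "f \<in> borel_measurable mu" and fB: "\<And>x. cmod (f x) \<le> B"
      and km [measurable]: "k \<in> borel_measurable mu" and kB: "\<And>x. cmod (k x) \<le> B" for f k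
  proof -
    have fi: "integrable mu f" by (rule integrable_mu_bounded[OF fm fB])
    obtain K where K: "\<And>e. 0 < e \<Longrightarrow> (\<integral>\<^sup>+t. ennreal (cmod (conj_poisson f e t) powr 2) \<partial>mu) \<le> ennreal K"
      by (rule finite_hilbert_bounded_powrE[OF _ fm fB, of 2]) auto
    show ?thesis
    proof (rule weak_limit_of_bounded_sequence[where p = 2 and M = K])
      show "integrable mu (\<lambda>t. cmod (k t) powr (2 / (2 - 1)))"
      proof (rule mu.integrable_const_bound[where B = "\<bar>B\<bar>\<^sup>2"])
        show "AE t in mu. norm (cmod (k t) powr (2 / (2 - 1))) \<le> \<bar>B\<bar>\<^sup>2"
          using kB by (intro AE_I2) (auto intro!: power_mono order_trans[OF kB])
      qed measurable
      show "AE t in mu. (\<lambda>n. conj_poisson f (?q n) t) \<longlonglongrightarrow> finite_hilbert f t"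
        by (rule AE_conj_poisson_tendsto[OF fi])
    qed (use K fi in \<open>auto simp del: of_nat_Suc intro: finite_hilbert_measurable\<close>)
  qed
  have "(\<lambda>n. \<integral>t. conj_poisson h (?q n) t * g t \<partial>mu) = (\<lambda>n. - (\<integral>t. conj_poisson g (?q n) t * h t \<partial>mu))"
    by (subst conj_poisson_antisymmetric[OF hm hB gm gB]) (auto simp: mult.commute)
  with conv[OF hm hB gm gB]
  have "(\<lambda>n. - (\<integral>t. conj_poisson g (?q n) t * h t \<partial>mu)) \<longlonglongrightarrow> (\<integral>t. finite_hilbert h t * g t \<partial>mu)" by simp
  moreover have "(\<lambda>n. - (\<integral>t. conj_poisson g (?q n) t * h t \<partial>mu)) \<longlonglongrightarrow> - (\<integral>t. finite_hilbert g t * h t \<partial>mu)"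
    by (intro tendsto_minus conv gm gB hm hB)
  ultimately show ?thesis using LIMSEQ_unique by (auto simp: mult.commute)
qed

lemma integrable_of_powr:
  fixes g :: "real \<Rightarrow> complex"
  assumes [measurable]: "g \<in> borel_measurable mu" and g: "integrable mu (\<lambda>t. cmod (g t) powr q)" and q: "1 \<le> q"
  shows "integrable mu g"
proof (rule Bochner_Integration.integrable_bound[where f = "\<lambda>t. 1 + cmod (g t) powr q"])
  have "cmod (g t) \<le> 1 + cmod (g t) powr q" for t
  proof (cases "cmod (g t) \<le> 1")
    case False
    hence "cmod (g t) powr 1 \<le> cmod (g t) powr q" using q by (intro powr_mono) auto
    thus ?thesis by simp
  qed (simp add: add_increasing2)
  thus "AE t in mu. norm (g t) \<le> norm (1 + cmod (g t) powr q)" by (intro AE_I2) simp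
qed (use g in auto)

text \<open>Multiplication by this unimodular factor (zero at the origin) makes a complex number positive.\<close>

definition phase :: "complex \<Rightarrow> complex" where
  "phase z = cnj z / of_real (cmod z)"

lemma phase_measurable [measurable]: "phase \<in> borel_measurable borel"
proof -
  have [measurable]: "cnj \<in> borel_measurable borel"
    by (intro borel_measurable_continuous_onI continuous_intros)
  show ?thesis unfolding phase_def by measurable
qed

lemma cmod_phase_le: "cmod (phase z) \<le> 1"
  by (simp add: phase_def norm_divide)

lemma mult_phase: "z * phase z = of_real (cmod z)"
proof -
  have "cnj z * z = of_real ((cmod z)\<^sup>2)" by (metis complex_norm_square mult.commute of_real_power)
  thus ?thesis by (cases "z = 0") (simp_all add: phase_def power2_eq_square mult.commute)
qed

definition level_cut :: "nat \<Rightarrow> (real \<Rightarrow> complex) \<Rightarrow> real \<Rightarrow> complex" where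
  "level_cut n g x = (if cmod (g x) \<le> real n then g x else 0)"

lemma level_cut_measurable [measurable]:
  assumes [measurable]: "g \<in> borel_measurable mu"
  shows "level_cut n g \<in> borel_measurable mu"
  unfolding level_cut_def by measurable

lemma level_cut_bound: "cmod (level_cut n g x) \<le> real n" and level_cut_le: "cmod (level_cut n g x) \<le> cmod (g x)"
  and diff_level_cut_le: "cmod (g x - level_cut n g x) \<le> cmod (g x)"
  by (auto simp: level_cut_def)

lemma level_cut_tendsto: "(\<lambda>n. level_cut n g x) \<longlonglongrightarrow> g x"
proof -
  have "eventually (\<lambda>n. cmod (g x) \<le> real n) sequentially"
    using eventually_ge_at_top[of "nat \<lceil>cmod (g x)\<rceil>"] by eventually_elim linarith
  hence "eventually (\<lambda>n. level_cut n g x = g x) sequentially" by eventually_elim (simp add: level_cut_def)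
  thus ?thesis by (rule tendsto_eventually)
qed

lemma level_cut_L1_tendsto:
  assumes g: "integrable mu g"
  shows "(\<lambda>n. \<integral>x. cmod (g x - level_cut n g x) \<partial>mu) \<longlonglongrightarrow> 0"
proof -
  note [measurable] = borel_measurable_integrable[OF g]
  have "(\<lambda>n. \<integral>x. cmod (g x - level_cut n g x) \<partial>mu) \<longlonglongrightarrow> (\<integral>x. 0 \<partial>mu)"
  proof (rule integral_dominated_convergence[where w = "\<lambda>x. cmod (g x)"])
    show "AE x in mu. (\<lambda>n. cmod (g x - level_cut n g x)) \<longlonglongrightarrow> 0"
    proof (rule AE_I2)
      fix x
      have "(\<lambda>n. cmod (g x - level_cut n g x)) \<longlonglongrightarrow> cmod (g x - g x)" by (intro tendsto_intros level_cut_tendsto)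
      thus "(\<lambda>n. cmod (g x - level_cut n g x)) \<longlonglongrightarrow> 0" by simp
    qed
  qed (use g diff_level_cut_le in auto)
  thus ?thesis by simp
qed

lemma finite_hilbert_AE_subsequence_limit:
  assumes k: "\<And>n. integrable mu (k n)" and g: "integrable mu g" and lim: "(\<lambda>n. \<integral>x. cmod (g x - k n x) \<partial>mu) \<longlonglongrightarrow> 0"
  obtains r :: "nat \<Rightarrow> nat" where "strict_mono r" "AE t in mu. (\<lambda>n. finite_hilbert (k (r n)) t) \<longlonglongrightarrow> finite_hilbert g t"
proof -
  have di: "integrable mu (\<lambda>x. 1 * g x + (-1) * k n x)" for n using g k by auto
  obtain r :: "nat \<Rightarrow> nat" where r: "strict_mono r" "AE t in mu. (\<lambda>n. finite_hilbert (\<lambda>x. 1 * g x + (-1) * k (r n) x) t) \<longlonglongrightarrow> 0"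
    by (rule finite_hilbert_AE_subsequence[of "\<lambda>n x. 1 * g x + (-1) * k n x"]) (use di lim in auto)
  have "AE t in mu. \<forall>n. finite_hilbert (\<lambda>x. 1 * g x + (-1) * k (r n) x) t = 1 * finite_hilbert g t + (-1) * finite_hilbert (k (r n)) t"
    unfolding AE_all_countable by (intro allI finite_hilbert_linear g k)
  with r(2) have "AE t in mu. (\<lambda>n. finite_hilbert (k (r n)) t) \<longlonglongrightarrow> finite_hilbert g t"
  proof eventually_elim
    case (elim t)
    have "(\<lambda>n. finite_hilbert g t - finite_hilbert (\<lambda>x. 1 * g x + (-1) * k (r n) x) t) \<longlonglongrightarrow> finite_hilbert g t - 0"
      using elim(1) by (intro tendsto_intros)
    thus ?case unfolding elim(2)[rule_format] by simp
  qed
  thus ?thesis using that r(1) by blast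
qed

text \<open>Testing with the phase of \<open>T g\<close> turns the estimate for bounded functions into an \<open>L\<^sup>1\<close> estimate for
  \<open>T\<close> on \<open>L\<^sup>q\<close>, \<open>q > 1\<close>. The free parameter \<open>s\<close> in Young's inequality makes the right-hand side small
  when \<open>g\<close> is small in \<open>L\<^sup>q\<close>, as the continuity argument for Parseval's formula requires.\<close>

lemma finite_hilbert_L1_bound:
  fixes p :: real
  assumes p: "1 < p"
  shows "\<exists>K\<ge>0. \<forall>g\<in>borel_measurable mu. integrable mu (\<lambda>t. cmod (g t) powr (p / (p - 1))) \<longrightarrow> (\<forall>s>0.
    (\<integral>\<^sup>+t. ennreal (cmod (finite_hilbert g t)) \<partial>mu)
      \<le> ennreal (s powr p * K + s powr (- (p / (p - 1))) * (\<integral>t. cmod (g t) powr (p / (p - 1)) \<partial>mu)))"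
proof -
  define q where "q = p / (p - 1)"
  have q: "1 < q" using p by (simp add: q_def field_simps)
  obtain K where K0: "0 \<le> K" and K: "\<And>h. h \<in> borel_measurable mu \<Longrightarrow> (\<And>x. cmod (h x) \<le> 1) \<Longrightarrow>
     (\<integral>\<^sup>+t. ennreal (cmod (finite_hilbert h t) powr p) \<partial>mu) \<le> ennreal K"
    using finite_hilbert_bounded_powr[of p 1] p by auto
  have bounded: "(\<integral>\<^sup>+t. ennreal (cmod (finite_hilbert g t)) \<partial>mu)
      \<le> ennreal (s powr p * K + s powr (- q) * (\<integral>t. cmod (g t) powr q \<partial>mu))"
    if gm [measurable]: "g \<in> borel_measurable mu" and gB: "\<And>x. cmod (g x) \<le> B" and s: "0 < s" for g B s
  proof -
    have gi: "integrable mu g" by (rule integrable_mu_bounded[OF gm gB])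
    have gq: "integrable mu (\<lambda>t. cmod (g t) powr q)"
      by (rule mu.integrable_const_bound[where B = "\<bar>B\<bar> powr q"])
         (use q in \<open>auto intro!: AE_I2 powr_mono2 order_trans[OF gB]\<close>)
    have Tg [measurable]: "finite_hilbert g \<in> borel_measurable mu" by (rule finite_hilbert_measurable[OF gi])
    define ph where "ph t = phase (finite_hilbert g t)" for t
    have pm [measurable]: "ph \<in> borel_measurable mu" unfolding ph_def by measurable
    have p1: "cmod (ph x) \<le> 1" for x unfolding ph_def by (rule cmod_phase_le)
    have pi: "integrable mu ph" by (rule integrable_mu_bounded[OF pm p1])
    have Tp [measurable]: "finite_hilbert ph \<in> borel_measurable mu" by (rule finite_hilbert_measurable[OF pi])
    have prod: "ph t * finite_hilbert g t = of_real (cmod (finite_hilbert g t))" for t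
      unfolding ph_def mult.commute[of "phase _"] by (rule mult_phase)
    obtain K2 where "(\<integral>\<^sup>+t. ennreal (cmod (finite_hilbert g t) powr 1) \<partial>mu) \<le> ennreal K2"
      by (rule finite_hilbert_bounded_powrE[OF _ gm gB, of 1]) auto
    from integrable_powr_bounded[OF Tg this]
    have nTi: "integrable mu (\<lambda>t. cmod (finite_hilbert g t))" by simp
    have Kph: "(\<integral>\<^sup>+t. ennreal (cmod (finite_hilbert ph t) powr p) \<partial>mu) \<le> ennreal K" by (rule K[OF pm p1])
    note Tpi = integrable_powr_bounded[OF Tp Kph]
    have B1: "cmod (g x) \<le> \<bar>B\<bar> + 1" "cmod (ph x) \<le> \<bar>B\<bar> + 1" for x
      using gB[of x] p1[of x] by linarith+
    have "(\<integral>t. cmod (finite_hilbert g t) \<partial>mu) = cmod (\<integral>t. ph t * finite_hilbert g t \<partial>mu)"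
      unfolding prod by simp
    also have "\<dots> = cmod (\<integral>t. finite_hilbert ph t * g t \<partial>mu)"
      using parseval_bounded[OF pm B1(2) gm B1(1)] by simp
    also have "\<dots> \<le> (\<integral>t. cmod (finite_hilbert ph t * g t) \<partial>mu)" by (rule integral_norm_bound)
    also have "\<dots> \<le> (\<integral>t. s powr p * cmod (finite_hilbert ph t) powr p + s powr (- q) * cmod (g t) powr q \<partial>mu)"
    proof (rule integral_mono)
      show "integrable mu (\<lambda>t. cmod (finite_hilbert ph t * g t))"
        by (intro integrable_norm integrable_product[OF Tp gm Tpi gq[unfolded q_def] p])
      show "integrable mu (\<lambda>t. s powr p * cmod (finite_hilbert ph t) powr p + s powr (- q) * cmod (g t) powr q)"
        using Tpi gq by auto
      fix t
      have "cmod (finite_hilbert ph t * g t) = (s * cmod (finite_hilbert ph t)) * (cmod (g t) / s)"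
        using s by (simp add: norm_mult)
      also have "\<dots> \<le> (s * cmod (finite_hilbert ph t)) powr p + (cmod (g t) / s) powr q"
        unfolding q_def using s p by (intro young_powr) auto
      also have "\<dots> = s powr p * cmod (finite_hilbert ph t) powr p + s powr (- q) * cmod (g t) powr q"
        using s by (simp add: powr_mult powr_divide powr_minus_divide)
      finally show "cmod (finite_hilbert ph t * g t) \<le> s powr p * cmod (finite_hilbert ph t) powr p + s powr (- q) * cmod (g t) powr q" .
    qed
    also have "\<dots> = s powr p * (\<integral>t. cmod (finite_hilbert ph t) powr p \<partial>mu) + s powr (- q) * (\<integral>t. cmod (g t) powr q \<partial>mu)"
      using Tpi gq by simp
    also have "\<dots> \<le> s powr p * K + s powr (- q) * (\<integral>t. cmod (g t) powr q \<partial>mu)"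
      using integral_powr_bounded[OF Tp Kph K0] by (intro add_right_mono mult_left_mono) auto
    finally show ?thesis using nn_integral_eq_integral[OF nTi] by (simp add: ennreal_leI)
  qed
  have "(\<integral>\<^sup>+t. ennreal (cmod (finite_hilbert g t)) \<partial>mu)
      \<le> ennreal (s powr p * K + s powr (- q) * (\<integral>t. cmod (g t) powr q \<partial>mu))"
    if gm [measurable]: "g \<in> borel_measurable mu" and gq: "integrable mu (\<lambda>t. cmod (g t) powr q)" and s: "0 < s" for g s
  proof -
    have gi: "integrable mu g" by (rule integrable_of_powr[OF gm gq]) (use q in simp)
    have ci: "integrable mu (level_cut n g)" for n by (rule integrable_mu_bounded[OF _ level_cut_bound]) measurable
    obtain r :: "nat \<Rightarrow> nat" where r: "strict_mono r"
      "AE t in mu. (\<lambda>n. finite_hilbert (level_cut (r n) g) t) \<longlonglongrightarrow> finite_hilbert g t"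
      by (rule finite_hilbert_AE_subsequence_limit[OF ci gi level_cut_L1_tendsto[OF gi]])
    have "(\<integral>\<^sup>+t. ennreal (cmod (finite_hilbert g t) powr 1) \<partial>mu)
      \<le> ennreal (s powr p * K + s powr (- q) * (\<integral>t. cmod (g t) powr q \<partial>mu))"
    proof (rule fatou_powr[OF _ _ _ r(2)])
      fix n
      show "finite_hilbert (level_cut (r n) g) \<in> borel_measurable mu" by (rule finite_hilbert_measurable[OF ci])
      have cq: "integrable mu (\<lambda>t. cmod (level_cut (r n) g t) powr q)"
        by (rule Bochner_Integration.integrable_bound[OF gq]) (use q level_cut_le in \<open>auto intro!: AE_I2 powr_mono2\<close>)
      have "(\<integral>t. cmod (level_cut (r n) g t) powr q \<partial>mu) \<le> (\<integral>t. cmod (g t) powr q \<partial>mu)"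
        by (intro integral_mono cq gq powr_mono2 level_cut_le) (use q in auto)
      hence "s powr p * K + s powr (- q) * (\<integral>t. cmod (level_cut (r n) g t) powr q \<partial>mu)
        \<le> s powr p * K + s powr (- q) * (\<integral>t. cmod (g t) powr q \<partial>mu)"
        by (intro add_left_mono mult_left_mono) auto
      thus "(\<integral>\<^sup>+t. ennreal (cmod (finite_hilbert (level_cut (r n) g) t) powr 1) \<partial>mu)
        \<le> ennreal (s powr p * K + s powr (- q) * (\<integral>t. cmod (g t) powr q \<partial>mu))"
        using bounded[of "level_cut (r n) g" "real (r n)" s, OF _ level_cut_bound s] by (simp add: order_trans[OF _ ennreal_leI])
    qed simp
    thus ?thesis by simp
  qed
  thus ?thesis using K0 unfolding q_def by blast
qed

theorem parseval:
  fixes p :: real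
  assumes p: "1 < p" and fm [measurable]: "f \<in> borel_measurable mu" and fB: "\<And>x. cmod (f x) \<le> B"
    and gm [measurable]: "g \<in> borel_measurable mu" and gq: "integrable mu (\<lambda>t. cmod (g t) powr (p / (p - 1)))"
  shows "integrable mu (finite_hilbert g)" and "integrable mu (\<lambda>t. finite_hilbert f t * g t)"
    and "(\<integral>t. finite_hilbert f t * g t \<partial>mu) = - (\<integral>t. f t * finite_hilbert g t \<partial>mu)"
proof -
  define q where "q = p / (p - 1)"
  have q: "1 < q" using p by (simp add: q_def field_simps)
  note gq' = gq[folded q_def]
  obtain K where K0: "0 \<le> K" and K: "\<And>g s. g \<in> borel_measurable mu \<Longrightarrow> integrable mu (\<lambda>t. cmod (g t) powr q) \<Longrightarrow> 0 < s \<Longrightarrow>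
    (\<integral>\<^sup>+t. ennreal (cmod (finite_hilbert g t)) \<partial>mu) \<le> ennreal (s powr p * K + s powr (- q) * (\<integral>t. cmod (g t) powr q \<partial>mu))"
    using finite_hilbert_L1_bound[OF p] unfolding q_def by blast
  have gi: "integrable mu g" by (rule integrable_of_powr[OF gm gq']) (use q in simp)
  have fi: "integrable mu f" by (rule integrable_mu_bounded[OF fm fB])
  have Tgm [measurable]: "finite_hilbert g \<in> borel_measurable mu" by (rule finite_hilbert_measurable[OF gi])
  have Tfm [measurable]: "finite_hilbert f \<in> borel_measurable mu" by (rule finite_hilbert_measurable[OF fi])
  have L1: "integrable mu (finite_hilbert g)"
    if gm [measurable]: "g \<in> borel_measurable mu" and gq: "integrable mu (\<lambda>t. cmod (g t) powr q)" for g
  proof (rule integrableI_bounded)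
    have gi: "integrable mu g" by (rule integrable_of_powr[OF gm gq]) (use q in simp)
    show "finite_hilbert g \<in> borel_measurable mu" by (rule finite_hilbert_measurable[OF gi])
    show "(\<integral>\<^sup>+t. ennreal (norm (finite_hilbert g t)) \<partial>mu) < \<infinity>"
      using K[OF gm gq, of 1] by (auto intro: le_less_trans)
  qed
  show Tgi: "integrable mu (finite_hilbert g)" by (rule L1[OF gm gq'])
  have fB': "\<forall>x. cmod (f x) \<le> \<bar>B\<bar> + 1"
  proof
    fix x show "cmod (f x) \<le> \<bar>B\<bar> + 1" using fB[of x] by linarith
  qed
  obtain Kf where Kf: "(\<integral>\<^sup>+t. ennreal (cmod (finite_hilbert f t) powr p) \<partial>mu) \<le> ennreal Kf"
    by (rule finite_hilbert_bounded_powrE[OF _ fm fB, of p]) (use p in auto)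
  show Tfg: "integrable mu (\<lambda>t. finite_hilbert f t * g t)"
    by (rule integrable_product[OF Tfm gm integrable_powr_bounded[OF Tfm Kf] gq p])
  have ci: "integrable mu (level_cut n g)" for n by (rule integrable_mu_bounded[OF _ level_cut_bound]) measurable
  have cq: "integrable mu (\<lambda>t. cmod (level_cut n g t) powr q)" for n
    by (rule Bochner_Integration.integrable_bound[OF gq']) (use q level_cut_le in \<open>auto intro!: AE_I2 powr_mono2\<close>)
  have lhs: "(\<lambda>n. \<integral>t. finite_hilbert f t * level_cut n g t \<partial>mu) \<longlonglongrightarrow> (\<integral>t. finite_hilbert f t * g t \<partial>mu)"
  proof (rule integral_dominated_convergence[OF _ _ integrable_norm[OF Tfg]])
    show "AE t in mu. (\<lambda>n. finite_hilbert f t * level_cut n g t) \<longlonglongrightarrow> finite_hilbert f t * g t"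
      by (intro AE_I2 tendsto_intros level_cut_tendsto)
    show "AE t in mu. norm (finite_hilbert f t * level_cut n g t) \<le> cmod (finite_hilbert f t * g t)" for n
      using level_cut_le by (intro AE_I2) (simp add: norm_mult mult_left_mono)
  qed measurable
  have rhs: "(\<lambda>n. \<integral>t. f t * finite_hilbert (level_cut n g) t \<partial>mu) \<longlonglongrightarrow> (\<integral>t. f t * finite_hilbert g t \<partial>mu)"
  proof (rule LIM_zero_cancel, rule tendstoI)
    fix c :: real assume c: "0 < c"
    define b where "b = \<bar>B\<bar> + 1"
    have b: "0 < b" by (simp add: b_def add_nonneg_pos)
    \<comment> \<open>the choice that makes \<open>b * (s powr p * K)\<close> less than half of \<open>c\<close>\<close>
    define s where "s = (c / (2 * b * (K + 1))) powr (1 / p)"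
    have s: "0 < s" using c b K0 by (simp add: s_def)
    have sp: "b * (s powr p * K) < c / 2"
    proof -
      have sp': "s powr p = c / (2 * b * (K + 1))" using c b K0 p by (simp add: s_def powr_powr)
      have "b * (s powr p * K) = c / 2 * (K / (K + 1))" unfolding sp' using b by simp
      also have "\<dots> < c / 2 * 1" using c K0 by (intro mult_strict_left_mono) auto
      finally show ?thesis by simp
    qed
    let ?d = "\<lambda>n t. 1 * g t + (-1) * level_cut n g t"
    have dq: "integrable mu (\<lambda>t. cmod (?d n t) powr q)" for n
      by (rule Bochner_Integration.integrable_bound[OF gq']) (use q diff_level_cut_le in \<open>auto intro!: AE_I2 powr_mono2\<close>)
    have "(\<lambda>n. \<integral>t. cmod (?d n t) powr q \<partial>mu) \<longlonglongrightarrow> (\<integral>t. 0 \<partial>mu)"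
    proof (rule integral_dominated_convergence[OF _ _ gq'])
      show "AE t in mu. (\<lambda>n. cmod (?d n t) powr q) \<longlonglongrightarrow> 0"
      proof (rule AE_I2)
        fix t
        have "(\<lambda>n. cmod (?d n t) powr q) \<longlonglongrightarrow> cmod (1 * g t + (-1) * g t) powr q"
          using q by (intro tendsto_powr2 tendsto_norm tendsto_intros level_cut_tendsto) auto
        thus "(\<lambda>n. cmod (?d n t) powr q) \<longlonglongrightarrow> 0" using q by simp
      qed
      show "AE t in mu. norm (cmod (?d n t) powr q) \<le> cmod (g t) powr q" for n
        using q diff_level_cut_le by (intro AE_I2) (auto intro!: powr_mono2)
    qed measurable
    hence "(\<lambda>n. b * (s powr p * K) + b * (s powr (- q) * (\<integral>t. cmod (?d n t) powr q \<partial>mu))) \<longlonglongrightarrow> b * (s powr p * K) + b * (s powr (- q) * (\<integral>t. 0 \<partial>mu))"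
      by (intro tendsto_intros)
    hence lim: "(\<lambda>n. b * (s powr p * K) + b * (s powr (- q) * (\<integral>t. cmod (?d n t) powr q \<partial>mu))) \<longlonglongrightarrow> b * (s powr p * K)"
      by simp
    have "eventually (\<lambda>n. b * (s powr p * K) + b * (s powr (- q) * (\<integral>t. cmod (?d n t) powr q \<partial>mu)) < c) sequentially"
      by (rule order_tendstoD(2)[OF lim]) (use sp c in linarith)
    thus "eventually (\<lambda>n. dist ((\<integral>t. f t * finite_hilbert (level_cut n g) t \<partial>mu) - (\<integral>t. f t * finite_hilbert g t \<partial>mu)) 0 < c) sequentially"
    proof eventually_elim
      case (elim n)
      have dm: "?d n \<in> borel_measurable mu" by measurable
      note Tdi = L1[OF dm dq] and Tci = L1[OF _ cq, of n]
      have mulbd: "integrable mu (\<lambda>t. f t * k t)" if "integrable mu k" for k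
        using bounded_kernel_integrable(1)[OF that fm, of "\<bar>B\<bar> + 1"] fB' by (simp add: mult.commute)
      have i1: "integrable mu (\<lambda>t. f t * finite_hilbert (level_cut n g) t)" using Tci by (intro mulbd) simp
      have i2: "integrable mu (\<lambda>t. f t * finite_hilbert g t)" by (rule mulbd[OF Tgi])
      have "cmod ((\<integral>t. f t * finite_hilbert (level_cut n g) t \<partial>mu) - (\<integral>t. f t * finite_hilbert g t \<partial>mu))
         = cmod (\<integral>t. f t * finite_hilbert (level_cut n g) t - f t * finite_hilbert g t \<partial>mu)"
        by (simp only: Bochner_Integration.integral_diff[OF i1 i2])
      also have "(\<integral>t. f t * finite_hilbert (level_cut n g) t - f t * finite_hilbert g t \<partial>mu) = (\<integral>t. finite_hilbert (?d n) t * (- f t) \<partial>mu)"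
      proof (rule integral_cong_AE)
        show "AE t in mu. f t * finite_hilbert (level_cut n g) t - f t * finite_hilbert g t = finite_hilbert (?d n) t * (- f t)"
          using finite_hilbert_linear[OF gi ci[of n], of 1 "-1"]
        proof eventually_elim
          case (elim t)
          show ?case unfolding elim by (simp add: algebra_simps)
        qed
      qed (use borel_measurable_integrable[OF Tdi] borel_measurable_integrable[OF i1] borel_measurable_integrable[OF i2] in \<open>auto intro!: borel_measurable_times borel_measurable_diff\<close>)
      also have "cmod (\<integral>t. finite_hilbert (?d n) t * (- f t) \<partial>mu) \<le> b * (\<integral>t. cmod (finite_hilbert (?d n) t) \<partial>mu)"
        by (rule bounded_kernel_integrable(2)[OF Tdi]) (use fB' in \<open>auto simp: b_def\<close>)
      also have "\<dots> \<le> b * (s powr p * K + s powr (- q) * (\<integral>t. cmod (?d n t) powr q \<partial>mu))"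
      proof (rule mult_left_mono)
        have nn: "0 \<le> s powr p * K + s powr (- q) * (\<integral>t. cmod (?d n t) powr q \<partial>mu)" using K0 by simp
        have "ennreal (\<integral>t. cmod (finite_hilbert (?d n) t) \<partial>mu) = (\<integral>\<^sup>+t. ennreal (cmod (finite_hilbert (?d n) t)) \<partial>mu)"
          by (rule nn_integral_eq_integral[symmetric]) (use Tdi in auto)
        also have "\<dots> \<le> ennreal (s powr p * K + s powr (- q) * (\<integral>t. cmod (?d n t) powr q \<partial>mu))" by (rule K[OF dm dq s])
        finally show "(\<integral>t. cmod (finite_hilbert (?d n) t) \<partial>mu) \<le> s powr p * K + s powr (- q) * (\<integral>t. cmod (?d n t) powr q \<partial>mu)"
          by (subst (asm) ennreal_le_iff[OF nn])
      qed (use b in simp)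
      also have "\<dots> < c" using elim by (simp add: distrib_left)
      finally show ?case by simp
    qed
  qed
  have "(\<integral>t. finite_hilbert f t * level_cut n g t \<partial>mu) = - (\<integral>t. f t * finite_hilbert (level_cut n g) t \<partial>mu)" for n
  proof (rule parseval_bounded[where B = "\<bar>B\<bar> + real n"])
    fix x
    show "cmod (f x) \<le> \<bar>B\<bar> + real n" using fB[of x] by linarith
    show "cmod (level_cut n g x) \<le> \<bar>B\<bar> + real n" using level_cut_bound[of n g x] by linarith
  qed measurable
  with lhs have "(\<lambda>n. - (\<integral>t. f t * finite_hilbert (level_cut n g) t \<partial>mu)) \<longlonglongrightarrow> (\<integral>t. finite_hilbert f t * g t \<partial>mu)" by simp
  from LIMSEQ_unique[OF this tendsto_minus[OF rhs]]
  show "(\<integral>t. finite_hilbert f t * g t \<partial>mu) = - (\<integral>t. f t * finite_hilbert g t \<partial>mu)" .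
qed

section \<open>Integration against complex measures with density\<close>

text \<open>The supremum that defines the positive variation is attained on the set where the density is
  nonnegative.\<close>

lemma pos_variation_density:
  fixes r :: "real \<Rightarrow> real"
  assumes r: "integrable mu r" and nu: "\<And>A. A \<in> sets mu \<Longrightarrow> \<nu> A = (\<integral>x. indicator A x * r x \<partial>mu)"
  shows "pos_variation \<nu> = density mu (\<lambda>x. ennreal (max 0 (r x)))"
proof -
  note [measurable] = borel_measurable_integrable[OF r]
  let ?D = "density mu (\<lambda>x. ennreal (max 0 (r x)))"
  have rp: "integrable mu (\<lambda>x. indicator A x * max 0 (r x))" if [measurable]: "A \<in> sets mu" for A
    using integrable_mult_indicator[OF that, of "\<lambda>x. max 0 (r x)"] r by simp
  have ri: "integrable mu (\<lambda>x. indicator A x * r x)" if [measurable]: "A \<in> sets mu" for A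
    using integrable_mult_indicator[OF that, of r] r by simp
  have val: "emeasure ?D A = ennreal (\<integral>x. indicator A x * max 0 (r x) \<partial>mu)" if A [measurable]: "A \<in> sets mu" for A
  proof -
    have "emeasure ?D A = (\<integral>\<^sup>+x. ennreal (indicator A x * max 0 (r x)) \<partial>mu)"
      by (subst emeasure_density) (auto intro!: nn_integral_cong simp: indicator_def)
    also have "\<dots> = ennreal (\<integral>x. indicator A x * max 0 (r x) \<partial>mu)"
      by (rule nn_integral_eq_integral[OF rp[OF A]]) auto
    finally show ?thesis .
  qed
  have sup: "(SUP B\<in>{B \<in> sets mu. B \<subseteq> A}. ennreal (\<nu> B)) = emeasure ?D A" if A [measurable]: "A \<in> sets mu" for A
  proof (rule antisym)
    show "(SUP B\<in>{B \<in> sets mu. B \<subseteq> A}. ennreal (\<nu> B)) \<le> emeasure ?D A"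
    proof (rule SUP_least)
      fix B assume "B \<in> {B \<in> sets mu. B \<subseteq> A}"
      hence B: "B \<in> sets mu" "B \<subseteq> A" by auto
      have "\<nu> B \<le> (\<integral>x. indicator A x * max 0 (r x) \<partial>mu)"
        unfolding nu[OF B(1)] by (intro integral_mono ri rp B A) (use B(2) in \<open>auto simp: indicator_def\<close>)
      thus "ennreal (\<nu> B) \<le> emeasure ?D A" unfolding val[OF A] by (rule ennreal_leI)
    qed
    let ?B = "A \<inter> {x \<in> space mu. 0 \<le> r x}"
    have B: "?B \<in> sets mu" by measurable
    have "\<nu> ?B = (\<integral>x. indicator A x * max 0 (r x) \<partial>mu)"
      unfolding nu[OF B] by (rule Bochner_Integration.integral_cong) (auto simp: indicator_def max_def)
    hence "emeasure ?D A = ennreal (\<nu> ?B)" unfolding val[OF A] by simp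
    also have "\<dots> \<le> (SUP B\<in>{B \<in> sets mu. B \<subseteq> A}. ennreal (\<nu> B))"
      using B by (intro SUP_upper) auto
    finally show "emeasure ?D A \<le> (SUP B\<in>{B \<in> sets mu. B \<subseteq> A}. ennreal (\<nu> B))" .
  qed
  have "pos_variation \<nu> = measure_of (space mu) (sets mu) (emeasure ?D)"
    unfolding pos_variation_def
  proof (rule measure_of_eq)
    fix A assume "A \<in> sigma_sets (space mu) (sets mu)"
    hence "A \<in> sets mu" by (simp only: sets.sigma_sets_eq)
    thus "(SUP B\<in>{B \<in> sets mu. B \<subseteq> A}. ennreal (\<nu> B)) = emeasure ?D A" by (rule sup)
  qed (rule sets.space_closed)
  also have "\<dots> = measure_of (space ?D) (sets ?D) (emeasure ?D)" by (simp only: space_density sets_density)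
  also have "\<dots> = ?D" by (rule measure_of_of_measure)
  finally show ?thesis .
qed

lemma cmeasure_density:
  fixes f w :: "real \<Rightarrow> complex"
  assumes w: "integrable mu w" and nu: "\<And>A. A \<in> sets mu \<Longrightarrow> \<nu> A = (\<integral>x. indicator A x * w x \<partial>mu)"
    and fm [measurable]: "f \<in> borel_measurable mu" and fw: "integrable mu (\<lambda>x. f x * w x)"
  shows "cmeasure_integrable \<nu> f"
    and "A \<in> sets mu \<Longrightarrow> cmeasure_integral \<nu> A f = (\<integral>x. f x * indicator A x * w x \<partial>mu)"
proof -
  note [measurable] = borel_measurable_integrable[OF w]
  have wi: "integrable mu (\<lambda>x. indicator A x * w x)" if "A \<in> sets mu" for A
    using integrable_mult_indicator[OF that w] by (simp add: scaleR_conv_of_real of_real_indicator)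
  have Re: "Re (\<nu> A) = (\<integral>x. indicator A x * Re (w x) \<partial>mu)" and Im: "Im (\<nu> A) = (\<integral>x. indicator A x * Im (w x) \<partial>mu)"
    if "A \<in> sets mu" for A
    unfolding nu[OF that]
  proof -
    have "Re (\<integral>x. indicator A x * w x \<partial>mu) = (\<integral>x. Re (indicator A x * w x) \<partial>mu)"
      by (rule integral_Re[OF wi[OF that], symmetric])
    also have "\<dots> = (\<integral>x. indicator A x * Re (w x) \<partial>mu)"
      by (rule Bochner_Integration.integral_cong) (simp_all split: split_indicator)
    finally show "Re (\<integral>x. indicator A x * w x \<partial>mu) = (\<integral>x. indicator A x * Re (w x) \<partial>mu)" .
    have "Im (\<integral>x. indicator A x * w x \<partial>mu) = (\<integral>x. Im (indicator A x * w x) \<partial>mu)"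
      by (rule integral_Im[OF wi[OF that], symmetric])
    also have "\<dots> = (\<integral>x. indicator A x * Im (w x) \<partial>mu)"
      by (rule Bochner_Integration.integral_cong) (simp_all split: split_indicator)
    finally show "Im (\<integral>x. indicator A x * w x \<partial>mu) = (\<integral>x. indicator A x * Im (w x) \<partial>mu)" .
  qed
  have pv: "pos_variation (\<lambda>A. Re (\<nu> A)) = density mu (\<lambda>x. ennreal (max 0 (Re (w x))))"
    "pos_variation (\<lambda>A. - Re (\<nu> A)) = density mu (\<lambda>x. ennreal (max 0 (- Re (w x))))"
    "pos_variation (\<lambda>A. Im (\<nu> A)) = density mu (\<lambda>x. ennreal (max 0 (Im (w x))))"
    "pos_variation (\<lambda>A. - Im (\<nu> A)) = density mu (\<lambda>x. ennreal (max 0 (- Im (w x))))"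
    by (rule pos_variation_density; use w Re Im in \<open>auto\<close>)+
  have b: "\<bar>max 0 (Re (w x))\<bar> \<le> cmod (w x)" "\<bar>max 0 (- Re (w x))\<bar> \<le> cmod (w x)"
    "\<bar>max 0 (Im (w x))\<bar> \<le> cmod (w x)" "\<bar>max 0 (- Im (w x))\<bar> \<le> cmod (w x)" for x
    using abs_Re_le_cmod[of "w x"] abs_Im_le_cmod[of "w x"] norm_ge_zero[of "w x"]
    by (auto simp: max_def abs_le_iff simp del: norm_ge_zero)
  have dom: "integrable mu (\<lambda>x. r x *\<^sub>R (indicator A x *\<^sub>R f x))"
    if [measurable]: "r \<in> borel_measurable mu" "A \<in> sets mu" and "\<And>x. \<bar>r x\<bar> \<le> cmod (w x)" for r :: "real \<Rightarrow> real" and A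
  proof (rule Bochner_Integration.integrable_bound[OF fw])
    have "\<bar>r x\<bar> * (indicator A x * cmod (f x)) \<le> cmod (w x) * (1 * cmod (f x))" for x
      using that(3)[of x] by (intro mult_mono) (auto simp: indicator_def)
    thus "AE x in mu. norm (r x *\<^sub>R (indicator A x *\<^sub>R f x)) \<le> norm (f x * w x)"
      by (intro AE_I2) (simp add: norm_mult abs_mult mult_ac)
  qed measurable
  have full: "integrable (density mu (\<lambda>x. ennreal (r x))) f"
    if [measurable]: "r \<in> borel_measurable mu" and "\<And>x. \<bar>r x\<bar> \<le> cmod (w x)" "\<And>x. 0 \<le> r x" for r :: "real \<Rightarrow> real"
  proof -
    have "integrable mu (\<lambda>x. r x *\<^sub>R f x)"
    proof (rule Bochner_Integration.integrable_bound[OF fw])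
      show "AE x in mu. norm (r x *\<^sub>R f x) \<le> norm (f x * w x)"
        using that(2) by (intro AE_I2) (simp add: norm_mult mult.commute[of "cmod (f _)"] mult_right_mono)
    qed measurable
    thus ?thesis using that by (subst integrable_density) auto
  qed
  show "cmeasure_integrable \<nu> f"
    unfolding cmeasure_integrable_def pv by (intro conjI full b) auto
  assume A [measurable]: "A \<in> sets mu"
  have li: "(LINT x:A|density mu (\<lambda>x. ennreal (r x)). f x) = (\<integral>x. r x *\<^sub>R (indicator A x *\<^sub>R f x) \<partial>mu)"
    if [measurable]: "r \<in> borel_measurable mu" and "\<And>x. 0 \<le> r x" for r :: "real \<Rightarrow> real"
    unfolding set_lebesgue_integral_def by (rule integral_density) (use that in auto)
  let ?g = "\<lambda>x. indicator A x *\<^sub>R f x"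
  have i: "integrable mu (\<lambda>x. max 0 (Re (w x)) *\<^sub>R ?g x)" "integrable mu (\<lambda>x. max 0 (- Re (w x)) *\<^sub>R ?g x)"
     "integrable mu (\<lambda>x. max 0 (Im (w x)) *\<^sub>R ?g x)" "integrable mu (\<lambda>x. max 0 (- Im (w x)) *\<^sub>R ?g x)"
    by (rule dom[OF _ A b(1)] dom[OF _ A b(2)] dom[OF _ A b(3)] dom[OF _ A b(4)]; measurable)+
  have "cmeasure_integral \<nu> A f = (\<integral>x. max 0 (Re (w x)) *\<^sub>R ?g x - max 0 (- Re (w x)) *\<^sub>R ?g x \<partial>mu)
      + \<i> * (\<integral>x. max 0 (Im (w x)) *\<^sub>R ?g x - max 0 (- Im (w x)) *\<^sub>R ?g x \<partial>mu)"
    unfolding cmeasure_integral_def pv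
    by (subst li, simp, simp)+ (simp only: Bochner_Integration.integral_diff i)
  also have "\<dots> = (\<integral>x. (max 0 (Re (w x)) *\<^sub>R ?g x - max 0 (- Re (w x)) *\<^sub>R ?g x)
      + \<i> * (max 0 (Im (w x)) *\<^sub>R ?g x - max 0 (- Im (w x)) *\<^sub>R ?g x) \<partial>mu)"
    by (simp only: Bochner_Integration.integral_add Bochner_Integration.integrable_diff i
        integral_mult_right_zero integrable_mult_right)
  also have "\<dots> = (\<integral>x. f x * indicator A x * w x \<partial>mu)"
  proof (rule Bochner_Integration.integral_cong)
    fix x
    define a b c d where "a = max 0 (Re (w x))" and "b = max 0 (- Re (w x))"
      and "c = max 0 (Im (w x))" and "d = max 0 (- Im (w x))"
    have wx: "w x = of_real a - of_real b + \<i> * (of_real c - of_real d)"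
      by (simp add: a_def b_def c_def d_def complex_eq_iff max_def)
    show "(max 0 (Re (w x)) *\<^sub>R ?g x - max 0 (- Re (w x)) *\<^sub>R ?g x)
      + \<i> * (max 0 (Im (w x)) *\<^sub>R ?g x - max 0 (- Im (w x)) *\<^sub>R ?g x) = f x * indicator A x * w x"
      unfolding a_def[symmetric] b_def[symmetric] c_def[symmetric] d_def[symmetric]
      by (subst wx, cases "x \<in> A") (simp_all add: scaleR_conv_of_real algebra_simps)
  qed simp
  finally show "cmeasure_integral \<nu> A f = (\<integral>x. f x * indicator A x * w x \<partial>mu)" .
qed

section \<open>Uniform boundedness on the optimal domain\<close>

text \<open>Uniform convergence of multipliers gives almost everywhere convergence of the transforms along a
  subsequence, and Fatou's lemma applies.\<close>

lemma powr_norm_lower_semicontinuous: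
  fixes f ph1 :: "real \<Rightarrow> complex" and p :: real
  assumes p: "1 < p" and f: "integrable mu f" and ph1 [measurable]: "ph1 \<in> borel_measurable mu" and B: "\<And>x. cmod (ph1 x) \<le> B"
    and big: "ennreal c < (\<integral>\<^sup>+t. ennreal (cmod (finite_hilbert (\<lambda>x. f x * ph1 x) t) powr p) \<partial>mu)"
  shows "\<exists>r>0. \<forall>ph\<in>borel_measurable mu. (\<forall>x. cmod (ph x - ph1 x) \<le> r) \<longrightarrow>
    ennreal c < (\<integral>\<^sup>+t. ennreal (cmod (finite_hilbert (\<lambda>x. f x * ph x) t) powr p) \<partial>mu)"
proof (rule ccontr)
  assume neg: "\<not> ?thesis"
  have "\<exists>ph\<in>borel_measurable mu. (\<forall>x. cmod (ph x - ph1 x) \<le> inverse (real (Suc j))) \<and>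
    (\<integral>\<^sup>+t. ennreal (cmod (finite_hilbert (\<lambda>x. f x * ph x) t) powr p) \<partial>mu) \<le> ennreal c" for j
  proof -
    have "0 < inverse (real (Suc j))" by simp
    thus ?thesis using neg by (meson not_le)
  qed
  then obtain ph where phm [measurable]: "\<And>j. ph j \<in> borel_measurable mu"
    and phc: "\<And>j x. cmod (ph j x - ph1 x) \<le> inverse (real (Suc j))"
    and phb: "\<And>j. (\<integral>\<^sup>+t. ennreal (cmod (finite_hilbert (\<lambda>x. f x * ph j x) t) powr p) \<partial>mu) \<le> ennreal c"
    by metis
  note [measurable] = borel_measurable_integrable[OF f]
  have f1: "integrable mu (\<lambda>x. f x * ph1 x)" by (rule bounded_kernel_integrable(1)[OF f ph1 B])
  have pB: "cmod (ph j x) \<le> B + inverse (real (Suc j))" for j x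
    using norm_triangle_ineq[of "ph j x - ph1 x" "ph1 x"] phc[of j x] B[of x] by simp
  have fj: "integrable mu (\<lambda>x. f x * ph j x)" for j by (rule bounded_kernel_integrable(1)[OF f phm pB])
  have "(\<lambda>j. \<integral>x. cmod (f x * ph1 x - f x * ph j x) \<partial>mu) \<longlonglongrightarrow> 0"
  proof (rule Lim_null_comparison)
    show "(\<lambda>j. (\<integral>x. cmod (f x) \<partial>mu) * inverse (real (Suc j))) \<longlonglongrightarrow> 0"
      using tendsto_mult[OF tendsto_const LIMSEQ_inverse_real_of_nat, of "\<integral>x. cmod (f x) \<partial>mu"] by simp
    show "eventually (\<lambda>j. norm (\<integral>x. cmod (f x * ph1 x - f x * ph j x) \<partial>mu) \<le> (\<integral>x. cmod (f x) \<partial>mu) * inverse (real (Suc j))) sequentially"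
    proof (rule always_eventually, rule allI)
      fix j
      have "(\<integral>x. cmod (f x * ph1 x - f x * ph j x) \<partial>mu) \<le> (\<integral>x. cmod (f x) * inverse (real (Suc j)) \<partial>mu)"
      proof (rule integral_mono)
        fix x
        have "cmod (f x * ph1 x - f x * ph j x) = cmod (f x) * cmod (ph j x - ph1 x)"
          by (simp flip: right_diff_distrib add: norm_mult norm_minus_commute)
        also have "\<dots> \<le> cmod (f x) * inverse (real (Suc j))" by (intro mult_left_mono phc) simp
        finally show "cmod (f x * ph1 x - f x * ph j x) \<le> cmod (f x) * inverse (real (Suc j))" .
      qed (use f1 fj f in \<open>auto simp del: of_nat_Suc\<close>)
      thus "norm (\<integral>x. cmod (f x * ph1 x - f x * ph j x) \<partial>mu) \<le> (\<integral>x. cmod (f x) \<partial>mu) * inverse (real (Suc j))"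
        by (simp del: of_nat_Suc)
    qed
  qed
  then obtain r :: "nat \<Rightarrow> nat" where r: "strict_mono r"
    "AE t in mu. (\<lambda>n. finite_hilbert (\<lambda>x. f x * ph (r n) x) t) \<longlonglongrightarrow> finite_hilbert (\<lambda>x. f x * ph1 x) t"
    by (rule finite_hilbert_AE_subsequence_limit[OF fj f1])
  have "(\<integral>\<^sup>+t. ennreal (cmod (finite_hilbert (\<lambda>x. f x * ph1 x) t) powr p) \<partial>mu) \<le> ennreal c"
    by (rule fatou_powr[OF finite_hilbert_measurable[OF fj] _ phb r(2)]) (use p in simp)
  thus False using big by simp
qed

lemma finite_hilbert_multiplier_scale:
  assumes f: "integrable mu f" and ph [measurable]: "ph \<in> borel_measurable mu" and B: "\<And>x. cmod (ph x) \<le> B"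
  shows "AE t in mu. finite_hilbert (\<lambda>x. f x * (u * ph x)) t = u * finite_hilbert (\<lambda>x. f x * ph x) t"
proof -
  have i: "integrable mu (\<lambda>x. f x * ph x)" by (rule bounded_kernel_integrable(1)[OF f ph B])
  show ?thesis using finite_hilbert_linear[OF i i, of u 0] by (simp add: mult.left_commute)
qed

text \<open>The set of multipliers \<open>\<phi>\<close> whose image \<open>T (\<phi> f)\<close> has \<open>L\<^sup>p\<close> norm at most \<open>n\<close> is closed in the
  uniform norm, and these sets cover all bounded multipliers. If no bound existed, every ball
  would contain multipliers with arbitrarily large images, and by semicontinuity a smaller ball on
  which the images stay large. Nested balls of this kind shrink to a multiplier whose image is not
  in \<open>L\<^sup>p\<close>.\<close>

theorem optimal_domain_uniform_bound:
  fixes f :: "real \<Rightarrow> complex" and p :: real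
  assumes p: "1 < p" and f: "integrable mu f"
    and dom: "\<And>h. h \<in> borel_measurable mu \<Longrightarrow> AE x in mu. cmod (h x) \<le> cmod (f x) \<Longrightarrow>
      integrable mu (\<lambda>t. cmod (finite_hilbert h t) powr p)"
  obtains M where "\<And>ph. ph \<in> borel_measurable mu \<Longrightarrow> (\<And>x. cmod (ph x) \<le> 1) \<Longrightarrow>
    (\<integral>\<^sup>+t. ennreal (cmod (finite_hilbert (\<lambda>x. f x * ph x) t) powr p) \<partial>mu) \<le> ennreal M"
proof (rule ccontr)
  note [measurable] = borel_measurable_integrable[OF f]
  define Ph where "Ph ph = (\<integral>\<^sup>+t. ennreal (cmod (finite_hilbert (\<lambda>x. f x * ph x) t) powr p) \<partial>mu)" for ph
  assume "\<not> thesis"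
  hence unb: "\<exists>ph\<in>borel_measurable mu. (\<forall>x. cmod (ph x) \<le> 1) \<and> ennreal M < Ph ph" for M
    using that[of M] unfolding Ph_def by (meson not_le)
  have p0: "0 < p" using p by simp
  have fin: "Ph ph < \<infinity>" if phm [measurable]: "ph \<in> borel_measurable mu" and B: "\<And>x. cmod (ph x) \<le> B" for ph B
  proof -
    define b where "b = \<bar>B\<bar> + 1"
    have b: "0 < b" by (simp add: b_def add_nonneg_pos)
    define ps where "ps x = of_real (1 / b) * ph x" for x
    have psm [measurable]: "ps \<in> borel_measurable mu" unfolding ps_def by measurable
    have ps1: "cmod (ps x) \<le> 1" for x
    proof -
      have "cmod (ph x) \<le> b" using B[of x] unfolding b_def by linarith
      thus ?thesis using b by (simp add: ps_def norm_mult norm_divide)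
    qed
    have "integrable mu (\<lambda>t. cmod (finite_hilbert (\<lambda>x. f x * ps x) t) powr p)"
      by (rule dom) (use ps1 in \<open>auto intro!: AE_I2 mult_left_le simp: norm_mult\<close>)
    hence i: "integrable mu (\<lambda>t. b powr p * cmod (finite_hilbert (\<lambda>x. f x * ps x) t) powr p)" by simp
    have phps: "ph x = of_real b * ps x" for x using b by (simp add: ps_def)
    have "Ph ph = (\<integral>\<^sup>+t. ennreal (b powr p * cmod (finite_hilbert (\<lambda>x. f x * ps x) t) powr p) \<partial>mu)"
      unfolding Ph_def
    proof (rule nn_integral_cong_AE)
      show "AE t in mu. ennreal (cmod (finite_hilbert (\<lambda>x. f x * ph x) t) powr p)
         = ennreal (b powr p * cmod (finite_hilbert (\<lambda>x. f x * ps x) t) powr p)"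
        using finite_hilbert_multiplier_scale[OF f psm ps1, of "of_real b"] unfolding phps
        by eventually_elim (use b in \<open>simp add: norm_mult powr_mult\<close>)
    qed
    also have "\<dots> < \<infinity>" using nn_integral_eq_integral[OF i] by simp
    finally show ?thesis .
  qed
  have stepA: "\<exists>ph1\<in>borel_measurable mu. (\<forall>x. cmod (ph1 x - ph0 x) \<le> r) \<and> ennreal c < Ph ph1"
    if m0 [measurable]: "ph0 \<in> borel_measurable mu" and B: "\<And>x. cmod (ph0 x) \<le> B" and r: "0 < r" and c: "0 \<le> c" for ph0 B r c
  proof (rule ccontr)
    assume "\<not> ?thesis"
    hence small: "Ph ph1 \<le> ennreal c" if "ph1 \<in> borel_measurable mu" "\<And>x. cmod (ph1 x - ph0 x) \<le> r" for ph1
      using that by (meson not_le)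
    obtain ps where ps [measurable]: "ps \<in> borel_measurable mu" and ps1: "\<And>x. cmod (ps x) \<le> 1"
      and big: "ennreal ((1/r) powr p * (2 powr p * (c + c))) < Ph ps"
      using unb by blast
    define ph1 where "ph1 x = ph0 x + of_real r * ps x" for x
    have m1 [measurable]: "ph1 \<in> borel_measurable mu" unfolding ph1_def by measurable
    have d1: "cmod (ph1 x - ph0 x) \<le> r" for x using ps1[of x] r by (simp add: ph1_def norm_mult mult_left_le)
    have B1: "cmod (ph1 x) \<le> B + r" for x
      using norm_triangle_ineq[of "ph1 x - ph0 x" "ph0 x"] d1[of x] B[of x] by simp
    have i0: "integrable mu (\<lambda>x. f x * ph0 x)" by (rule bounded_kernel_integrable(1)[OF f m0 B])
    have i1: "integrable mu (\<lambda>x. f x * ph1 x)" by (rule bounded_kernel_integrable(1)[OF f m1 B1])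
    note T0 [measurable] = finite_hilbert_measurable[OF i0] and T1 [measurable] = finite_hilbert_measurable[OF i1]
    have pse: "(\<lambda>x. f x * ps x) = (\<lambda>x. of_real (1/r) * (f x * ph1 x) + (- of_real (1/r)) * (f x * ph0 x))"
      using r by (auto simp: ph1_def field_simps)
    have "Ph ps \<le> (\<integral>\<^sup>+t. ennreal ((1/r) powr p * 2 powr p) * (ennreal (cmod (finite_hilbert (\<lambda>x. f x * ph1 x) t) powr p)
        + ennreal (cmod (finite_hilbert (\<lambda>x. f x * ph0 x) t) powr p)) \<partial>mu)"
      unfolding Ph_def
    proof (rule nn_integral_mono_AE)
      show "AE t in mu. ennreal (cmod (finite_hilbert (\<lambda>x. f x * ps x) t) powr p) \<le> ennreal ((1/r) powr p * 2 powr p) *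
          (ennreal (cmod (finite_hilbert (\<lambda>x. f x * ph1 x) t) powr p) + ennreal (cmod (finite_hilbert (\<lambda>x. f x * ph0 x) t) powr p))"
        using finite_hilbert_linear[OF i1 i0, of "of_real (1/r)" "- of_real (1/r)"]
      proof eventually_elim
        case (elim t)
        let ?a = "finite_hilbert (\<lambda>x. f x * ph1 x) t" and ?b = "finite_hilbert (\<lambda>x. f x * ph0 x) t"
        have "finite_hilbert (\<lambda>x. f x * ps x) t = of_real (1/r) * (?a - ?b)"
          unfolding pse elim by (simp add: algebra_simps)
        hence "cmod (finite_hilbert (\<lambda>x. f x * ps x) t) \<le> (1/r) * (cmod ?a + cmod ?b)"
          using r norm_triangle_ineq4[of ?a ?b] by (simp add: norm_divide divide_right_mono)
        hence "cmod (finite_hilbert (\<lambda>x. f x * ps x) t) powr p \<le> ((1/r) * (cmod ?a + cmod ?b)) powr p"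
          using p0 by (intro powr_mono2) auto
        also have "\<dots> = (1/r) powr p * (cmod ?a + cmod ?b) powr p" using r by (subst powr_mult) auto
        also have "\<dots> \<le> (1/r) powr p * (2 powr p * (cmod ?a powr p + cmod ?b powr p))"
          using p0 by (intro mult_left_mono add_powr_le) auto
        finally show ?case by (simp add: ennreal_leI mult.assoc flip: ennreal_plus ennreal_mult)
      qed
    qed
    also have "\<dots> = ennreal ((1/r) powr p * 2 powr p) * (Ph ph1 + Ph ph0)"
      unfolding Ph_def by (subst nn_integral_cmult, measurable, subst nn_integral_add) auto
    also have "\<dots> \<le> ennreal ((1/r) powr p * 2 powr p) * (ennreal c + ennreal c)"
      by (intro mult_left_mono add_mono small m1 m0 d1) (use r in auto)
    also have "\<dots> = ennreal ((1/r) powr p * (2 powr p * (c + c)))" using c by (simp add: mult.assoc flip: ennreal_plus ennreal_mult)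
    finally show False using big by simp
  qed
  define st where "st n s \<longleftrightarrow> fst s \<in> borel_measurable mu \<and> (\<exists>B. \<forall>x. cmod (fst s x) \<le> B) \<and> 0 < snd s \<and>
    (\<forall>ph\<in>borel_measurable mu. (\<forall>x. cmod (ph x - fst s x) \<le> snd s) \<longrightarrow> ennreal (real n) < Ph ph)"
    for n :: nat and s :: "(real \<Rightarrow> complex) \<times> real"
  have next_state: "\<exists>s'. st n s' \<and> snd s' \<le> r / 2 \<and> (\<forall>x. cmod (fst s' x - ph0 x) \<le> r / 2)"
    if m0: "ph0 \<in> borel_measurable mu" and B: "\<And>x. cmod (ph0 x) \<le> B" and r: "0 < r" for ph0 B r n
  proof -
    obtain ph1 where ph1: "ph1 \<in> borel_measurable mu" "\<And>x. cmod (ph1 x - ph0 x) \<le> r / 2" "ennreal (real n) < Ph ph1"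
      using stepA[OF m0 B, of "r/2" "real n"] r by auto
    have B1: "cmod (ph1 x) \<le> B + r / 2" for x
      using norm_triangle_ineq[of "ph1 x - ph0 x" "ph0 x"] ph1(2)[of x] B[of x] by simp
    obtain r1 where r1: "0 < r1" "\<And>ph. ph \<in> borel_measurable mu \<Longrightarrow> (\<forall>x. cmod (ph x - ph1 x) \<le> r1) \<Longrightarrow> ennreal (real n) < Ph ph"
      using powr_norm_lower_semicontinuous[OF p f ph1(1) B1, of "real n"] ph1(3) unfolding Ph_def by blast
    have "st n (ph1, min r1 (r/2))"
      unfolding st_def using ph1(1) B1 r1 r by (auto intro!: exI[of _ "B + r / 2"])
    thus ?thesis using ph1(2) by (intro exI[of _ "(ph1, min r1 (r/2))"]) auto
  qed
  have "\<exists>S. \<forall>n. st n (S n) \<and> (snd (S (Suc n)) \<le> snd (S n) / 2 \<and> (\<forall>x. cmod (fst (S (Suc n)) x - fst (S n) x) \<le> snd (S n) / 2))"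
  proof (rule dependent_nat_choice)
    show "\<exists>s. st 0 s" using next_state[of "\<lambda>_. 0" 0 1 0] by auto
    fix s n assume "st n s"
    then obtain B where "fst s \<in> borel_measurable mu" "\<And>x. cmod (fst s x) \<le> B" "0 < snd s" unfolding st_def by blast
    from next_state[OF this, of "Suc n"]
    show "\<exists>s'. st (Suc n) s' \<and> snd s' \<le> snd s / 2 \<and> (\<forall>x. cmod (fst s' x - fst s x) \<le> snd s / 2)" .
  qed
  then obtain S where S: "\<And>n. st n (S n)" "\<And>n. snd (S (Suc n)) \<le> snd (S n) / 2"
    "\<And>n x. cmod (fst (S (Suc n)) x - fst (S n) x) \<le> snd (S n) / 2" by blast
  have pos: "0 < snd (S n)" and Sm [measurable]: "fst (S n) \<in> borel_measurable mu" for n using S(1)[of n] by (auto simp: st_def)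
  have near: "cmod (fst (S (n + k)) x - fst (S n) x) \<le> snd (S n)" for n k x
  proof (induction k arbitrary: n)
    case 0
    show ?case using pos[of n] by simp
  next
    case (Suc k)
    have "cmod (fst (S (n + Suc k)) x - fst (S n) x) \<le> cmod (fst (S (Suc n + k)) x - fst (S (Suc n)) x) + cmod (fst (S (Suc n)) x - fst (S n) x)"
      using norm_triangle_ineq[of "fst (S (Suc n + k)) x - fst (S (Suc n)) x" "fst (S (Suc n)) x - fst (S n) x"] by simp
    also have "\<dots> \<le> snd (S (Suc n)) + snd (S n) / 2" by (intro add_mono Suc S(3))
    also have "\<dots> \<le> snd (S n)" using S(2)[of n] by simp
    finally show ?case .
  qed
  have small: "snd (S n) \<le> snd (S 0) * (1/2) ^ n" for n
  proof (induction n)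
    case (Suc n)
    thus ?case using S(2)[of n] by simp
  qed simp
  have "(\<lambda>n. snd (S 0) * (1/2) ^ n) \<longlonglongrightarrow> snd (S 0) * 0"
    by (intro tendsto_intros LIMSEQ_realpow_zero) auto
  hence lim0: "(\<lambda>n. snd (S 0) * (1/2) ^ n) \<longlonglongrightarrow> 0" by simp
  have radius0: "(\<lambda>n. snd (S n)) \<longlonglongrightarrow> 0"
  proof (rule tendsto_sandwich[OF _ _ tendsto_const lim0])
    show "eventually (\<lambda>n. 0 \<le> snd (S n)) sequentially" by (intro always_eventually allI less_imp_le pos)
    show "eventually (\<lambda>n. snd (S n) \<le> snd (S 0) * (1/2) ^ n) sequentially" by (intro always_eventually allI small)
  qed
  have "Cauchy (\<lambda>n. fst (S n) x)" for x
  proof (rule metric_CauchyI)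
    fix c :: real assume "0 < c"
    then obtain N where N: "snd (S N) < c / 2"
      using order_tendstoD(2)[OF radius0, of "c/2"] eventually_happens'[OF sequentially_bot] by auto
    have "dist (fst (S n) x) (fst (S N) x) < c / 2" if "N \<le> n" for n
      using near[of N "n - N" x] N that by (simp add: dist_norm)
    thus "\<exists>M. \<forall>m\<ge>M. \<forall>n\<ge>M. dist (fst (S m) x) (fst (S n) x) < c"
      using dist_triangle_half_l by (metis dist_commute)
  qed
  hence conv: "(\<lambda>n. fst (S n) x) \<longlonglongrightarrow> lim (\<lambda>n. fst (S n) x)" for x
    by (simp add: Cauchy_convergent_iff convergent_LIMSEQ_iff)
  define ph where "ph x = lim (\<lambda>n. fst (S n) x)" for x
  have phm: "ph \<in> borel_measurable mu" unfolding ph_def by (intro borel_measurable_lim_metric Sm)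
  have phn: "cmod (ph x - fst (S n) x) \<le> snd (S n)" for n x
  proof (rule LIMSEQ_le_const2)
    show "(\<lambda>k. cmod (fst (S (n + k)) x - fst (S n) x)) \<longlonglongrightarrow> cmod (ph x - fst (S n) x)"
      using LIMSEQ_ignore_initial_segment[OF conv[of x], of n]
      by (intro tendsto_intros) (simp add: ph_def add.commute)
  qed (use near in auto)
  obtain B where "\<And>x. cmod (fst (S 0) x) \<le> B" using S(1)[of 0] unfolding st_def by blast
  hence "cmod (ph x) \<le> B + snd (S 0)" for x
    using norm_triangle_ineq[of "ph x - fst (S 0) x" "fst (S 0) x"] phn[of x 0] by (simp add: add_mono order_trans add.commute)
  from fin[OF phm this] obtain y where y: "Ph ph = ennreal y" "0 \<le> y" by (cases "Ph ph") auto
  have "ennreal (real n) < Ph ph" for n using S(1)[of n] phm phn[of _ n] unfolding st_def by blast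
  hence "real n < y" for n using y by (simp add: ennreal_less_iff)
  thus False using reals_Archimedean2[of y] by (meson less_asym)
qed

section \<open>Duality on the optimal domain\<close>

text \<open>For the truncations of \<open>f\<close> to its level sets this is Parseval's formula. With a suitable phase
  and the uniform bound it estimates \<open>|f T g|\<close> in \<open>L\<^sup>1\<close>, uniformly in the level.\<close>

theorem optimal_domain_duality:
  fixes f g :: "real \<Rightarrow> complex" and p :: real
  assumes p: "1 < p" and f: "integrable mu f"
    and dom: "\<And>h. h \<in> borel_measurable mu \<Longrightarrow> AE x in mu. cmod (h x) \<le> cmod (f x) \<Longrightarrow>
      integrable mu (\<lambda>t. cmod (finite_hilbert h t) powr p)"
    and gm [measurable]: "g \<in> borel_measurable mu" and gq: "integrable mu (\<lambda>t. cmod (g t) powr (p / (p - 1)))"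
  shows "integrable mu (\<lambda>t. f t * finite_hilbert g t)"
    and "ph \<in> borel_measurable mu \<Longrightarrow> (\<And>x. cmod (ph x) \<le> 1) \<Longrightarrow>
      (\<integral>t. finite_hilbert (\<lambda>x. f x * ph x) t * g t \<partial>mu) = - (\<integral>t. f t * ph t * finite_hilbert g t \<partial>mu)"
proof -
  note fm [measurable] = borel_measurable_integrable[OF f]
  obtain M where M: "\<And>ph. ph \<in> borel_measurable mu \<Longrightarrow> (\<And>x. cmod (ph x) \<le> 1) \<Longrightarrow>
    (\<integral>\<^sup>+t. ennreal (cmod (finite_hilbert (\<lambda>x. f x * ph x) t) powr p) \<partial>mu) \<le> ennreal M"
    using optimal_domain_uniform_bound[OF p f dom] by blast
  have M': "(\<integral>\<^sup>+t. ennreal (cmod (finite_hilbert (\<lambda>x. f x * ph x) t) powr p) \<partial>mu) \<le> ennreal \<bar>M\<bar>"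
    if "ph \<in> borel_measurable mu" "\<And>x. cmod (ph x) \<le> 1" for ph
    using M[OF that] by (rule order_trans) (simp add: ennreal_leI)
  have q: "1 \<le> p / (p - 1)" using p by (simp add: field_simps)
  have gi: "integrable mu g" by (rule integrable_of_powr[OF gm gq q])
  have Tgm [measurable]: "finite_hilbert g \<in> borel_measurable mu" by (rule finite_hilbert_measurable[OF gi])
  define lev where "lev n x = (if cmod (f x) \<le> real n then 1 else 0 :: complex)" for n x
  have levm [measurable]: "lev n \<in> borel_measurable mu" for n unfolding lev_def by measurable
  have cutf: "f x * lev n x = level_cut n f x" for n x by (simp add: lev_def level_cut_def)
  have lev1: "cmod (lev n x) \<le> 1" for n x by (simp add: lev_def)
  have pars: "(\<integral>t. finite_hilbert (\<lambda>x. f x * (lev n x * ps x)) t * g t \<partial>mu) = - (\<integral>t. f t * (lev n t * ps t) * finite_hilbert g t \<partial>mu)"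
    if [measurable]: "ps \<in> borel_measurable mu" and ps1: "\<And>x. cmod (ps x) \<le> 1" for ps n
  proof (rule parseval(3)[OF p _ _ gm gq])
    fix x
    have "cmod (level_cut n f x) * cmod (ps x) \<le> real n * 1" by (intro mult_mono level_cut_bound ps1) auto
    thus "cmod (f x * (lev n x * ps x)) \<le> real n" by (simp add: norm_mult mult.assoc[symmetric] flip: cutf)
  qed measurable
  define C where "C = \<bar>M\<bar> + (\<integral>t. cmod (g t) powr (p / (p - 1)) \<partial>mu)"
  have level: "(\<integral>\<^sup>+t. ennreal (cmod (level_cut n f t * finite_hilbert g t) powr 1) \<partial>mu) \<le> ennreal C" for n
  proof -
    define ps where "ps t = phase (f t * finite_hilbert g t)" for t
    have psm [measurable]: "ps \<in> borel_measurable mu" unfolding ps_def by measurable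
    have ps1: "cmod (ps t) \<le> 1" for t unfolding ps_def by (rule cmod_phase_le)
    have prod: "f t * (lev n t * ps t) * finite_hilbert g t = of_real (cmod (level_cut n f t * finite_hilbert g t))" for t
    proof -
      define z where "z = f t * finite_hilbert g t"
      have "lev n t * (z * ps t) = lev n t * of_real (cmod z)" unfolding ps_def z_def mult_phase ..
      moreover have "lev n t * of_real (cmod z) = of_real (cmod (level_cut n f t * finite_hilbert g t))"
        by (simp add: lev_def level_cut_def z_def)
      moreover have "f t * (lev n t * ps t) * finite_hilbert g t = lev n t * (z * ps t)" by (simp add: z_def mult_ac)
      ultimately show ?thesis by (simp only:)
    qed
    have m1: "cmod (lev n t * ps t) \<le> 1" for t
      using mult_mono[OF lev1[of n t] ps1[of t]] by (simp add: norm_mult)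
    have i: "integrable mu (\<lambda>x. f x * (lev n x * ps x))" by (rule bounded_kernel_integrable(1)[OF f _ m1]) measurable
    note Tm [measurable] = finite_hilbert_measurable[OF i]
    have Mb: "(\<integral>\<^sup>+t. ennreal (cmod (finite_hilbert (\<lambda>x. f x * (lev n x * ps x)) t) powr p) \<partial>mu) \<le> ennreal \<bar>M\<bar>"
      by (rule M'[OF _ m1]) measurable
    note Tp = integrable_powr_bounded[OF Tm Mb]
    have Tgi: "integrable mu (finite_hilbert g)" by (rule parseval(1)[OF p _ _ gm gq, of "\<lambda>_. 0" 0]) auto
    have ci: "integrable mu (\<lambda>t. level_cut n f t * finite_hilbert g t)"
      using bounded_kernel_integrable(1)[OF Tgi level_cut_measurable[OF fm] level_cut_bound] by (simp add: mult.commute)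
    have "(\<integral>t. cmod (level_cut n f t * finite_hilbert g t) \<partial>mu) = cmod (\<integral>t. f t * (lev n t * ps t) * finite_hilbert g t \<partial>mu)"
      unfolding prod by simp
    also have "\<dots> = cmod (\<integral>t. finite_hilbert (\<lambda>x. f x * (lev n x * ps x)) t * g t \<partial>mu)"
      unfolding pars[OF psm ps1] by simp
    also have "\<dots> \<le> (\<integral>t. cmod (finite_hilbert (\<lambda>x. f x * (lev n x * ps x)) t * g t) \<partial>mu)" by (rule integral_norm_bound)
    also have "\<dots> \<le> (\<integral>t. cmod (finite_hilbert (\<lambda>x. f x * (lev n x * ps x)) t) powr p + cmod (g t) powr (p / (p - 1)) \<partial>mu)"
      by (intro integral_mono integrable_norm integrable_product[OF Tm gm Tp gq p] Bochner_Integration.integrable_add Tp gq)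
         (simp add: norm_mult young_powr p)
    also have "\<dots> = (\<integral>t. cmod (finite_hilbert (\<lambda>x. f x * (lev n x * ps x)) t) powr p \<partial>mu) + (\<integral>t. cmod (g t) powr (p / (p - 1)) \<partial>mu)"
      by (rule Bochner_Integration.integral_add[OF Tp gq])
    also have "\<dots> \<le> C" unfolding C_def using integral_powr_bounded[OF Tm Mb] by simp
    finally show ?thesis using nn_integral_eq_integral[OF integrable_norm[OF ci]] by (simp add: ennreal_leI)
  qed
  show fTg: "integrable mu (\<lambda>t. f t * finite_hilbert g t)"
  proof (rule integrableI_bounded)
    have "(\<integral>\<^sup>+t. ennreal (cmod (f t * finite_hilbert g t) powr 1) \<partial>mu) \<le> ennreal C"
    proof (rule fatou_powr[OF _ _ level])
      show "AE t in mu. (\<lambda>n. level_cut n f t * finite_hilbert g t) \<longlonglongrightarrow> f t * finite_hilbert g t"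
        by (intro AE_I2 tendsto_intros level_cut_tendsto)
    qed auto
    thus "(\<integral>\<^sup>+t. ennreal (norm (f t * finite_hilbert g t)) \<partial>mu) < \<infinity>" by (auto intro: le_less_trans)
  qed measurable
  assume phm [measurable]: "ph \<in> borel_measurable mu" and ph1: "\<And>x. cmod (ph x) \<le> 1"
  have m1: "cmod (lev n t * ph t) \<le> 1" for n t
    using mult_mono[OF lev1[of n t] ph1[of t]] by (simp add: norm_mult)
  have i: "integrable mu (\<lambda>x. f x * (lev n x * ph x))" for n by (rule bounded_kernel_integrable(1)[OF f _ m1]) measurable
  have iph: "integrable mu (\<lambda>x. f x * ph x)" by (rule bounded_kernel_integrable(1)[OF f phm ph1])
  have rhs: "(\<lambda>n. \<integral>t. f t * (lev n t * ph t) * finite_hilbert g t \<partial>mu) \<longlonglongrightarrow> (\<integral>t. f t * ph t * finite_hilbert g t \<partial>mu)"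
  proof (rule integral_dominated_convergence[OF _ _ integrable_norm[OF fTg]])
    show "AE t in mu. (\<lambda>n. f t * (lev n t * ph t) * finite_hilbert g t) \<longlonglongrightarrow> f t * ph t * finite_hilbert g t"
    proof (rule AE_I2)
      fix t
      have "(\<lambda>n. level_cut n f t * ph t * finite_hilbert g t) \<longlonglongrightarrow> f t * ph t * finite_hilbert g t"
        by (intro tendsto_intros level_cut_tendsto)
      thus "(\<lambda>n. f t * (lev n t * ph t) * finite_hilbert g t) \<longlonglongrightarrow> f t * ph t * finite_hilbert g t"
        by (simp add: mult.assoc[symmetric] flip: cutf)
    qed
    show "AE t in mu. norm (f t * (lev n t * ph t) * finite_hilbert g t) \<le> norm (f t * finite_hilbert g t)" for n
    proof (rule AE_I2)
      fix t
      have "cmod (f t) * cmod (lev n t * ph t) * cmod (finite_hilbert g t) \<le> cmod (f t) * 1 * cmod (finite_hilbert g t)"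
        by (intro mult_mono m1) auto
      thus "norm (f t * (lev n t * ph t) * finite_hilbert g t) \<le> norm (f t * finite_hilbert g t)" by (simp add: norm_mult)
    qed
  qed measurable
  have "(\<lambda>n. \<integral>x. cmod (f x * ph x - f x * (lev n x * ph x)) \<partial>mu) \<longlonglongrightarrow> 0"
  proof (rule tendsto_sandwich[OF _ _ tendsto_const level_cut_L1_tendsto[OF f]])
    show "eventually (\<lambda>n. (\<integral>x. cmod (f x * ph x - f x * (lev n x * ph x)) \<partial>mu) \<le> (\<integral>x. cmod (f x - level_cut n f x) \<partial>mu)) sequentially"
    proof (rule always_eventually, rule allI)
      fix n
      have ci: "integrable mu (level_cut n f)" by (rule integrable_mu_bounded[OF _ level_cut_bound]) measurable
      show "(\<integral>x. cmod (f x * ph x - f x * (lev n x * ph x)) \<partial>mu) \<le> (\<integral>x. cmod (f x - level_cut n f x) \<partial>mu)"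
      proof (rule integral_mono)
        fix x
        have "cmod (f x * ph x - f x * (lev n x * ph x)) = cmod (f x - level_cut n f x) * cmod (ph x)"
          by (simp add: norm_mult[symmetric] left_diff_distrib mult.assoc flip: cutf)
        also have "\<dots> \<le> cmod (f x - level_cut n f x) * 1" by (intro mult_left_mono ph1) simp
        finally show "cmod (f x * ph x - f x * (lev n x * ph x)) \<le> cmod (f x - level_cut n f x)" by simp
      qed (use i iph f ci in auto)
    qed
  qed simp
  then obtain r :: "nat \<Rightarrow> nat" where r: "strict_mono r"
    "AE t in mu. (\<lambda>n. finite_hilbert (\<lambda>x. f x * (lev (r n) x * ph x)) t) \<longlonglongrightarrow> finite_hilbert (\<lambda>x. f x * ph x) t"
    by (rule finite_hilbert_AE_subsequence_limit[OF i iph])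
  have "(\<lambda>n. \<integral>t. finite_hilbert (\<lambda>x. f x * (lev (r n) x * ph x)) t * g t \<partial>mu) \<longlonglongrightarrow> (\<integral>t. finite_hilbert (\<lambda>x. f x * ph x) t * g t \<partial>mu)"
    by (rule weak_limit_of_bounded_sequence[OF finite_hilbert_measurable[OF i] finite_hilbert_measurable[OF iph] gm p gq M'[OF _ m1] r(2)]) measurable
  moreover have "(\<lambda>n. \<integral>t. finite_hilbert (\<lambda>x. f x * (lev (r n) x * ph x)) t * g t \<partial>mu) \<longlonglongrightarrow> - (\<integral>t. f t * ph t * finite_hilbert g t \<partial>mu)"
    unfolding pars[OF phm ph1]
    using tendsto_minus[OF LIMSEQ_subseq_LIMSEQ[OF rhs r(1)]] by (simp add: o_def)
  ultimately show "(\<integral>t. finite_hilbert (\<lambda>x. f x * ph x) t * g t \<partial>mu) = - (\<integral>t. f t * ph t * finite_hilbert g t \<partial>mu)"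
    by (rule LIMSEQ_unique)
qed

section \<open>Scalar integrals of functions in the optimal domain\<close>

lemma Lp_iff: "f \<in> Lp p \<longleftrightarrow> f \<in> borel_measurable mu \<and> integrable mu (\<lambda>x. cmod (f x) powr p)"
  by (simp add: Lp_def L0_def)

lemma optimal_domain_dominated:
  assumes "f \<in> optimal_domain X" "h \<in> borel_measurable mu" "AE x in mu. cmod (h x) \<le> cmod (f x)"
  shows "finite_hilbert h \<in> X"
  using assms by (auto simp: optimal_domain_def L0_def)

text \<open>Parseval's formula for indicators identifies the scalar measure as the one with density
  \<open>- T g\<close>.\<close>

lemma optimal_domain_scalar_integral:
  assumes f: "f \<in> optimal_domain X" and p: "p \<in> J X" and g: "g \<in> Lp (conjugate_exponent p)"
  shows "cmeasure_integrable (m_hat_scalar g) f"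
    and "A \<in> sets mu \<Longrightarrow> pairing (finite_hilbert (\<lambda>x. f x * indicator A x)) g = cmeasure_integral (m_hat_scalar g) A f"
proof -
  have p1: "1 < p" and Xp: "X \<subseteq> Lp p" using p by (auto simp: J_def)
  have fi: "integrable mu f" using f by (simp add: optimal_domain_def)
  have gm: "g \<in> borel_measurable mu" and gq: "integrable mu (\<lambda>t. cmod (g t) powr (p / (p - 1)))"
    using g by (auto simp: Lp_iff conjugate_exponent_def)
  have dom: "integrable mu (\<lambda>t. cmod (finite_hilbert h t) powr p)"
    if "h \<in> borel_measurable mu" "AE x in mu. cmod (h x) \<le> cmod (f x)" for h
    using optimal_domain_dominated[OF f that] Xp by (auto simp: Lp_iff)
  have im: "(indicator A :: real \<Rightarrow> complex) \<in> borel_measurable mu" if "A \<in> sets mu" for A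
    using that by measurable
  have i1: "cmod (indicator A x) \<le> 1" for A and x :: real by (simp add: indicator_def)
  note ps = parseval[OF p1 im i1 gm gq]
  have w: "integrable mu (\<lambda>x. - finite_hilbert g x)" using ps(1)[of "{}"] by simp
  have nu: "m_hat_scalar g A = (\<integral>x. indicator A x * - finite_hilbert g x \<partial>mu)" if "A \<in> sets mu" for A
    using ps(3)[OF that] by (simp add: m_hat_scalar_def m_hat_def pairing_def)
  have "integrable mu (\<lambda>x. f x * finite_hilbert g x)"
    by (rule optimal_domain_duality(1)[OF p1 fi _ gm gq]) (rule dom)
  hence fw: "integrable mu (\<lambda>x. f x * - finite_hilbert g x)" by simp
  note cd = cmeasure_density[OF w nu borel_measurable_integrable[OF fi] fw]
  show "cmeasure_integrable (m_hat_scalar g) f" by (rule cd(1))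
  assume A: "A \<in> sets mu"
  show "pairing (finite_hilbert (\<lambda>x. f x * indicator A x)) g = cmeasure_integral (m_hat_scalar g) A f"
  proof -
    have "(\<integral>x. finite_hilbert (\<lambda>x. f x * indicator A x) x * g x \<partial>mu) = - (\<integral>x. f x * indicator A x * finite_hilbert g x \<partial>mu)"
      by (rule optimal_domain_duality(2)[OF p1 fi _ gm gq im[OF A] i1]) (rule dom)
    thus ?thesis unfolding pairing_def using cd(2)[OF _ A] by simp
  qed
qed

lemma bounded_in_Lp:
  assumes "g \<in> borel_measurable mu" "\<And>x. cmod (g x) \<le> 1" "0 < q"
  shows "g \<in> Lp q"
  unfolding Lp_iff
  by (intro conjI assms(1) mu.integrable_const_bound[where B = 1])
     (use assms powr_mono2[of q _ 1] in \<open>auto intro!: AE_I2\<close>)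

text \<open>Test with the phase of the difference, which is bounded and therefore in the dual.\<close>

lemma pairing_separates_points:
  assumes p: "p \<in> J X" and h: "h \<in> X_hat X" "h' \<in> X_hat X"
    and eq: "\<And>g. g \<in> X_hat_dual X \<Longrightarrow> pairing h g = pairing h' g"
  shows "AE x in mu. h' x = h x"
proof -
  have p1: "1 < p" using p by (auto simp: J_def)
  have hp: "h \<in> Lp p" "h' \<in> Lp p" using h p by (auto simp: X_hat_def)
  have hm [measurable]: "h \<in> borel_measurable mu" "h' \<in> borel_measurable mu" using hp by (auto simp: Lp_iff)
  have hi: "integrable mu h" "integrable mu h'"
    using hp p1 by (auto simp: Lp_iff intro: integrable_of_powr)
  define g where "g x = phase (h' x - h x)" for x
  have gm [measurable]: "g \<in> borel_measurable mu" unfolding g_def by measurable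
  have g1: "cmod (g x) \<le> 1" for x unfolding g_def by (rule cmod_phase_le)
  have "g \<in> Lp (conjugate_exponent p)"
    by (rule bounded_in_Lp[OF gm g1]) (use p1 in \<open>simp add: conjugate_exponent_def\<close>)
  hence "pairing h g = pairing h' g" using p by (intro eq) (auto simp: X_hat_dual_def)
  hence "(\<integral>x. h' x * g x - h x * g x \<partial>mu) = 0"
    using bounded_kernel_integrable(1)[OF hi(1) gm g1] bounded_kernel_integrable(1)[OF hi(2) gm g1]
    by (simp add: pairing_def)
  moreover have "h' x * g x - h x * g x = of_real (cmod (h' x - h x))" for x
    unfolding g_def left_diff_distrib[symmetric] by (rule mult_phase)
  ultimately have "(\<integral>x. cmod (h' x - h x) \<partial>mu) = 0" by simp
  hence "AE x in mu. cmod (h' x - h x) = 0"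
    using hi by (subst (asm) integral_nonneg_eq_0_iff_AE) auto
  thus ?thesis by eventually_elim simp
qed

section \<open>Symmetric decreasing rearrangement\<close>

lemma level_set_measurable:
  assumes [measurable]: "f \<in> borel_measurable mu"
  shows "{x \<in> space mu. l < cmod (f x)} \<in> sets mu"
  by measurable

lemma distribution_function_antimono:
  assumes "f \<in> borel_measurable mu" "l \<le> k"
  shows "distribution_function f k \<le> distribution_function f l"
  unfolding distribution_function_def
  by (rule mu.finite_measure_mono[OF _ level_set_measurable[OF assms(1)]]) (use assms(2) in auto)

lemma distribution_function_bounds: "0 \<le> distribution_function f l" "distribution_function f l \<le> 2"
proof -
  have "measure mu {x \<in> space mu. l < cmod (f x)} \<le> measure mu (space mu)"
    by (rule mu.bounded_measure)
  also have "\<dots> = 2" by (simp add: measure_def emeasure_mu)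
  finally show "distribution_function f l \<le> 2" by (simp add: distribution_function_def)
qed (simp add: distribution_function_def)

lemma distribution_function_right_continuous:
  assumes f: "f \<in> borel_measurable mu" and le: "\<And>k. l < k \<Longrightarrow> distribution_function f k \<le> c"
  shows "distribution_function f l \<le> c"
proof -
  let ?A = "\<lambda>n::nat. {x \<in> space mu. l + inverse (real (Suc n)) < cmod (f x)}"
  have "(\<lambda>n. measure mu (?A n)) \<longlonglongrightarrow> measure mu (\<Union>n. ?A n)"
  proof (rule mu.finite_Lim_measure_incseq)
    show "incseq ?A"
    proof (rule incseq_SucI)
      fix n
      have "inverse (real (Suc (Suc n))) \<le> inverse (real (Suc n))" by (intro le_imp_inverse_le) auto
      hence "l + inverse (real (Suc n)) < c \<Longrightarrow> l + inverse (real (Suc (Suc n))) < c" for c by linarith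
      thus "?A n \<subseteq> ?A (Suc n)" by blast
    qed
  qed (use level_set_measurable[OF f] in blast)
  also have "(\<Union>n. ?A n) = {x \<in> space mu. l < cmod (f x)}"
  proof (intro equalityI subsetI)
    fix x assume x: "x \<in> {x \<in> space mu. l < cmod (f x)}"
    then obtain n where "inverse (real (Suc n)) < cmod (f x) - l" using reals_Archimedean[of "cmod (f x) - l"] by auto
    thus "x \<in> (\<Union>n. ?A n)" using x by (auto simp: algebra_simps simp del: of_nat_Suc intro!: exI[of _ n])
  next
    fix x assume "x \<in> (\<Union>n. ?A n)"
    then obtain n where "x \<in> space mu" "l + inverse (real (Suc n)) < cmod (f x)" by auto
    moreover have "0 < inverse (real (Suc n))" by simp
    ultimately have "x \<in> space mu" "l < cmod (f x)" by linarith+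
    thus "x \<in> {x \<in> space mu. l < cmod (f x)}" by blast
  qed
  finally have "(\<lambda>n. distribution_function f (l + inverse (real (Suc n)))) \<longlonglongrightarrow> distribution_function f l"
    by (simp add: distribution_function_def)
  moreover have "distribution_function f (l + inverse (real (Suc n))) \<le> c" for n by (rule le) simp
  ultimately show ?thesis by (intro LIMSEQ_le_const2) auto
qed

lemma distribution_function_eventually_small:
  assumes f: "f \<in> borel_measurable mu" and c: "0 < c"
  shows "\<exists>l\<ge>0. distribution_function f l \<le> c"
proof -
  let ?A = "\<lambda>n::nat. {x \<in> space mu. real n < cmod (f x)}"
  have "(\<lambda>n. measure mu (?A n)) \<longlonglongrightarrow> measure mu (\<Inter>n. ?A n)"
    by (rule mu.finite_Lim_measure_decseq) (use level_set_measurable[OF f] in \<open>auto simp: decseq_def\<close>)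
  also have "(\<Inter>n. ?A n) = {}"
  proof -
    have "\<exists>n. \<not> real n < cmod (f x)" for x using reals_Archimedean2[of "cmod (f x)"] less_asym by blast
    thus ?thesis by blast
  qed
  finally have "(\<lambda>n. measure mu (?A n)) \<longlonglongrightarrow> 0" by simp
  hence "eventually (\<lambda>n. measure mu (?A n) < c) sequentially" using c by (rule order_tendstoD(2))
  then obtain n where "measure mu (?A n) < c" using eventually_happens'[OF sequentially_bot] by blast
  thus ?thesis by (intro exI[of _ "real n"]) (simp add: distribution_function_def)
qed

text \<open>The even function, decreasing in \<open>|x|\<close> away from the origin, whose distribution function is that
  of \<open>f\<close>. At the origin the set of levels may be empty, and the value there is set to 0.\<close>

definition symmetric_rearrangement :: "(real \<Rightarrow> complex) \<Rightarrow> real \<Rightarrow> real" where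
  "symmetric_rearrangement f x =
     (if x = 0 then 0 else Inf {l. 0 \<le> l \<and> distribution_function f l \<le> 2 * \<bar>x\<bar>})"

lemma symmetric_rearrangement_nonneg:
  assumes "f \<in> borel_measurable mu"
  shows "0 \<le> symmetric_rearrangement f x"
proof (cases "x = 0")
  case False
  hence "\<exists>l\<ge>0. distribution_function f l \<le> 2 * \<bar>x\<bar>"
    by (intro distribution_function_eventually_small assms) simp
  thus ?thesis using False by (auto simp: symmetric_rearrangement_def intro!: cInf_greatest)
qed (simp add: symmetric_rearrangement_def)

lemma symmetric_rearrangement_greater_iff:
  assumes f: "f \<in> borel_measurable mu" and l: "0 \<le> l"
  shows "l < symmetric_rearrangement f x \<longleftrightarrow> x \<noteq> 0 \<and> 2 * \<bar>x\<bar> < distribution_function f l"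
proof (cases "x = 0")
  case False
  let ?S = "{l. 0 \<le> l \<and> distribution_function f l \<le> 2 * \<bar>x\<bar>}"
  have ne: "?S \<noteq> {}" using distribution_function_eventually_small[OF f, of "2 * \<bar>x\<bar>"] False by auto
  have bdd: "bdd_below ?S" by (rule bdd_belowI[of _ 0]) auto
  have r: "symmetric_rearrangement f x = Inf ?S" using False by (simp add: symmetric_rearrangement_def)
  have InfS: "distribution_function f (Inf ?S) \<le> 2 * \<bar>x\<bar>"
  proof (rule distribution_function_right_continuous[OF f])
    fix k assume "Inf ?S < k"
    then obtain s where "s \<in> ?S" "s < k" using cInf_lessD[OF ne] by blast
    thus "distribution_function f k \<le> 2 * \<bar>x\<bar>" using distribution_function_antimono[OF f, of s k] by auto
  qed
  show ?thesis
  proof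
    assume "l < symmetric_rearrangement f x"
    hence "l \<notin> ?S" using cInf_lower[OF _ bdd, of l] unfolding r by auto
    thus "x \<noteq> 0 \<and> 2 * \<bar>x\<bar> < distribution_function f l" using l False by auto
  next
    assume d: "x \<noteq> 0 \<and> 2 * \<bar>x\<bar> < distribution_function f l"
    show "l < symmetric_rearrangement f x"
    proof (rule ccontr)
      assume "\<not> ?thesis"
      hence "Inf ?S \<le> l" unfolding r by simp
      from distribution_function_antimono[OF f this] InfS d show False by simp
    qed
  qed
qed (use l in \<open>simp add: symmetric_rearrangement_def\<close>)

lemma symmetric_rearrangement_measurable [measurable]:
  assumes f: "f \<in> borel_measurable mu"
  shows "symmetric_rearrangement f \<in> borel_measurable borel"
  unfolding borel_measurable_iff_greater
proof
  fix a
  show "{w \<in> space borel. a < symmetric_rearrangement f w} \<in> sets borel"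
  proof (cases "0 \<le> a")
    case True
    have "{w. w \<noteq> 0 \<and> 2 * \<bar>w\<bar> < distribution_function f a} \<in> sets borel" by measurable
    thus ?thesis by (simp add: symmetric_rearrangement_greater_iff[OF f True])
  next
    case False
    hence "a < symmetric_rearrangement f w" for w
      using symmetric_rearrangement_nonneg[OF f, of w] by linarith
    thus ?thesis by simp
  qed
qed

lemma measure_symmetric_interval:
  assumes "0 \<le> c"
  shows "measure mu {x \<in> space mu. x \<noteq> 0 \<and> 2 * \<bar>x\<bar> < c} = min 2 c"
    and "measure mu {x \<in> space mu. 0 < x \<and> 2 * \<bar>x\<bar> < c} = min 1 (c / 2)"
    and "measure mu {x \<in> space mu. x < 0 \<and> 2 * \<bar>x\<bar> < c} = min 1 (c / 2)"
proof -
  define b where "b = min 1 (c / 2)"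
  have b: "0 \<le> b" "b \<le> 1" using assms by (auto simp: b_def)
  have m: "measure mu A = measure lborel A" if "A \<subseteq> {-1<..<1}" for A
    using that by (simp add: measure_def emeasure_mu)
  have s: "{x \<in> space mu. 0 < x \<and> 2 * \<bar>x\<bar> < c} = {0<..<b}" "{x \<in> space mu. x < 0 \<and> 2 * \<bar>x\<bar> < c} = {-b<..<0}"
    by (auto simp: b_def min_def split: if_splits)
  show p: "measure mu {x \<in> space mu. 0 < x \<and> 2 * \<bar>x\<bar> < c} = min 1 (c / 2)"
    unfolding s using b by (subst m) (auto simp: b_def)
  show n: "measure mu {x \<in> space mu. x < 0 \<and> 2 * \<bar>x\<bar> < c} = min 1 (c / 2)"
    unfolding s using b by (subst m) (auto simp: b_def)
  have "{x \<in> space mu. x \<noteq> 0 \<and> 2 * \<bar>x\<bar> < c} = {0<..<b} \<union> {-b<..<0}"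
    unfolding s[symmetric] by auto
  moreover have "measure mu ({0<..<b} \<union> {-b<..<0}) = measure mu {0<..<b} + measure mu {-b<..<0}"
    by (rule mu.finite_measure_Union) (use b in \<open>auto simp: sets_mu\<close>)
  ultimately have "measure mu {x \<in> space mu. x \<noteq> 0 \<and> 2 * \<bar>x\<bar> < c} = b + b"
    using p n unfolding s b_def by simp
  thus "measure mu {x \<in> space mu. x \<noteq> 0 \<and> 2 * \<bar>x\<bar> < c} = min 2 c" by (auto simp: b_def min_def)
qed

section \<open>Dilations of a rearrangement invariant space\<close>

lemma order_idealD:
  assumes "order_ideal X"
  shows "f \<in> X \<Longrightarrow> f \<in> borel_measurable mu"
    and "f \<in> X \<Longrightarrow> g \<in> X \<Longrightarrow> (\<lambda>x. f x + g x) \<in> X"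
    and "f \<in> X \<Longrightarrow> (\<lambda>x. c * f x) \<in> X"
    and "f \<in> X \<Longrightarrow> g \<in> borel_measurable mu \<Longrightarrow> AE x in mu. cmod (g x) \<le> cmod (f x) \<Longrightarrow> g \<in> X"
    and "(\<lambda>x. 0) \<in> X"
  using assms by (auto simp: order_ideal_def L0_def)

lemma lattice_normD:
  assumes "lattice_norm X N"
  shows "f \<in> X \<Longrightarrow> 0 \<le> N f"
    and "f \<in> X \<Longrightarrow> N f = 0 \<longleftrightarrow> (AE x in mu. f x = 0)"
    and "f \<in> X \<Longrightarrow> N (\<lambda>x. c * f x) = cmod c * N f"
    and "f \<in> X \<Longrightarrow> g \<in> X \<Longrightarrow> N (\<lambda>x. f x + g x) \<le> N f + N g"
    and "f \<in> X \<Longrightarrow> g \<in> X \<Longrightarrow> AE x in mu. cmod (g x) \<le> cmod (f x) \<Longrightarrow> N g \<le> N f"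
  using assms by (auto simp: lattice_norm_def)

lemma rearrangement_invariantD:
  assumes ri: "rearrangement_invariant X N" and f: "f \<in> X" and g: "g \<in> borel_measurable mu"
    and le: "\<And>l. 0 \<le> l \<Longrightarrow> distribution_function g l \<le> distribution_function f l"
  shows "g \<in> X"
proof -
  have "decreasing_rearrangement g t \<le> decreasing_rearrangement f t" for t
    unfolding decreasing_rearrangement_def
    by (rule Inf_superset_mono) (use le in \<open>force intro: order_trans\<close>)
  thus ?thesis using ri f g unfolding rearrangement_invariant_def L0_def by blast
qed

lemma dilation_measurable:
  assumes f: "f \<in> borel_measurable mu" and s: "1 \<le> s"
  shows "(\<lambda>x. f (x / s)) \<in> borel_measurable mu"
proof -
  have "(\<lambda>x. x / s) \<in> mu \<rightarrow>\<^sub>M mu"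
    unfolding mu_def
  proof (rule measurable_restrict_space2)
    show "(\<lambda>x. x / s) \<in> restrict_space lborel {- 1<..<1} \<rightarrow>\<^sub>M lborel"
      by (rule measurable_restrict_space1) simp
    have "-1 < x / s \<and> x / s < 1" if "-1 < x" "x < 1" for x
      using that s by (auto simp: field_simps)
    thus "(\<lambda>x. x / s) \<in> space (restrict_space lborel {- 1<..<1}) \<rightarrow> {- 1<..<1}" by (auto simp: space_restrict_space)
  qed
  from measurable_compose[OF this f] show ?thesis .
qed

lemma distribution_function_dilation:
  assumes f: "f \<in> borel_measurable mu" and s: "1 \<le> s"
  shows "distribution_function (\<lambda>x. f (x / s)) l \<le> min 2 (s * distribution_function f l)"
proof -
  let ?B = "{x \<in> space mu. l < cmod (f x)}" and ?A = "{x \<in> space mu. l < cmod (f (x / s))}"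
  have B: "?B \<in> sets borel"
    using level_set_measurable[OF f, of l] unfolding sets_mu by (rule conjunct1)
  have A: "?A \<in> sets borel"
    using level_set_measurable[OF dilation_measurable[OF f s], of l] unfolding sets_mu by (rule conjunct1)
  have em: "emeasure mu C = (\<integral>\<^sup>+x. indicator C x \<partial>lborel)" if "C \<in> sets borel" "C \<subseteq> space mu" for C
    using that emeasure_mu[of C] by simp
  have "emeasure mu ?A = (\<integral>\<^sup>+x. indicator ?A x \<partial>lborel)" by (rule em[OF A]) blast
  also have "\<dots> = ennreal \<bar>s\<bar> * (\<integral>\<^sup>+x. indicator ?A (0 + s * x) \<partial>lborel)"
    by (rule nn_integral_real_affine[OF borel_measurable_indicator[OF A]]) (use s in simp)
  also have "\<dots> \<le> ennreal s * (\<integral>\<^sup>+x. indicator ?B x \<partial>lborel)"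
  proof (intro mult_mono nn_integral_mono)
    fix x
    have "-1 < x \<and> x < 1" if "-1 < s * x" "s * x < 1"
    proof -
      have "\<bar>s * x\<bar> < 1" using that by auto
      moreover have "1 * \<bar>x\<bar> \<le> s * \<bar>x\<bar>" using s by (intro mult_right_mono) auto
      ultimately have "\<bar>x\<bar> < 1" using s by (simp add: abs_mult)
      thus ?thesis by auto
    qed
    thus "(indicator ?A (0 + s * x) :: ennreal) \<le> indicator ?B x" using s by (auto simp: indicator_def)
  qed (use s in auto)
  also have "\<dots> = ennreal s * emeasure mu ?B" by (subst em[OF B]) auto
  finally have "ennreal (measure mu ?A) \<le> ennreal (s * measure mu ?B)"
    using s by (simp add: mu.emeasure_eq_measure ennreal_mult)
  hence "measure mu ?A \<le> s * measure mu ?B" using s by (subst (asm) ennreal_le_iff) auto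
  thus ?thesis using distribution_function_bounds(2)[of "\<lambda>x. f (x / s)" l] by (simp add: distribution_function_def)
qed

text \<open>The dilated rearrangement is even, so for a factor of at most two each half of it is dominated in
  distribution by the original function.\<close>

lemma small_dilation_in_ri_space:
  assumes ri: "rearrangement_invariant X N" and f: "f \<in> X" and s: "1 \<le> s" "s \<le> 2"
  shows "(\<lambda>x. f (x / s)) \<in> X"
proof -
  have oi: "order_ideal X" using ri by (simp add: rearrangement_invariant_def banach_function_space_def)
  have fm: "f \<in> borel_measurable mu" by (rule order_idealD(1)[OF oi f])
  let ?d = "distribution_function f"
  define h where "h x = complex_of_real (symmetric_rearrangement f (x / s))" for x
  have hm: "h \<in> borel_measurable borel"
    unfolding h_def using measurable_compose[OF _ symmetric_rearrangement_measurable[OF fm], of "\<lambda>x. x / s" borel] by simp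
  have level: "l < cmod (h x) \<longleftrightarrow> x \<noteq> 0 \<and> 2 * \<bar>x\<bar> < s * ?d l" if "0 \<le> l" for l x
  proof -
    have "l < cmod (h x) \<longleftrightarrow> l < symmetric_rearrangement f (x / s)"
      using symmetric_rearrangement_nonneg[OF fm, of "x / s"] by (simp add: h_def)
    also have "\<dots> \<longleftrightarrow> x / s \<noteq> 0 \<and> 2 * \<bar>x / s\<bar> < ?d l" by (rule symmetric_rearrangement_greater_iff[OF fm that])
    also have "\<dots> \<longleftrightarrow> x \<noteq> 0 \<and> 2 * \<bar>x\<bar> < s * ?d l" using s by (auto simp: abs_div field_simps)
    finally show ?thesis .
  qed
  define h1 h2 where "h1 x = (if 0 < x then h x else 0)" and "h2 x = (if x < 0 then h x else 0)" for x
  have "h1 \<in> borel_measurable borel" "h2 \<in> borel_measurable borel" unfolding h1_def h2_def using hm by measurable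
  hence h12m: "h1 \<in> borel_measurable mu" "h2 \<in> borel_measurable mu" by (auto intro: borel_measurable_mu)
  have sd: "0 \<le> s * ?d l" "min 1 (s * ?d l / 2) \<le> ?d l" for l
    using s distribution_function_bounds(1)[of f l] mult_right_mono[of s 2 "?d l"] by (auto simp: min_def)
  have "h1 \<in> X"
  proof (rule rearrangement_invariantD[OF ri f h12m(1)])
    fix l :: real assume l: "0 \<le> l"
    have "l < cmod (h1 x) \<longleftrightarrow> 0 < x \<and> 2 * \<bar>x\<bar> < s * ?d l" for x
    proof (cases "0 < x")
      case True
      thus ?thesis using level[OF l, of x] by (simp only: h1_def if_True) simp
    next
      case False
      thus ?thesis using l by (simp add: h1_def)
    qed
    thus "distribution_function h1 l \<le> ?d l"
      using measure_symmetric_interval(2)[OF sd(1)] sd(2) by (simp add: distribution_function_def)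
  qed
  moreover have "h2 \<in> X"
  proof (rule rearrangement_invariantD[OF ri f h12m(2)])
    fix l :: real assume l: "0 \<le> l"
    have "l < cmod (h2 x) \<longleftrightarrow> x < 0 \<and> 2 * \<bar>x\<bar> < s * ?d l" for x
    proof (cases "x < 0")
      case True
      thus ?thesis using level[OF l, of x] by (simp only: h2_def if_True) simp
    next
      case False
      thus ?thesis using l by (simp add: h2_def)
    qed
    thus "distribution_function h2 l \<le> ?d l"
      using measure_symmetric_interval(3)[OF sd(1)] sd(2) by (simp add: distribution_function_def)
  qed
  ultimately have "(\<lambda>x. h1 x + h2 x) \<in> X" by (rule order_idealD(2)[OF oi])
  moreover have "(\<lambda>x. h1 x + h2 x) = h"
  proof
    fix x show "h1 x + h2 x = h x" by (cases x "0 :: real" rule: linorder_cases)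
       (auto simp: h1_def h2_def h_def symmetric_rearrangement_def)
  qed
  ultimately have hX: "h \<in> X" by simp
  show ?thesis
  proof (rule rearrangement_invariantD[OF ri hX dilation_measurable[OF fm s(1)]])
    fix l :: real assume l: "0 \<le> l"
    have "distribution_function h l = min 2 (s * ?d l)"
      using measure_symmetric_interval(1)[OF sd(1), of l] level[OF l] by (simp add: distribution_function_def)
    thus "distribution_function (\<lambda>x. f (x / s)) l \<le> distribution_function h l"
      using distribution_function_dilation[OF fm s(1), of l] by simp
  qed
qed

text \<open>Iterate dilations of factor at most two.\<close>

lemma dilation_in_ri_space:
  assumes ri: "rearrangement_invariant X N" and f: "f \<in> X" and s: "1 \<le> s"
  shows "(\<lambda>x. f (x / s)) \<in> X"
proof -
  obtain n where "s < 2 ^ n" using real_arch_pow[of 2 s] by auto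
  hence "s \<le> 2 ^ n" by simp
  thus ?thesis using f s
  proof (induction n arbitrary: s f)
    case 0
    hence "s = 1" by simp
    thus ?case using 0 by simp
  next
    case (Suc n)
    show ?case
    proof (cases "s \<le> 2")
      case True
      thus ?thesis using small_dilation_in_ri_space[OF ri Suc.prems(2,3)] by simp
    next
      case False
      have "(\<lambda>x. f (x / (s / 2))) \<in> X" using Suc False by (intro Suc.IH) auto
      from small_dilation_in_ri_space[OF ri this, of 2] show ?thesis by simp
    qed
  qed
qed

lemma symmetric_rearrangement_in_ri_space:
  assumes ri: "rearrangement_invariant X N" and f: "f \<in> X"
  shows "(\<lambda>x. complex_of_real (symmetric_rearrangement f x)) \<in> X"
proof (rule rearrangement_invariantD[OF ri f])
  have fm: "f \<in> borel_measurable mu"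
    using ri f by (auto simp: rearrangement_invariant_def banach_function_space_def intro: order_idealD(1))
  show "(\<lambda>x. complex_of_real (symmetric_rearrangement f x)) \<in> borel_measurable mu"
    using symmetric_rearrangement_measurable[OF fm] by (intro borel_measurable_mu) simp
  fix l :: real assume l: "0 \<le> l"
  have "{x \<in> space mu. l < cmod (complex_of_real (symmetric_rearrangement f x))} = {x \<in> space mu. x \<noteq> 0 \<and> 2 * \<bar>x\<bar> < distribution_function f l}"
    using symmetric_rearrangement_greater_iff[OF fm l] symmetric_rearrangement_nonneg[OF fm] by auto
  thus "distribution_function (\<lambda>x. complex_of_real (symmetric_rearrangement f x)) l \<le> distribution_function f l"
    using measure_symmetric_interval(1)[OF distribution_function_bounds(1)[of f l]] by (simp add: distribution_function_def)
qed

lemma AE_mu_dilation: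
  assumes ae: "AE x in mu. P x" and s: "1 \<le> s"
  shows "AE x in mu. P (x / s)"
proof -
  obtain Z where Z: "Z \<in> null_sets lborel" "{x. \<not> (x \<in> {-1<..<1} \<longrightarrow> P x)} \<subseteq> Z"
  proof -
    from ae[unfolded AE_mu_iff] obtain Z where "{x \<in> space lborel. \<not> (x \<in> {-1<..<1} \<longrightarrow> P x)} \<subseteq> Z"
      "emeasure lborel Z = 0" "Z \<in> sets lborel" by (rule AE_E)
    thus ?thesis by (intro that[of Z] null_setsI) simp_all
  qed
  have "AE x in lborel. x \<notin> Z" by (rule AE_not_in[OF Z(1)])
  hence "AE x in lborel. 0 + (1 / s) * x \<notin> Z"
    using s Z(1) by (intro AE_borel_affine) auto
  thus ?thesis unfolding AE_mu_iff
  proof eventually_elim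
    case (elim x)
    show ?case
    proof
      assume "x \<in> {-1<..<1}"
      hence "x / s \<in> {-1<..<1}" using s by (auto simp: field_simps)
      thus "P (x / s)" using elim Z(2) by auto
    qed
  qed
qed

text \<open>Positive operators on a Banach function space are automatically bounded: if the images of unit
  vectors \<open>f n\<close> grew like \<open>4\<^sup>n\<close>, the image of the sum of the functions \<open>2\<^sup>-\<^sup>n |f n|\<close>, which converges by
  completeness, would dominate all of them, scaled by \<open>2\<^sup>-\<^sup>n\<close>.\<close>

lemma dilation_bounded:
  assumes ri: "rearrangement_invariant X N" and s: "1 \<le> s"
  shows "\<exists>C. \<forall>f\<in>X. N f \<le> 1 \<longrightarrow> N (\<lambda>x. f (x / s)) \<le> C"
proof (rule ccontr)
  have oi: "order_ideal X" and ln: "lattice_norm X N" and nc: "norm_complete X N"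
    using ri by (auto simp: rearrangement_invariant_def banach_function_space_def)
  note oi = order_idealD[OF oi] and ln = lattice_normD[OF ln]
  have dil: "(\<lambda>x. f (x / s)) \<in> X" if "f \<in> X" for f by (rule dilation_in_ri_space[OF ri that s])
  assume "\<not> ?thesis"
  hence "\<exists>f\<in>X. N f \<le> 1 \<and> C < N (\<lambda>x. f (x / s))" for C by (meson not_le)
  hence "\<exists>f\<in>X. N f \<le> 1 \<and> 4 ^ n < N (\<lambda>x. f (x / s))" for n :: nat .
  then obtain f where f: "\<And>n. f n \<in> X" "\<And>n. N (f n) \<le> 1" "\<And>n::nat. 4 ^ n < N (\<lambda>x. f n (x / s))" by metis
  define g where "g n x = (1/2) ^ n * cmod (f n x)" for n x
  have g0: "0 \<le> g n x" for n x by (simp add: g_def)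
  have fm [measurable]: "f n \<in> borel_measurable mu" for n by (rule oi(1)[OF f(1)])
  have gm [measurable]: "g n \<in> borel_measurable mu" for n unfolding g_def by measurable
  have cfX: "(\<lambda>x. complex_of_real ((1/2) ^ n) * f n x) \<in> X" for n by (rule oi(3)[OF f(1)])
  have gX: "(\<lambda>x. complex_of_real (g n x)) \<in> X" for n
    by (rule oi(4)[OF cfX]) (auto intro!: AE_I2 simp: g_def norm_mult norm_power)
  have Ng: "N (\<lambda>x. complex_of_real (g n x)) \<le> (1/2) ^ n" for n
  proof -
    have "N (\<lambda>x. complex_of_real (g n x)) \<le> N (\<lambda>x. complex_of_real ((1/2) ^ n) * f n x)"
      by (rule ln(5)[OF cfX gX]) (auto intro!: AE_I2 simp: g_def norm_mult norm_power)
    also have "\<dots> = (1/2) ^ n * N (f n)" unfolding ln(3)[OF f(1)] by (simp add: norm_power)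
    also have "\<dots> \<le> (1/2) ^ n * 1" by (intro mult_left_mono f(2)) auto
    finally show ?thesis by simp
  qed
  define S where "S n x = complex_of_real (\<Sum>k<n. g k x)" for n x
  have SX: "S n \<in> X" for n
  proof (induction n)
    case 0
    show ?case using oi(5) by (simp add: S_def)
  next
    case (Suc n)
    have "S (Suc n) = (\<lambda>x. S n x + complex_of_real (g n x))" by (auto simp: S_def)
    thus ?case using oi(2)[OF Suc gX] by simp
  qed
  have N0: "N (\<lambda>x. 0) = 0" using ln(2)[OF oi(5)] by simp
  have Sd: "(\<lambda>x. S (n + k) x - S n x) \<in> X \<and> N (\<lambda>x. S (n + k) x - S n x) \<le> 2 * (1/2) ^ n - 2 * (1/2) ^ (n + k)" for n k
  proof (induction k)
    case 0
    show ?case using oi(5) N0 by simp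
  next
    case (Suc k)
    have eq: "(\<lambda>x. S (n + Suc k) x - S n x) = (\<lambda>x. (S (n + k) x - S n x) + complex_of_real (g (n + k) x))"
      by (auto simp: S_def)
    have "N (\<lambda>x. (S (n + k) x - S n x) + complex_of_real (g (n + k) x)) \<le> N (\<lambda>x. S (n + k) x - S n x) + N (\<lambda>x. complex_of_real (g (n + k) x))"
      using Suc by (intro ln(4) gX) auto
    also have "\<dots> \<le> (2 * (1/2) ^ n - 2 * (1/2) ^ (n + k)) + (1/2) ^ (n + k)" using Suc Ng by (intro add_mono) auto
    finally show ?case using oi(2)[OF _ gX, of "\<lambda>x. S (n + k) x - S n x" "n + k"] Suc unfolding eq by simp
  qed
  have sym: "N (\<lambda>x. S m x - S n x) = N (\<lambda>x. S n x - S m x)" if "m \<le> n" for m n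
  proof -
    have "(\<lambda>x. S n x - S m x) \<in> X" using Sd[of m "n - m"] that by simp
    from ln(3)[OF this, of "-1"] show ?thesis by simp
  qed
  have cauchy: "\<forall>e>0. \<exists>n0::nat. \<forall>m\<ge>n0. \<forall>n\<ge>n0. N (\<lambda>x. S m x - S n x) < e"
  proof (intro allI impI)
    fix e :: real assume e: "0 < e"
    obtain n0 where n0: "(1/2::real) ^ n0 < e / 2" using real_arch_pow_inv[of "e/2" "1/2"] e by auto
    have main: "N (\<lambda>x. S n x - S m x) < e" if "n0 \<le> m" "m \<le> n" for m n
    proof -
      have "N (\<lambda>x. S n x - S m x) \<le> 2 * (1/2) ^ m - 2 * (1/2) ^ n" using Sd[of m "n - m"] that by simp
      also have "\<dots> \<le> 2 * (1/2) ^ m" by simp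
      also have "\<dots> \<le> 2 * (1/2) ^ n0" using that by (intro mult_left_mono power_decreasing) auto
      also have "\<dots> < e" using n0 by simp
      finally show ?thesis .
    qed
    show "\<exists>n0::nat. \<forall>m\<ge>n0. \<forall>n\<ge>n0. N (\<lambda>x. S m x - S n x) < e"
    proof (intro exI[of _ n0] allI impI)
      fix m n assume "n0 \<le> m" "n0 \<le> n"
      thus "N (\<lambda>x. S m x - S n x) < e" using main[of m n] main[of n m] sym[of m n] by (cases "m \<le> n") auto
    qed
  qed
  then obtain F where F: "F \<in> X" "(\<lambda>n. N (\<lambda>x. S n x - F x)) \<longlonglongrightarrow> 0"
    using nc SX unfolding norm_complete_def by blast
  have Fm [measurable]: "F \<in> borel_measurable mu" by (rule oi(1)[OF F(1)])
  have SF: "(\<lambda>x. S m x - F x) \<in> X" for m using oi(2)[OF SX oi(3)[OF F(1), of "-1"], of m] by simp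
  have dom: "AE x in mu. g n x \<le> cmod (F x)" for n
  proof -
    define v where "v x = complex_of_real (max 0 (g n x - cmod (F x)))" for x
    have vm: "v \<in> borel_measurable mu" unfolding v_def by measurable
    have vle: "cmod (v x) \<le> cmod (S m x - F x)" if "n < m" for m x
    proof -
      have "g n x \<le> (\<Sum>k<m. g k x)" using that g0 by (intro member_le_sum) auto
      also have "\<dots> = cmod (S m x)" using g0 unfolding S_def norm_of_real by (simp add: sum_nonneg)
      finally have "g n x - cmod (F x) \<le> cmod (S m x - F x)" using norm_triangle_ineq2[of "S m x" "F x"] by linarith
      thus ?thesis by (auto simp: v_def)
    qed
    have vX: "v \<in> X" by (rule oi(4)[OF SF vm]) (use vle[of "Suc n"] in auto)
    have "N v \<le> 0"
    proof (rule LIMSEQ_le_const[OF F(2)])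
      show "\<exists>M. \<forall>m\<ge>M. N v \<le> N (\<lambda>x. S m x - F x)"
        by (intro exI[of _ "Suc n"] allI impI ln(5)[OF SF vX] AE_I2 vle) auto
    qed
    hence "N v = 0" using ln(1)[OF vX] by simp
    hence "AE x in mu. v x = 0" using ln(2)[OF vX] by simp
    thus ?thesis by eventually_elim (auto simp: v_def max_def split: if_splits)
  qed
  have big: "2 ^ n \<le> N (\<lambda>x. F (x / s))" for n
  proof -
    have "(2::real) ^ n = (1/2) ^ n * 4 ^ n" by (simp flip: power_mult_distrib)
    also have "\<dots> \<le> (1/2) ^ n * N (\<lambda>x. f n (x / s))" using f(3)[of n] by (intro mult_left_mono) auto
    also have "\<dots> = N (\<lambda>x. complex_of_real ((1/2) ^ n) * f n (x / s))"
      unfolding ln(3)[OF dil[OF f(1)]] by (simp add: norm_power)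
    also have "\<dots> \<le> N (\<lambda>x. F (x / s))"
    proof (rule ln(5)[OF dil[OF F(1)] oi(3)[OF dil[OF f(1)]]])
      show "AE x in mu. cmod (complex_of_real ((1/2) ^ n) * f n (x / s)) \<le> cmod (F (x / s))"
        using AE_mu_dilation[OF dom[of n] s] by eventually_elim (simp add: g_def norm_mult norm_power)
    qed
    finally show ?thesis .
  qed
  obtain n where "N (\<lambda>x. F (x / s)) < 2 ^ n" using real_arch_pow[of 2] by auto
  thus False using big[of n] by simp
qed

section \<open>The upper Boyd index and integrability\<close>

text \<open>Let \<open>k0 < t\<close> be the norm of the dilation of factor \<open>t\<close> and \<open>K\<close> a number greater than one between
  them. On the whole interval the \<open>n\<close>-fold dilated rearrangement \<open>R\<close> of \<open>f\<close> is at least \<open>R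
  (t\<^sup>-\<^sup>n)\<close>, a constant, so \<open>R (t\<^sup>-\<^sup>n)\<close> is at most a multiple of \<open>K\<^sup>n\<close>. Hence \<open>|f|\<close> exceeds \<open>c K\<^sup>n\<close>
  on a set of measure at most \<open>2 t\<^sup>-\<^sup>n\<close>, and \<open>f\<close> is in \<open>L\<^sup>p\<close> as soon as \<open>K powr p < t\<close>.\<close>

lemma J_nonempty_of_upper_boyd_index:
  assumes ri: "rearrangement_invariant X N" and ub: "upper_boyd_index X N < 1"
  shows "J X \<noteq> {}"
proof -
  have oi: "order_ideal X" and ln: "lattice_norm X N" and sX: "{f. simple_function mu f} \<subseteq> X"
    using ri by (auto simp: rearrangement_invariant_def banach_function_space_def)
  note oi = order_idealD[OF oi] and ln = lattice_normD[OF ln]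
  obtain t where t: "1 < t" and idx: "ln (op_norm X N (dilation (1 / t))) / ln t < 1"
    using ub by (auto simp: upper_boyd_index_def INF_less_iff)
  define k0 where "k0 = op_norm X N (dilation (1 / t))"
  have ln_t: "0 < ln t" using t by simp
  have "k0 < t"
  proof (cases "0 < k0")
    case True
    have "ln k0 < ln t" using idx ln_t by (simp add: k0_def field_simps)
    thus ?thesis using True t by simp
  qed (use t in simp)
  define K where "K = (max k0 1 + t) / 2"
  have K: "1 < K" "K < t" "k0 \<le> K" using \<open>k0 < t\<close> t by (auto simp: K_def)
  have dil: "(\<lambda>x. f (x / s)) \<in> X" if "f \<in> X" "1 \<le> s" for f s by (rule dilation_in_ri_space[OF ri that])
  have dileq: "N (dilation (1 / t) f) = N (\<lambda>x. f (x / t))" if f: "f \<in> X" for f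
  proof -
    have pt: "dilation (1 / t) f x = f (x / t)" if "x \<in> space mu" for x
      using that t by (auto simp: dilation_def field_simps)
    have m: "dilation (1 / t) f \<in> borel_measurable mu"
      using oi(1)[OF dil[OF f, of t]] t by (subst measurable_cong[OF pt]) auto
    have fX: "(\<lambda>x. f (x / t)) \<in> X" using dil[OF f] t by simp
    have dX: "dilation (1 / t) f \<in> X" by (rule oi(4)[OF fX m]) (rule AE_I2, simp add: pt)
    show ?thesis
      by (intro antisym ln(5)[OF fX dX] ln(5)[OF dX fX]; rule AE_I2; simp add: pt)
  qed
  have K1: "N (\<lambda>x. f (x / t)) \<le> K" if f: "f \<in> X" "N f \<le> 1" for f
  proof -
    obtain C where C: "\<forall>f\<in>X. N f \<le> 1 \<longrightarrow> N (\<lambda>x. f (x / t)) \<le> C" using dilation_bounded[OF ri, of t] t by auto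
    have "N (dilation (1 / t) f) \<le> k0"
      unfolding k0_def op_norm_def
    proof (rule cSUP_upper)
      show "f \<in> {f \<in> X. N f \<le> 1}" using f by simp
      show "bdd_above ((\<lambda>f. N (dilation (1 / t) f)) ` {f \<in> X. N f \<le> 1})"
        by (rule bdd_aboveI[of _ C]) (use C dileq in auto)
    qed
    thus ?thesis using dileq[OF f(1)] K by simp
  qed
  have Kb: "N (\<lambda>x. f (x / t)) \<le> K * b" if f: "f \<in> X" "N f \<le> b" "0 < b" for f b
  proof -
    have "N (\<lambda>x. complex_of_real (1 / b) * f (x / t)) \<le> K"
    proof (rule K1)
      show "(\<lambda>x. complex_of_real (1 / b) * f x) \<in> X" by (rule oi(3)[OF f(1)])
      have "N (\<lambda>x. complex_of_real (1 / b) * f x) = (1 / b) * N f"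
        unfolding ln(3)[OF f(1)] using f(3) by (simp add: norm_divide)
      thus "N (\<lambda>x. complex_of_real (1 / b) * f x) \<le> 1" using f by simp
    qed
    moreover have "N (\<lambda>x. complex_of_real (1 / b) * f (x / t)) = (1 / b) * N (\<lambda>x. f (x / t))"
      using ln(3)[OF dil[OF f(1), of t], of "complex_of_real (1 / b)"] f(3) t by (simp add: norm_divide)
    ultimately have "(1 / b) * N (\<lambda>x. f (x / t)) \<le> K" by (simp only:)
    thus ?thesis using f(3) by (simp add: field_simps)
  qed
  have iter: "(\<lambda>x. f (x / t ^ n)) \<in> X \<and> N (\<lambda>x. f (x / t ^ n)) \<le> K ^ n * b" if f: "f \<in> X" "N f \<le> b" "0 < b" for f b n
  proof (induction n)
    case 0
    show ?case using f by simp
  next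
    case (Suc n)
    have eq: "(\<lambda>x. f (x / t ^ Suc n)) = (\<lambda>x. (\<lambda>x. f (x / t ^ n)) (x / t))" by (simp add: field_simps)
    have "N (\<lambda>x. (\<lambda>x. f (x / t ^ n)) (x / t)) \<le> K * (K ^ n * b)"
      by (rule Kb) (use Suc f K in auto)
    moreover have "(\<lambda>x. (\<lambda>x. f (x / t ^ n)) (x / t)) \<in> X" 
      by (rule dil[of "\<lambda>x. f (x / t ^ n)"]) (use Suc t in auto)
    ultimately show ?case unfolding eq by (simp add: mult.assoc)
  qed
  have oneX: "(\<lambda>x. 1) \<in> X" using sX by auto
  have "\<not> (AE x in mu. (1::complex) = 0)"
  proof
    assume "AE x in mu. (1::complex) = 0"
    hence "AE x in mu. False" by simp
    then obtain Z where "{x \<in> space mu. \<not> False} \<subseteq> Z" "emeasure mu Z = 0" "Z \<in> sets mu" by (rule AE_E)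
    hence "emeasure mu (space mu) \<le> 0" using emeasure_mono[of "space mu" Z mu] by (simp del: space_mu)
    thus False by (simp add: emeasure_mu)
  qed
  hence N1: "0 < N (\<lambda>x. 1)" using ln(1,2)[OF oneX] by (smt (verit))
  \<comment> \<open>halfway between 1 and the exponent at which \<open>K powr p = t\<close>\<close>
  define p where "p = (1 + ln t / ln K) / 2"
  have lnK: "0 < ln K" "ln K < ln t" using K by auto
  have p: "1 < p" using lnK by (simp add: p_def field_simps)
  have "p * ln K < ln t" using lnK by (simp add: p_def field_simps)
  hence "exp (p * ln K) < exp (ln t)" by simp
  hence Kp: "K powr p < t" using K t by (simp add: powr_def)
  have "f \<in> Lp p" if f: "f \<in> X" for f
  proof -
    have fm [measurable]: "f \<in> borel_measurable mu" by (rule oi(1)[OF f])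
    let ?R = "\<lambda>x. complex_of_real (symmetric_rearrangement f x)"
    have RX: "?R \<in> X" by (rule symmetric_rearrangement_in_ri_space[OF ri f])
    define b where "b = N ?R + 1"
    have b: "N ?R \<le> b" "0 < b" using ln(1)[OF RX] by (auto simp: b_def)
    define c where "c = b / N (\<lambda>x. 1)"
    have c: "0 < c" using b N1 by (simp add: c_def)
    have decay: "distribution_function f (c * K ^ n) \<le> 2 * (1 / t) ^ n" for n
    proof (rule ccontr)
      assume neg: "\<not> ?thesis"
      have l0: "0 \<le> c * K ^ n" using c K by simp
      have gt: "c * K ^ n < symmetric_rearrangement f (x / t ^ n)" if "x \<in> {-1<..<1}" "x \<noteq> 0" for x
      proof (subst symmetric_rearrangement_greater_iff[OF fm l0], intro conjI)
        show "x / t ^ n \<noteq> 0" using that t by simp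
        have "2 * \<bar>x / t ^ n\<bar> = 2 * \<bar>x\<bar> * (1 / t) ^ n" using t by (simp add: abs_div power_divide)
        also have "\<dots> \<le> 2 * 1 * (1 / t) ^ n" using that t by (intro mult_right_mono) auto
        finally show "2 * \<bar>x / t ^ n\<bar> < distribution_function f (c * K ^ n)" using neg by simp
      qed
      define l where "l = symmetric_rearrangement f (1 / t ^ n)"
      have gtl: "c * K ^ n < l"
        unfolding l_def using neg t by (subst symmetric_rearrangement_greater_iff[OF fm l0]) (simp add: power_divide)
      have ge: "l \<le> symmetric_rearrangement f (x / t ^ n)" if x: "x \<in> {-1<..<1}" "x \<noteq> 0" for x
      proof (rule ccontr)
        assume lt: "\<not> ?thesis"
        define r where "r = symmetric_rearrangement f (x / t ^ n)"
        have r0: "0 \<le> r" unfolding r_def by (rule symmetric_rearrangement_nonneg[OF fm])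
        have "r < symmetric_rearrangement f (1 / t ^ n)" using lt by (simp add: r_def l_def)
        hence "2 * \<bar>1 / t ^ n\<bar> < distribution_function f r" using symmetric_rearrangement_greater_iff[OF fm r0] by blast
        moreover have "\<bar>x / t ^ n\<bar> \<le> \<bar>1 / t ^ n\<bar>" using x t by (auto simp: abs_div intro!: divide_right_mono)
        ultimately have "r < symmetric_rearrangement f (x / t ^ n)"
          using x t by (subst symmetric_rearrangement_greater_iff[OF fm r0]) auto
        thus False by (simp add: r_def)
      qed
      have "l * N (\<lambda>x. 1) = N (\<lambda>x. complex_of_real l * 1)"
        using ln(3)[OF oneX, of "complex_of_real l"] gtl l0 by simp
      also have "\<dots> \<le> N (\<lambda>x. ?R (x / t ^ n))"
      proof (rule ln(5))
        show "(\<lambda>x. ?R (x / t ^ n)) \<in> X" using iter[OF RX b] by blast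
        show "(\<lambda>x. complex_of_real l * 1) \<in> X" by (rule oi(3)[OF oneX])
        have "AE x in mu. x \<noteq> 0" unfolding AE_mu_iff using AE_lborel_singleton[of 0] by eventually_elim simp
        thus "AE x in mu. cmod (complex_of_real l * 1) \<le> cmod (?R (x / t ^ n))"
          using AE_mu_space
        proof eventually_elim
          case (elim x)
          thus ?case using ge[of x] gtl l0 symmetric_rearrangement_nonneg[OF fm, of "x / t ^ n"] by simp
        qed
      qed
      also have "\<dots> \<le> K ^ n * b" using iter[OF RX b] by blast
      also have "\<dots> = c * K ^ n * N (\<lambda>x. 1)" using N1 by (simp add: c_def)
      finally show False using gtl N1 by simp
    qed
    have term_le_suminf: "F j \<le> (\<Sum>n. F n)" for F :: "nat \<Rightarrow> ennreal" and j
      using sum_le_suminf[of F "{j}"] by (simp add: summableI)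
    let ?A = "\<lambda>n. {x \<in> space mu. c * K ^ n < cmod (f x)}"
    have pt: "ennreal (cmod (f x) powr p) \<le> ennreal (c powr p) + (\<Sum>n. ennreal ((c * K ^ Suc n) powr p) * indicator (?A n) x)"
      if x: "x \<in> space mu" for x
    proof (cases "cmod (f x) \<le> c")
      case True
      have "cmod (f x) powr p \<le> c powr p" using True p by (intro powr_mono2) auto
      hence "ennreal (cmod (f x) powr p) \<le> ennreal (c powr p) + 0" by (simp add: ennreal_leI)
      also have "\<dots> \<le> ennreal (c powr p) + (\<Sum>n. ennreal ((c * K ^ Suc n) powr p) * indicator (?A n) x)"
        by (intro add_left_mono) simp
      finally show ?thesis .
    next
      case False
      \<comment> \<open>the last level that \<open>|f x|\<close> exceeds is the one below \<open>m\<close>\<close>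
      define m where "m = (LEAST n. cmod (f x) \<le> c * K ^ n)"
      obtain n where "cmod (f x) / c < K ^ n" using real_arch_pow[of K] K by auto
      hence ex: "cmod (f x) \<le> c * K ^ n" using c by (simp add: field_simps)
      have m1: "cmod (f x) \<le> c * K ^ m" unfolding m_def by (rule LeastI[of _ n]) (rule ex)
      have "m \<noteq> 0" using m1 False by (intro notI) simp
      then obtain j where j: "m = Suc j" by (cases m) auto
      have "\<not> cmod (f x) \<le> c * K ^ j" by (rule not_less_Least[of j "\<lambda>n. cmod (f x) \<le> c * K ^ n", folded m_def]) (simp add: j)
      hence xA: "x \<in> ?A j" using x by simp
      have "cmod (f x) powr p \<le> (c * K ^ Suc j) powr p" using m1 p unfolding j by (intro powr_mono2) auto
      hence "ennreal (cmod (f x) powr p) \<le> ennreal ((c * K ^ Suc j) powr p) * indicator (?A j) x"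
        using xA by (simp add: ennreal_leI)
      also have "\<dots> \<le> (\<Sum>n. ennreal ((c * K ^ Suc n) powr p) * indicator (?A n) x)"
        by (rule term_le_suminf)
      also have "\<dots> \<le> ennreal (c powr p) + (\<Sum>n. ennreal ((c * K ^ Suc n) powr p) * indicator (?A n) x)"
        by (rule add_increasing) auto
      finally show ?thesis .
    qed
    have Am: "?A n \<in> sets mu" for n by (rule level_set_measurable[OF fm])
    define q where "q = K powr p / t"
    have q: "0 \<le> q" "q < 1" using Kp t by (auto simp: q_def)
    have term_le: "ennreal ((c * K ^ Suc n) powr p) * emeasure mu (?A n) \<le> ennreal (2 * (c * K) powr p * q ^ n)" for n
    proof -
      have "(c * K ^ Suc n) powr p = (c * K) powr p * (K powr p) ^ n"
      proof -
        have "(c * K ^ Suc n) powr p = (c * K * K ^ n) powr p" by (simp only: power_Suc mult.assoc)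
        also have "\<dots> = (c * K) powr p * (K ^ n) powr p" using c K by (subst powr_mult) auto
        also have "(K ^ n) powr p = (K powr p) ^ n" using K by (simp add: powr_realpow[symmetric] powr_powr mult.commute)
        finally show ?thesis .
      qed
      moreover have "measure mu (?A n) \<le> 2 * (1 / t) ^ n" using decay[of n] by (simp add: distribution_function_def)
      ultimately have "(c * K ^ Suc n) powr p * measure mu (?A n) \<le> ((c * K) powr p * (K powr p) ^ n) * (2 * (1 / t) ^ n)"
        by (metis mult_left_mono powr_ge_zero)
      also have "\<dots> = 2 * (c * K) powr p * q ^ n" by (simp add: q_def power_divide)
      finally show ?thesis by (simp add: mu.emeasure_eq_measure ennreal_leI flip: ennreal_mult)
    qed
    have "(\<integral>\<^sup>+x. ennreal (cmod (f x) powr p) \<partial>mu)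
      \<le> (\<integral>\<^sup>+x. ennreal (c powr p) + (\<Sum>n. ennreal ((c * K ^ Suc n) powr p) * indicator (?A n) x) \<partial>mu)"
      by (rule nn_integral_mono) (rule pt)
    also have "\<dots> = ennreal (c powr p) * emeasure mu (space mu) + (\<integral>\<^sup>+x. (\<Sum>n. ennreal ((c * K ^ Suc n) powr p) * indicator (?A n) x) \<partial>mu)"
      by (subst nn_integral_add) (use Am in \<open>auto intro!: borel_measurable_suminf_order\<close>)
    also have "(\<integral>\<^sup>+x. (\<Sum>n. ennreal ((c * K ^ Suc n) powr p) * indicator (?A n) x) \<partial>mu)
      = (\<Sum>n. \<integral>\<^sup>+x. ennreal ((c * K ^ Suc n) powr p) * indicator (?A n) x \<partial>mu)"
      by (rule nn_integral_suminf) (use Am in auto)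
    also have "\<dots> = (\<Sum>n. ennreal ((c * K ^ Suc n) powr p) * emeasure mu (?A n))"
      by (intro suminf_cong nn_integral_cmult_indicator Am)
    also have "\<dots> \<le> (\<Sum>n. ennreal (2 * (c * K) powr p * q ^ n))"
      by (intro suminf_le term_le summableI)
    also have "\<dots> = ennreal (\<Sum>n. 2 * (c * K) powr p * q ^ n)"
      by (rule suminf_ennreal2) (use q in \<open>auto intro!: summable_mult summable_geometric\<close>)
    finally have "(\<integral>\<^sup>+x. ennreal (cmod (f x) powr p) \<partial>mu)
      \<le> ennreal (c powr p) * emeasure mu (space mu) + ennreal (\<Sum>n. 2 * (c * K) powr p * q ^ n)"
      by (simp add: add_left_mono)
    also have "\<dots> < \<infinity>" by (simp add: mu.emeasure_eq_measure ennreal_mult_less_top)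
    finally have "(\<integral>\<^sup>+x. ennreal (cmod (f x) powr p) \<partial>mu) < \<infinity>" .
    hence "integrable mu (\<lambda>x. cmod (f x) powr p)" by (intro integrableI_nonneg) auto
    thus ?thesis using fm by (simp add: Lp_iff)
  qed
  hence "p \<in> J X" using p by (auto simp: J_def)
  thus ?thesis by blast
qed

section \<open>The integral representation\<close>

theorem proposition4p3:
  fixes X :: "(real \<Rightarrow> complex) set" and N :: "(real \<Rightarrow> complex) \<Rightarrow> real"
  assumes "rearrangement_invariant X N"
    and "0 < lower_boyd_index X N"
    and "lower_boyd_index X N \<le> upper_boyd_index X N"
    and "upper_boyd_index X N < 1"
  shows "optimal_domain X \<subseteq> L1_m_hat X \<and>
    (\<forall>f\<in>optimal_domain X. \<forall>A\<in>sets mu.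
       finite_hilbert (\<lambda>x. f x * indicator A x) \<in> X \<and>
       (AE x in mu. m_hat_integral X A f x = finite_hilbert (\<lambda>x. f x * indicator A x) x)) \<and>
    (\<forall>f\<in>optimal_domain X. \<forall>g\<in>optimal_domain X. \<forall>a b.
       (\<lambda>x. a * f x + b * g x) \<in> optimal_domain X \<and>
       (AE x in mu. finite_hilbert (\<lambda>x. a * f x + b * g x) x =
          a * finite_hilbert f x + b * finite_hilbert g x)) \<and>
    (\<forall>f\<in>optimal_domain X.
       finite_hilbert f \<in> X \<and>
       (AE x in mu. finite_hilbert f x = m_hat_integral X {-1<..<1} f x))"
proof -
  have oi: "order_ideal X" using assms(1) by (simp add: rearrangement_invariant_def banach_function_space_def)
  note oi = order_idealD[OF oi]
  obtain p where p: "p \<in> J X" using J_nonempty_of_upper_boyd_index[OF assms(1,4)] by blast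
  have XX: "X \<subseteq> X_hat X" by (auto simp: X_hat_def J_def)
  have fi: "integrable mu f" if "f \<in> optimal_domain X" for f using that by (simp add: optimal_domain_def)
  have TA: "finite_hilbert (\<lambda>x. f x * indicator A x) \<in> X" if f: "f \<in> optimal_domain X" and A: "A \<in> sets mu" for f A
  proof (rule optimal_domain_dominated[OF f])
    show "(\<lambda>x. f x * indicator A x) \<in> borel_measurable mu"
      using borel_measurable_integrable[OF fi[OF f]] A by measurable
    show "AE x in mu. cmod (f x * indicator A x) \<le> cmod (f x)" by (intro AE_I2) (simp add: indicator_def)
  qed
  have isint: "is_m_hat_integral X A f (finite_hilbert (\<lambda>x. f x * indicator A x))"
    if f: "f \<in> optimal_domain X" and A: "A \<in> sets mu" for f A
    unfolding is_m_hat_integral_def X_hat_dual_def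
    using TA[OF f A] XX optimal_domain_scalar_integral(2)[OF f _ _ A] by blast
  have unique: "AE x in mu. h' x = h x" if "is_m_hat_integral X A f h" "is_m_hat_integral X A f h'" for A f h h'
    by (rule pairing_separates_points[OF p]) (use that in \<open>auto simp: is_m_hat_integral_def\<close>)
  have L1: "f \<in> L1_m_hat X" if f: "f \<in> optimal_domain X" for f
    unfolding L1_m_hat_def mem_Collect_eq
  proof (intro conjI ballI)
    show "scalarly_m_hat_integrable X f"
      unfolding scalarly_m_hat_integrable_def X_hat_dual_def L0_def
      using borel_measurable_integrable[OF fi[OF f]] optimal_domain_scalar_integral(1)[OF f] by blast
    fix A assume A: "A \<in> sets mu"
    show "\<exists>h. is_m_hat_integral X A f h \<and> (\<forall>h'. is_m_hat_integral X A f h' \<longrightarrow> (AE x in mu. h' x = h x))"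
      using isint[OF f A] unique by blast
  qed
  have rep: "AE x in mu. m_hat_integral X A f x = finite_hilbert (\<lambda>x. f x * indicator A x) x"
    if f: "f \<in> optimal_domain X" and A: "A \<in> sets mu" for f A
    unfolding m_hat_integral_def by (rule unique[OF isint[OF f A]]) (rule someI[of "is_m_hat_integral X A f", OF isint[OF f A]])
  have lin: "AE x in mu. finite_hilbert (\<lambda>x. a * f x + b * g x) x = a * finite_hilbert f x + b * finite_hilbert g x"
    if "f \<in> optimal_domain X" "g \<in> optimal_domain X" for f g a b
    by (rule finite_hilbert_linear[OF fi[OF that(1)] fi[OF that(2)]])
  have piece: "finite_hilbert h \<in> X"
    if f: "f \<in> optimal_domain X" and h [measurable]: "h \<in> borel_measurable mu" and le: "AE x in mu. cmod (h x) \<le> cmod a * cmod (f x)" for f h a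
  proof -
    \<comment> \<open>adding 1 avoids a division by zero when \<open>a = 0\<close>\<close>
    let ?c = "complex_of_real (cmod a + 1)"
    let ?k = "\<lambda>x. inverse ?c * h x"
    have c: "cmod ?c = cmod a + 1" "?c \<noteq> 0"
      using norm_ge_zero[of a] by (simp_all only: norm_of_real of_real_eq_0_iff)
    have kle: "AE x in mu. cmod (?k x) \<le> cmod (f x)"
      using le
    proof eventually_elim
      case (elim x)
      have "cmod (h x) \<le> (cmod a + 1) * cmod (f x)" using elim by (simp add: distrib_right add_increasing2)
      hence "cmod (h x) / (cmod a + 1) \<le> cmod (f x)"
        using norm_ge_zero[of a] by (subst pos_divide_le_eq) (auto simp: mult.commute add_nonneg_pos)
      thus ?case unfolding norm_mult norm_inverse c(1) by (simp add: field_simps)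
    qed
    have km [measurable]: "?k \<in> borel_measurable mu" by measurable
    have ki: "integrable mu ?k" by (rule Bochner_Integration.integrable_bound[OF fi[OF f] km kle])
    have hk: "(\<lambda>x. ?c * ?k x) = h"
      by (rule ext) (use c(2) in \<open>simp only: mult.assoc[symmetric] right_inverse mult_1 not_False_eq_True\<close>)
    have hi: "integrable mu h" using integrable_mult_right[OF ki, of ?c] unfolding hk .
    have TkX: "finite_hilbert ?k \<in> X" by (rule optimal_domain_dominated[OF f km kle])
    show ?thesis
    proof (rule oi(4)[OF oi(3)[OF TkX, of ?c] finite_hilbert_measurable[OF hi]])
      have "AE x in mu. finite_hilbert (\<lambda>x. ?c * ?k x + 0 * ?k x) x = ?c * finite_hilbert ?k x + 0 * finite_hilbert ?k x"
        by (rule finite_hilbert_linear[OF ki ki])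
      moreover have "(\<lambda>x. ?c * ?k x + 0 * ?k x) = h" by (simp only: mult_zero_left add_0_right hk)
      ultimately have "AE x in mu. finite_hilbert h x = ?c * finite_hilbert ?k x" by simp
      thus "AE x in mu. cmod (finite_hilbert h x) \<le> cmod (?c * finite_hilbert ?k x)" by eventually_elim simp
    qed
  qed
  have comb: "(\<lambda>x. a * f x + b * g x) \<in> optimal_domain X"
    if f: "f \<in> optimal_domain X" and g: "g \<in> optimal_domain X" for f g a b
    unfolding optimal_domain_def mem_Collect_eq L0_def
  proof (intro conjI ballI impI)
    note [measurable] = borel_measurable_integrable[OF fi[OF f]] borel_measurable_integrable[OF fi[OF g]]
    show "integrable mu (\<lambda>x. a * f x + b * g x)" using fi[OF f] fi[OF g] by simp
    fix h :: "real \<Rightarrow> complex"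
    assume hm [measurable]: "h \<in> borel_measurable mu" and le: "AE x in mu. norm (h x) \<le> norm (a * f x + b * g x)"
    let ?u = "\<lambda>x. cmod (a * f x)" and ?v = "\<lambda>x. cmod (b * g x)"
    \<comment> \<open>split \<open>h\<close> in proportion to the two terms that dominate it\<close>
    define h1 h2 where "h1 x = h x * of_real (?u x / (?u x + ?v x))" and "h2 x = h x * of_real (?v x / (?u x + ?v x))" for x
    have [measurable]: "h1 \<in> borel_measurable mu" "h2 \<in> borel_measurable mu" unfolding h1_def h2_def by measurable
    have le': "AE x in mu. cmod (h x) \<le> ?u x + ?v x" using le by eventually_elim (rule order_trans[OF _ norm_triangle_ineq])
    have frac: "r * (s / (s + s')) \<le> s" if "0 \<le> r" "r \<le> s + s'" "0 \<le> s" "0 \<le> s'" for r s s' :: real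
      using that mult_right_mono[OF that(2,3)] by (cases "s + s' = 0") (auto simp: field_simps)
    have nh: "cmod (h1 x) = cmod (h x) * (?u x / (?u x + ?v x))" "cmod (h2 x) = cmod (h x) * (?v x / (?v x + ?u x))" for x
      unfolding h1_def h2_def norm_mult[of "h x"] norm_of_real by (simp_all add: add.commute)
    have T1: "finite_hilbert h1 \<in> X"
    proof (rule piece[OF f])
      show "AE x in mu. cmod (h1 x) \<le> cmod a * cmod (f x)"
        using le'
      proof eventually_elim
        case (elim x)
        have "cmod (h1 x) \<le> ?u x" unfolding nh by (rule frac) (use elim in auto)
        thus ?case by (simp only: norm_mult)
      qed
    qed measurable
    have T2: "finite_hilbert h2 \<in> X"
    proof (rule piece[OF g])
      show "AE x in mu. cmod (h2 x) \<le> cmod b * cmod (g x)"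
        using le'
      proof eventually_elim
        case (elim x)
        have "cmod (h2 x) \<le> ?v x" unfolding nh by (rule frac) (use elim in auto)
        thus ?case by (simp only: norm_mult)
      qed
    qed measurable
    have hi: "integrable mu h"
      by (rule Bochner_Integration.integrable_bound[OF _ hm le]) (use fi[OF f] fi[OF g] in simp)
    have ratio: "s / (s + s') \<le> 1" if "0 \<le> s" "0 \<le> s'" for s s' :: real
      using that by (cases "s + s' = 0") (auto simp: divide_le_eq_1)
    have hb: "cmod (h1 x) \<le> cmod (h x)" "cmod (h2 x) \<le> cmod (h x)" for x
      unfolding nh by (intro mult_left_le ratio norm_ge_zero)+
    have h12i: "integrable mu h1" "integrable mu h2"
      by (rule Bochner_Integration.integrable_bound[OF hi]; use hb in auto)+
    have ae: "AE x in mu. h x = 1 * h1 x + 1 * h2 x"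
      using le'
    proof eventually_elim
      case (elim x)
      show ?case
      proof (cases "?u x + ?v x = 0")
        case True
        hence "h x = 0" using elim by simp
        thus ?thesis by (simp add: h1_def h2_def)
      next
        case False
        have "?u x / (?u x + ?v x) + ?v x / (?u x + ?v x) = 1" using False by (simp flip: add_divide_distrib)
        hence "h x * of_real (?u x / (?u x + ?v x) + ?v x / (?u x + ?v x)) = h x" by simp
        thus ?thesis by (simp only: h1_def h2_def of_real_add distrib_left mult_1)
      qed
    qed
    show "finite_hilbert h \<in> X"
    proof (rule oi(4)[OF oi(2)[OF T1 T2] finite_hilbert_measurable[OF hi]])
      show "AE x in mu. cmod (finite_hilbert h x) \<le> cmod (finite_hilbert h1 x + finite_hilbert h2 x)"
        using finite_hilbert_linear[OF h12i, of 1 1] AE_mu_space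
      proof eventually_elim
        case (elim x)
        have "finite_hilbert h x = finite_hilbert (\<lambda>x. 1 * h1 x + 1 * h2 x) x"
          by (rule finite_hilbert_cong_AE[OF hi _ ae elim(2)]) measurable
        thus ?case using elim(1) by simp
      qed
    qed
  qed
  have all: "AE x in mu. finite_hilbert f x = m_hat_integral X {-1<..<1} f x" if f: "f \<in> optimal_domain X" for f
  proof -
    have S: "{-1<..<1} \<in> sets mu" by (simp add: sets_mu)
    show ?thesis using rep[OF f S] AE_mu_space
    proof eventually_elim
      case (elim x)
      have "finite_hilbert f x = finite_hilbert (\<lambda>x. f x * indicator {-1<..<1} x) x"
        using borel_measurable_integrable[OF fi[OF f]] S
        by (intro finite_hilbert_cong_AE[OF fi[OF f] _ _ elim(2)]) (auto intro!: AE_I2)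
      thus ?case using elim(1) by simp
    qed
  qed
  have Tf: "finite_hilbert f \<in> X" if f: "f \<in> optimal_domain X" for f
    by (rule optimal_domain_dominated[OF f borel_measurable_integrable[OF fi[OF f]]]) simp
  have "optimal_domain X \<subseteq> L1_m_hat X" using L1 by (rule subsetI)
  thus ?thesis by (intro conjI ballI allI) (assumption | erule (1) TA rep comb lin | erule Tf all)+
qed

end
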